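(* Let $g$ be the accelerating Kerr-(anti-)de Sitter metric with real parameters $a,m,\Lambda,\alpha$ (see context). Then the Karlhede invariant $\mathfrak K=\nabla_\mu R_{\alpha\beta\gamma\delta}\nabla^\mu R^{\alpha\beta\gamma\delta}$ of $g$ equals $$\mathfrak K=\frac{-720\,m^2(\alpha r\cos\theta-1)^6}{(r^2+a^2\cos^2\theta)^9}\sum_{i=0}^{12}k_i\cos^i\theta,$$ where $$\begin{aligned} k_0=&-\Big[r\alpha^2(\alpha^2+\tfrac\Lambda3)a^4+\Big(\tfrac{r^3\alpha^2\Lambda}{3}-2mr^2\alpha^4+(2\alpha^2-\tfrac\Lambda3)r+2\alpha^2m\Big)a^2+2\alpha^2mr^2-\tfrac{\Lambda r^3}{3}-2m+r\Big]r^9,\\ k_1=&\;2\alpha\Big(\big(\alpha^2m-\tfrac{8r\Lambda}{3}\big)a^4+\big(-\alpha^4mr^4+20\alpha^2mr^2-\tfrac83\Lambda r^3-17m\big)a^2+\alpha^2mr^4\Big)r^8,\\ k_2=&\;27\Big(r\alpha^2(\alpha^2+\tfrac\Lambda3)a^6+\Big(\tfrac{\alpha^4(\alpha^2+\frac\Lambda3)r^5}{27}+\tfrac{28r^3\alpha^2\Lambda}{81}-\tfrac{88mr^2\alpha^4}{27}+(2\alpha^2-\tfrac\Lambda3)r+\tfrac{88\alpha^2m}{27}\Big)a^4\\ &+\Big(\tfrac{2\alpha^2(\alpha^2+\frac\Lambda2)r^5}{27}-\tfrac{40\alpha^4mr^4}{27}-\tfrac{28\Lambda r^3}{81}+\tfrac{32\alpha^2mr^2}{9}+r-\tfrac{56m}{27}\Big)a^2+\tfrac{\alpha^2r^5}{27}\Big)r^7,\\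 k_3=&-56\alpha\Big(\big(\alpha^2m-\tfrac{4r\Lambda}{7}\big)a^6+\big(-\tfrac{11}{7}\alpha^4mr^4+\tfrac{241}{28}\alpha^2mr^2-\tfrac23\Lambda r^3-5m\big)a^4\\ &-\tfrac{(\alpha^4mr^4-48\alpha^2mr^2+\frac83\Lambda r^3+17m)r^2a^2}{28}+\tfrac{\alpha^2mr^6}{28}\Big)r^6,\\ k_4=&-42\Big[r\alpha^2(\alpha^2+\tfrac\Lambda3)a^6+\Big(\tfrac{9\alpha^4(\alpha^2+\frac\Lambda3)r^5}{14}+\tfrac{23r^3\alpha^2\Lambda}{42}-\tfrac{26mr^2\alpha^4}{3}+(2\alpha^2-\tfrac\Lambda3)r+\tfrac{26\alpha^2m}{3}\Big)a^4\\ &+\Big(\tfrac{mr^6\alpha^6}{21}+\tfrac{9\alpha^2(\alpha^2+\frac\Lambda2)r^5}{7}-\tfrac{241\alpha^4mr^4}{21}-\tfrac{23\Lambda r^3}{42}+\tfrac{310\alpha^2mr^2}{21}+r-\tfrac{10m}{3}\Big)a^2\\ &-\tfrac{17\alpha^2r^4(\alpha^2mr^2-m-\frac{27}{34}r)}{21}\Big]a^2r^5,\\ k_5=&\;140\Big(a^6\alpha^2m+\big(-\tfrac{13}{5}\alpha^4mr^4+\tfrac{38}{5}\alpha^2mr^2-\tfrac{8}{35}\Lambda r^3-\tfrac{13}{5}m\big)a^4\\ &+\big[-\tfrac{22}{35}\alpha^4mr^6+\tfrac{31}{7}\alpha^2mr^4-\tfrac8{35}\Lambda r^5-2mr^2\big]a^2+\tfrac{2\alpha^2mr^6}{5}\Big)\alpha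 a^2r^4,\\ k_6=&-42\Big(r\alpha^2(\alpha^2+\tfrac\Lambda3)a^6+\Big((-\alpha^6-\tfrac13\Lambda\alpha^4)r^5+\tfrac{20mr^2\alpha^4}{3}+(2\alpha^2-\tfrac\Lambda3)r-\tfrac{20\alpha^2m}{3}\Big)a^4\\ &+\Big(-\tfrac{4mr^6\alpha^6}{3}+(-2\alpha^4-\Lambda\alpha^2)r^5+\tfrac{76\alpha^4mr^4}{3}-\tfrac{76\alpha^2mr^2}{3}+r+\tfrac{4m}{3}\Big)a^2\\ &+\tfrac{20\alpha^2(\alpha^2mr^2-m-\frac3{20}r)r^4}{3}\Big)a^4r^3,\\ k_7=&-56\alpha\Big(\big(\alpha^2m+\tfrac{4r\Lambda}{7}\big)a^6+\big(-5\alpha^4mr^4+\tfrac{155}{14}\alpha^2mr^2+\tfrac47\Lambda r^3-\tfrac{11}{7}m\big)a^4\\ &-\tfrac{13(\alpha^4r^4-\frac{38}{13}\alpha^2r^2+1)mr^2a^2}{2}+\tfrac{5\alpha^2mr^6}{2}\Big)a^4r^2,\\ k_8=&\;27\Big[r\alpha^2(\alpha^2+\tfrac\Lambda3)a^6+\Big(\tfrac{14\alpha^4(\alpha^2+\frac\Lambda3)r^5}{9}+\tfrac{23r^3\alpha^2\Lambda}{27}+\tfrac{34mr^2\alpha^4}{27}+(2\alpha^2-\tfrac\Lambda3)r-\tfrac{34\alpha^2m}{27}\Big)a^4\\ &+\Big(-\tfrac{140mr^6\alpha^6}{27}+\tfrac{28\alpha^2(\alpha^2+\frac\Lambda2)r^5}{9}+\tfrac{620\alpha^4mr^4}{27}-\tfrac{23\Lambda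 r^3}{27}-\tfrac{482\alpha^2mr^2}{27}+r+\tfrac{2m}{27}\Big)a^2\\ &+\tfrac{364\alpha^2r^4(\alpha^2mr^2-m+\frac3{26}r)}{27}\Big]a^6r,\\ k_9=&\;2\alpha a^6\Big(\big(\alpha^2m+\tfrac{8r\Lambda}{3}\big)a^6+\big(-17\alpha^4mr^4+48\alpha^2mr^2+\tfrac{56}{3}\Lambda r^3-m\big)a^4\\ &+\big[-140\alpha^4mr^6+241\alpha^2mr^4+16\Lambda r^5-44mr^2\big]a^2+28\alpha^2mr^6\Big),\\ k_{10}=&-\Big(\alpha^2(\alpha^2+\tfrac\Lambda3)a^6+\Big((27\alpha^6+9\Lambda\alpha^4)r^4+\tfrac{28\Lambda\alpha^2r^2}{3}+2\alpha^2-\tfrac\Lambda3\Big)a^4\\ &+\Big[1-56\alpha^6mr^5+(54\alpha^4+27\Lambda\alpha^2)r^4+96\alpha^4mr^3-\tfrac{28\Lambda r^2}{3}-40\alpha^2mr\Big]a^2\\ &+88\alpha^2\big(\alpha^2mr^2-m+\tfrac{27}{88}r\big)r^3\Big)a^8,\\ k_{11}=&-2\alpha a^8\Big(\big(\alpha^2m+\tfrac{8r\Lambda}{3}\big)a^4+\big(-17\alpha^4mr^4+20\alpha^2mr^2+\tfrac83\Lambda r^3-m\big)a^2+\alpha^2mr^4\Big),\\ k_{12}=&\Big[\alpha^2\Big\{\alpha^2(\alpha^2+\tfrac\Lambda3)r^2+\tfrac\Lambda3\Big\}a^4+\Big(-2\alpha^6mr^3+(2\alpha^4+\Lambda\alpha^2)r^2+2\alpha^4mr-\tfrac\Lambda3\Big)a^2\\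 &+2\alpha^2\big(\alpha^2mr^2-m+\tfrac12r\big)r\Big]a^{10}. \end{aligned}$$
   Context: Accelerating Kerr black hole in (anti-)de Sitter spacetime: in coordinates $(t,r,\theta,\phi)$, signature $(-,+,+,+)$, $$ds^2=\frac1{\Omega^2}\Big\{-\frac{Q}{\rho^2}\big[dt-a\sin^2\theta\,d\phi\big]^2+\frac{\rho^2}{Q}dr^2+\frac{\rho^2}{P}d\theta^2+\frac{P}{\rho^2}\sin^2\theta\big[a\,dt-(r^2+a^2)d\phi\big]^2\Big\},$$ $\Omega=1-\alpha r\cos\theta$, $\rho^2=r^2+a^2\cos^2\theta$, $P=1-2\alpha m\cos\theta+(\alpha^2a^2+\frac13\Lambda a^2)\cos^2\theta$, $Q=(a^2-2mr+r^2)(1-\alpha^2r^2)-\frac13\Lambda(a^2+r^2)r^2$. Here $\alpha$ is the acceleration parameter, $a$ the Kerr parameter, $m$ the mass, $\Lambda$ the cosmological constant. The identity is on the domain where the metric is regular ($\Omega>0$, $\rho^2\ne0$, $Q\neq0$, $P>0$, $\sin\theta\neq0$). $R_{\alpha\beta\gamma\delta}$ is the Riemann tensor (its Greek indices are unrelated to the parameter $\alpha$) and $\nabla$ the Levi-Civita connection of $g$. *)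

theory Defs
  imports "HOL-Analysis.Analysis"
begin

section \<open>Levi-Civita calculus in one coordinate chart\<close>

text \<open>
  A metric is given by its component matrix as a function of the coordinates. It need not be positive
  definite. Tensor fields are given by their components; the point of evaluation is the last
  argument. Every notion at a point depends only on the metric near that point, so values outside
  the domain of the chart are irrelevant.
\<close>

type_synonym 'n metric = "real^'n \<Rightarrow> real^'n^'n"

definition partial_deriv :: "'n::finite \<Rightarrow> (real^'n \<Rightarrow> real) \<Rightarrow> real^'n \<Rightarrow> real" where
  "partial_deriv i f x = deriv (\<lambda>s. f (x + s *\<^sub>R axis i 1)) 0"

definition inv_metric :: "'n::finite metric \<Rightarrow> 'n metric" where
  "inv_metric g x = matrix_inv (g x)"

text \<open>Here \<open>christoffel g i j k\<close> has \<open>i\<close> as its upper index.\<close>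

definition christoffel :: "'n::finite metric \<Rightarrow> 'n \<Rightarrow> 'n \<Rightarrow> 'n \<Rightarrow> real^'n \<Rightarrow> real" where
  "christoffel g i j k x =
     1/2 * (\<Sum>l\<in>UNIV. inv_metric g x $ i $ l *
       (partial_deriv j (\<lambda>y. g y $ l $ k) x + partial_deriv k (\<lambda>y. g y $ l $ j) x
         - partial_deriv l (\<lambda>y. g y $ j $ k) x))"

text \<open>
  In \<open>riemann_up g i j k l\<close> the index \<open>i\<close> is the upper one, with the convention that
  \<open>(\<nabla>\<^sub>k \<nabla>\<^sub>l - \<nabla>\<^sub>l \<nabla>\<^sub>k) V\<^sup>i\<close> is the sum over \<open>j\<close> of
  \<open>riemann_up g i j k l\<close> times \<open>V\<^sup>j\<close>. The opposite sign convention gives the same value of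
  \<open>karlhede_invariant\<close> below.
\<close>

definition riemann_up :: "'n::finite metric \<Rightarrow> 'n \<Rightarrow> 'n \<Rightarrow> 'n \<Rightarrow> 'n \<Rightarrow> real^'n \<Rightarrow> real" where
  "riemann_up g i j k l x =
     partial_deriv k (christoffel g i l j) x - partial_deriv l (christoffel g i k j) x
     + (\<Sum>e\<in>UNIV. christoffel g i k e x * christoffel g e l j x
                - christoffel g i l e x * christoffel g e k j x)"

definition riemann :: "'n::finite metric \<Rightarrow> 'n \<Rightarrow> 'n \<Rightarrow> 'n \<Rightarrow> 'n \<Rightarrow> real^'n \<Rightarrow> real" where
  "riemann g i j k l x = (\<Sum>e\<in>UNIV. g x $ i $ e * riemann_up g e j k l x)"

definition cov_deriv4 ::
  "'n::finite metric \<Rightarrow> ('n \<Rightarrow> 'n \<Rightarrow> 'n \<Rightarrow> 'n \<Rightarrow> real^'n \<Rightarrow> real)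
    \<Rightarrow> 'n \<Rightarrow> 'n \<Rightarrow> 'n \<Rightarrow> 'n \<Rightarrow> 'n \<Rightarrow> real^'n \<Rightarrow> real" where
  "cov_deriv4 g T m i j k l x =
     partial_deriv m (T i j k l) x
     - (\<Sum>e\<in>UNIV. christoffel g e m i x * T e j k l x + christoffel g e m j x * T i e k l x
                + christoffel g e m k x * T i j e l x + christoffel g e m l x * T i j k e x)"

definition raise5 ::
  "'n::finite metric \<Rightarrow> ('n \<Rightarrow> 'n \<Rightarrow> 'n \<Rightarrow> 'n \<Rightarrow> 'n \<Rightarrow> real^'n \<Rightarrow> real)
    \<Rightarrow> 'n \<Rightarrow> 'n \<Rightarrow> 'n \<Rightarrow> 'n \<Rightarrow> 'n \<Rightarrow> real^'n \<Rightarrow> real" where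
  "raise5 g T m i j k l x =
     (\<Sum>m'\<in>UNIV. \<Sum>i'\<in>UNIV. \<Sum>j'\<in>UNIV. \<Sum>k'\<in>UNIV. \<Sum>l'\<in>UNIV.
        inv_metric g x $ m $ m' * inv_metric g x $ i $ i' * inv_metric g x $ j $ j'
        * inv_metric g x $ k $ k' * inv_metric g x $ l $ l' * T m' i' j' k' l' x)"

definition karlhede_invariant :: "'n::finite metric \<Rightarrow> real^'n \<Rightarrow> real" where
  "karlhede_invariant g x =
     (\<Sum>m\<in>UNIV. \<Sum>i\<in>UNIV. \<Sum>j\<in>UNIV. \<Sum>k\<in>UNIV. \<Sum>l\<in>UNIV.
        cov_deriv4 g (riemann g) m i j k l x * raise5 g (cov_deriv4 g (riemann g)) m i j k l x)"


section \<open>The accelerating Kerr--(anti-)de Sitter metric\<close>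

definition akds_Omega :: "real \<Rightarrow> real \<Rightarrow> real \<Rightarrow> real" where
  "akds_Omega \<alpha> r \<theta> = 1 - \<alpha> * r * cos \<theta>"

text \<open>This is the square \<open>\<rho>\<^sup>2\<close>, not \<open>\<rho>\<close> itself.\<close>

definition akds_rho2 :: "real \<Rightarrow> real \<Rightarrow> real \<Rightarrow> real" where
  "akds_rho2 a r \<theta> = r^2 + a^2 * (cos \<theta>)^2"

definition akds_P :: "real \<Rightarrow> real \<Rightarrow> real \<Rightarrow> real \<Rightarrow> real \<Rightarrow> real" where
  "akds_P a m \<Lambda> \<alpha> \<theta> =
     1 - 2 * \<alpha> * m * cos \<theta> + (\<alpha>^2 * a^2 + 1/3 * \<Lambda> * a^2) * (cos \<theta>)^2"

definition akds_Q :: "real \<Rightarrow> real \<Rightarrow> real \<Rightarrow> real \<Rightarrow> real \<Rightarrow> real" where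
  "akds_Q a m \<Lambda> \<alpha> r =
     (a^2 - 2 * m * r + r^2) * (1 - \<alpha>^2 * r^2) - 1/3 * \<Lambda> * (a^2 + r^2) * r^2"

text \<open>
  The coordinates with indices \<open>1, 2, 3, 4\<close> are \<open>t, r, \<theta>, \<phi>\<close>, and \<open>axis i 1\<close> is the
  differential of the \<open>i\<close>-th coordinate. The covectors \<open>u\<close> and \<open>w\<close> are
  \<open>dt - a sin\<^sup>2 \<theta> d\<phi>\<close> and \<open>a dt - (r\<^sup>2 + a\<^sup>2) d\<phi>\<close>.
\<close>

definition akds_metric :: "real \<Rightarrow> real \<Rightarrow> real \<Rightarrow> real \<Rightarrow> 4 metric" where
  "akds_metric a m \<Lambda> \<alpha> x =
     (let r = x $ 2; \<theta> = x $ 3;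
          \<rho>2 = akds_rho2 a r \<theta>; P = akds_P a m \<Lambda> \<alpha> \<theta>; Q = akds_Q a m \<Lambda> \<alpha> r;
          dt = axis 1 1; dr = axis 2 1; d\<theta> = axis 3 1; d\<phi> = axis 4 1;
          u = dt - (a * (sin \<theta>)^2) *\<^sub>R d\<phi>;
          w = a *\<^sub>R dt - (r^2 + a^2) *\<^sub>R d\<phi>
      in \<chi> i j. 1 / (akds_Omega \<alpha> r \<theta>)^2 *
           (- (Q / \<rho>2) * u $ i * u $ j + \<rho>2 / Q * dr $ i * dr $ j
            + \<rho>2 / P * d\<theta> $ i * d\<theta> $ j + P / \<rho>2 * (sin \<theta>)^2 * w $ i * w $ j))"

lemma vector_4 [simp]:
  fixes x y z w :: "'a::zero"
  shows "(vector [x, y, z, w] :: 'a^4) $ 1 = x"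
    and "(vector [x, y, z, w] :: 'a^4) $ 2 = y"
    and "(vector [x, y, z, w] :: 'a^4) $ 3 = z"
    and "(vector [x, y, z, w] :: 'a^4) $ 4 = w"
  by (simp_all add: vector_def)

lemma akds_line_element:
  fixes a m \<Lambda> \<alpha> t r \<theta> \<phi> vt vr v\<theta> v\<phi> :: real
  defines "v \<equiv> (vector [vt, vr, v\<theta>, v\<phi>] :: real^4)"
  shows "v \<bullet> (akds_metric a m \<Lambda> \<alpha> (vector [t, r, \<theta>, \<phi>]) *v v) =
    1 / (akds_Omega \<alpha> r \<theta>)^2 *
      (- (akds_Q a m \<Lambda> \<alpha> r / akds_rho2 a r \<theta>) * (vt - a * (sin \<theta>)^2 * v\<phi>)^2
       + akds_rho2 a r \<theta> / akds_Q a m \<Lambda> \<alpha> r * vr^2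
       + akds_rho2 a r \<theta> / akds_P a m \<Lambda> \<alpha> \<theta> * v\<theta>^2
       + akds_P a m \<Lambda> \<alpha> \<theta> / akds_rho2 a r \<theta> * (sin \<theta>)^2 * (a * vt - (r^2 + a^2) * v\<phi>)^2)"
  unfolding v_def akds_metric_def Let_def inner_vec_def matrix_vector_mult_def sum_4
  by (simp add: axis_def) (simp add: divide_inverse power2_eq_square algebra_simps)

text \<open>The list of the coefficients of the powers \<open>0\<close> to \<open>12\<close> of \<open>cos \<theta>\<close>.\<close>

definition karlhede_coeffs :: "real \<Rightarrow> real \<Rightarrow> real \<Rightarrow> real \<Rightarrow> real \<Rightarrow> real list" where
  "karlhede_coeffs a m \<Lambda> \<alpha> r =
    [
     -(r * \<alpha>^2 * (\<alpha>^2 + \<Lambda>/3) * a^4 + (r^3 * \<alpha>^2 * \<Lambda>/3 - 2 * m * r^2 * \<alpha>^4 + (2 * \<alpha>^2 - \<Lambda>/3) * r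
       + 2 * \<alpha>^2 * m) * a^2 + 2 * \<alpha>^2 * m * r^2 - \<Lambda> * r^3/3 - 2 * m + r) * r^9,
     2 * \<alpha> * ((\<alpha>^2 * m - 8 * r * \<Lambda>/3) * a^4 + (- (\<alpha>^4) * m * r^4 + 20 * \<alpha>^2 * m * r^2 - (8/3) * \<Lambda> * r^3
       - 17 * m) * a^2 + \<alpha>^2 * m * r^4) * r^8,
     27 * (r * \<alpha>^2 * (\<alpha>^2 + \<Lambda>/3) * a^6 + (\<alpha>^4 * (\<alpha>^2 + \<Lambda>/3) * r^5/27 + 28 * r^3 * \<alpha>^2 * \<Lambda>/81
       - 88 * m * r^2 * \<alpha>^4/27 + (2 * \<alpha>^2 - \<Lambda>/3) * r + 88 * \<alpha>^2 * m/27) * a^4 + (2 * \<alpha>^2 * (\<alpha>^2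
       + \<Lambda>/2) * r^5/27 - 40 * \<alpha>^4 * m * r^4/27 - 28 * \<Lambda> * r^3/81 + 32 * \<alpha>^2 * m * r^2/9 + r - 56 * m/27) * a^2
       + \<alpha>^2 * r^5/27) * r^7,
     -56 * \<alpha> * ((\<alpha>^2 * m - 4 * r * \<Lambda>/7) * a^6 + (-(11/7) * \<alpha>^4 * m * r^4 + (241/28) * \<alpha>^2 * m * r^2
       - (2/3) * \<Lambda> * r^3 - 5 * m) * a^4 - (\<alpha>^4 * m * r^4 - 48 * \<alpha>^2 * m * r^2 + (8/3) * \<Lambda> * r^3
       + 17 * m) * r^2 * a^2/28 + \<alpha>^2 * m * r^6/28) * r^6,
     -42 * (r * \<alpha>^2 * (\<alpha>^2 + \<Lambda>/3) * a^6 + (9 * \<alpha>^4 * (\<alpha>^2 + \<Lambda>/3) * r^5/14 + 23 * r^3 * \<alpha>^2 * \<Lambda>/42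
       - 26 * m * r^2 * \<alpha>^4/3 + (2 * \<alpha>^2 - \<Lambda>/3) * r + 26 * \<alpha>^2 * m/3) * a^4 + (m * r^6 * \<alpha>^6/21
       + 9 * \<alpha>^2 * (\<alpha>^2 + \<Lambda>/2) * r^5/7 - 241 * \<alpha>^4 * m * r^4/21 - 23 * \<Lambda> * r^3/42 + 310 * \<alpha>^2 * m * r^2/21
       + r - 10 * m/3) * a^2 - 17 * \<alpha>^2 * r^4 * (\<alpha>^2 * m * r^2 - m - (27/34) * r)/21) * a^2 * r^5,
     140 * (a^6 * \<alpha>^2 * m + (-(13/5) * \<alpha>^4 * m * r^4 + (38/5) * \<alpha>^2 * m * r^2 - (8/35) * \<Lambda> * r^3
       - (13/5) * m) * a^4 + (-(22/35) * \<alpha>^4 * m * r^6 + (31/7) * \<alpha>^2 * m * r^4 - (8/35) * \<Lambda> * r^5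
       - 2 * m * r^2) * a^2 + 2 * \<alpha>^2 * m * r^6/5) * \<alpha> * a^2 * r^4,
     -42 * (r * \<alpha>^2 * (\<alpha>^2 + \<Lambda>/3) * a^6 + ((- (\<alpha>^6) - \<Lambda> * \<alpha>^4/3) * r^5 + 20 * m * r^2 * \<alpha>^4/3
       + (2 * \<alpha>^2 - \<Lambda>/3) * r - 20 * \<alpha>^2 * m/3) * a^4 + (-4 * m * r^6 * \<alpha>^6/3 + (-2 * \<alpha>^4 - \<Lambda> * \<alpha>^2) * r^5
       + 76 * \<alpha>^4 * m * r^4/3 - 76 * \<alpha>^2 * m * r^2/3 + r + 4 * m/3) * a^2 + 20 * \<alpha>^2 * (\<alpha>^2 * m * r^2
       - m - (3/20) * r) * r^4/3) * a^4 * r^3,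
     -56 * \<alpha> * ((\<alpha>^2 * m + 4 * r * \<Lambda>/7) * a^6 + (-5 * \<alpha>^4 * m * r^4 + (155/14) * \<alpha>^2 * m * r^2
       + (4/7) * \<Lambda> * r^3 - (11/7) * m) * a^4 - 13 * (\<alpha>^4 * r^4 - (38/13) * \<alpha>^2 * r^2 + 1) * m * r^2 * a^2/2
       + 5 * \<alpha>^2 * m * r^6/2) * a^4 * r^2,
     27 * (r * \<alpha>^2 * (\<alpha>^2 + \<Lambda>/3) * a^6 + (14 * \<alpha>^4 * (\<alpha>^2 + \<Lambda>/3) * r^5/9 + 23 * r^3 * \<alpha>^2 * \<Lambda>/27
       + 34 * m * r^2 * \<alpha>^4/27 + (2 * \<alpha>^2 - \<Lambda>/3) * r - 34 * \<alpha>^2 * m/27) * a^4 + (-140 * m * r^6 * \<alpha>^6/27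
       + 28 * \<alpha>^2 * (\<alpha>^2 + \<Lambda>/2) * r^5/9 + 620 * \<alpha>^4 * m * r^4/27 - 23 * \<Lambda> * r^3/27 - 482 * \<alpha>^2 * m * r^2/27
       + r + 2 * m/27) * a^2 + 364 * \<alpha>^2 * r^4 * (\<alpha>^2 * m * r^2 - m + (3/26) * r)/27) * a^6 * r,
     2 * \<alpha> * a^6 * ((\<alpha>^2 * m + 8 * r * \<Lambda>/3) * a^6 + (-17 * \<alpha>^4 * m * r^4 + 48 * \<alpha>^2 * m * r^2
       + (56/3) * \<Lambda> * r^3 - m) * a^4 + (-140 * \<alpha>^4 * m * r^6 + 241 * \<alpha>^2 * m * r^4 + 16 * \<Lambda> * r^5
       - 44 * m * r^2) * a^2 + 28 * \<alpha>^2 * m * r^6),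
     -(\<alpha>^2 * (\<alpha>^2 + \<Lambda>/3) * a^6 + ((27 * \<alpha>^6 + 9 * \<Lambda> * \<alpha>^4) * r^4 + 28 * \<Lambda> * \<alpha>^2 * r^2/3 + 2 * \<alpha>^2
       - \<Lambda>/3) * a^4 + (1 - 56 * \<alpha>^6 * m * r^5 + (54 * \<alpha>^4 + 27 * \<Lambda> * \<alpha>^2) * r^4 + 96 * \<alpha>^4 * m * r^3
       - 28 * \<Lambda> * r^2/3 - 40 * \<alpha>^2 * m * r) * a^2 + 88 * \<alpha>^2 * (\<alpha>^2 * m * r^2 - m + (27/88) * r) * r^3) * a^8,
     -2 * \<alpha> * a^8 * ((\<alpha>^2 * m + 8 * r * \<Lambda>/3) * a^4 + (-17 * \<alpha>^4 * m * r^4 + 20 * \<alpha>^2 * m * r^2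
       + (8/3) * \<Lambda> * r^3 - m) * a^2 + \<alpha>^2 * m * r^4),
     (\<alpha>^2 * (\<alpha>^2 * (\<alpha>^2 + \<Lambda>/3) * r^2 + \<Lambda>/3) * a^4 + (-2 * \<alpha>^6 * m * r^3 + (2 * \<alpha>^4 + \<Lambda> * \<alpha>^2) * r^2
       + 2 * \<alpha>^4 * m * r - \<Lambda>/3) * a^2 + 2 * \<alpha>^2 * (\<alpha>^2 * m * r^2 - m + r/2) * r) * a^10
    ]"

end

theory Submission
  imports Defs
begin

text \<open>
  The metric is of Petrov type D. In the orthogonal frame dual to \<open>u, dr / Q, d(cos \<theta>) / X, w\<close>
  with \<open>X = P sin\<^sup>2 \<theta>\<close>, all connection coefficients are polynomials in a few simple functions,
  and the curvature is that of constant curvature \<open>\<Lambda> / 3\<close> plus a Weyl part determined by the single complex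
  function \<open>\<Psi> = - m (1 - \<i> \<alpha> a) (\<Omega> / (r + \<i> a cos \<theta>))\<^sup>3\<close>. Up to powers of the weights of the frame, every
  component of the covariant derivative of the Riemann tensor is then a multiple of the real or the imaginary part
  of a partial derivative of \<open>\<Psi>\<close>, and summing their squares gives
  \<open>80 Re (g(\<nabla>\<Psi>, \<nabla>\<Psi>))\<close>. Expanding this in powers of \<open>cos \<theta>\<close> yields the coefficients.
\<close>

section \<open>Elementary functions and partial derivatives\<close>

text \<open>\<open>deriv\<close> and \<open>matrix_inv\<close> are choice-based: a derivative rule
  can be used only where differentiability has been established, and the inverse metric comes with
  no formula. The proof is shaped around both. Differentiability is obtained wholesale from a class
  of functions closed under differentiation. The Christoffel symbols are never computed from their
  definition but recognised through symmetry and metric compatibility, so every 4 by 4 inversion is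
  replaced by duality of frame and coframe.

  The frame is orthogonal and not orthonormal because Q may have either sign on the regular domain:
  normalising would bring in square roots and case distinctions, whereas the squared lengths, kept
  as weights, are rational in r and cos \<theta>. The price is that the Koszul formula contains
  derivatives of the weights as well as structure functions.

  With the 5 tensor indices in a frame, raising an index is a division by a weight, so the invariant
  is a signed sum of squares, and the Riemann symmetries leave 21 components in each of the 4
  directions.\<close>

definition has_partial :: "'n::finite \<Rightarrow> (real^'n \<Rightarrow> real) \<Rightarrow> real \<Rightarrow> real^'n \<Rightarrow> bool" where
  "has_partial i f D x \<longleftrightarrow> ((\<lambda>s. f (x + s *\<^sub>R axis i 1)) has_real_derivative D) (at 0)"

lemma has_partial_imp_partial_deriv: "has_partial i f D x \<Longrightarrow> partial_deriv i f x = D"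
  unfolding has_partial_def partial_deriv_def by (rule DERIV_imp_deriv)

lemma eventually_in_open_line:
  fixes U :: "(real^'n::finite) set"
  assumes "open U" "x \<in> U"
  shows "\<forall>\<^sub>F s in nhds 0. x + s *\<^sub>R v \<in> U"
proof -
  have "((\<lambda>s. x + s *\<^sub>R v) \<longlongrightarrow> x + 0 *\<^sub>R v) (nhds 0)"
    by (intro tendsto_intros filterlim_ident)
  then show ?thesis
    using assms by (auto dest: topological_tendstoD)
qed

text \<open>A coordinate line through \<open>x\<close> stays in the open set for small
  \<open>s\<close>, so the derivative sees only values on \<open>U\<close>.\<close>

lemma has_partial_cong:
  assumes "open U" "x \<in> U" "\<And>y. y \<in> U \<Longrightarrow> f y = g y" "has_partial i f D x"
  shows "has_partial i g D x"
proof -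
  have "\<forall>\<^sub>F s in nhds 0. f (x + s *\<^sub>R axis i 1) = g (x + s *\<^sub>R axis i 1)"
    using eventually_in_open_line[OF assms(1,2)] by (rule eventually_mono) (use assms(3) in auto)
  then show ?thesis
    using assms(4) unfolding has_partial_def by (simp add: DERIV_cong_ev[OF refl _ refl])
qed

lemma has_partial_const: "has_partial i (\<lambda>x. k) 0 x"
  and has_partial_coord: "has_partial i (\<lambda>x. x $ j) (if i = j then 1 else 0) x"
  unfolding has_partial_def by (auto intro!: derivative_eq_intros simp: axis_def)

lemma
  assumes "has_partial i f D x"
  shows has_partial_sin: "has_partial i (\<lambda>x. sin (f x)) (cos (f x) * D) x"
    and has_partial_cos: "has_partial i (\<lambda>x. cos (f x)) (- sin (f x) * D) x"
    and has_partial_inverse: "f x \<noteq> 0 \<Longrightarrow>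
      has_partial i (\<lambda>x. inverse (f x)) (- (D * (inverse (f x) * inverse (f x)))) x"
  using assms unfolding has_partial_def by (auto intro!: derivative_eq_intros)

lemma
  assumes "has_partial i f D x" "has_partial i g D' x"
  shows has_partial_add: "has_partial i (\<lambda>x. f x + g x) (D + D') x"
    and has_partial_mult: "has_partial i (\<lambda>x. f x * g x) (f x * D' + D * g x) x"
  using assms unfolding has_partial_def by (auto intro!: derivative_eq_intros)

text \<open>
  A class of functions closed under partial derivatives. It supplies all differentiability
  conditions and the symmetry of second derivatives by induction.
\<close>

inductive elementary :: "(real^'n::finite) set \<Rightarrow> (real^'n \<Rightarrow> real) \<Rightarrow> bool" for U where
  const: "elementary U (\<lambda>x. k)"
| coord: "elementary U (\<lambda>x. x $ i)"
| sin: "elementary U f \<Longrightarrow> elementary U (\<lambda>x. sin (f x))"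
| cos: "elementary U f \<Longrightarrow> elementary U (\<lambda>x. cos (f x))"
| add: "elementary U f \<Longrightarrow> elementary U g \<Longrightarrow> elementary U (\<lambda>x. f x + g x)"
| mult: "elementary U f \<Longrightarrow> elementary U g \<Longrightarrow> elementary U (\<lambda>x. f x * g x)"
| inverse: "elementary U f \<Longrightarrow> (\<And>x. x \<in> U \<Longrightarrow> f x \<noteq> 0) \<Longrightarrow> elementary U (\<lambda>x. inverse (f x))"
| cong: "elementary U f \<Longrightarrow> (\<And>x. x \<in> U \<Longrightarrow> f x = g x) \<Longrightarrow> elementary U g"

lemma elementary_minus: "elementary U f \<Longrightarrow> elementary U (\<lambda>x. - f x)"
  using elementary.mult[OF elementary.const[of U "-1"], of f] by simp

lemma elementary_diff: "elementary U f \<Longrightarrow> elementary U g \<Longrightarrow> elementary U (\<lambda>x. f x - g x)"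
  using elementary.add[of U f "\<lambda>x. - g x"] elementary_minus[of U g] by simp

lemma elementary_divide:
  "elementary U f \<Longrightarrow> elementary U g \<Longrightarrow> (\<And>x. x \<in> U \<Longrightarrow> g x \<noteq> 0) \<Longrightarrow> elementary U (\<lambda>x. f x / g x)"
  using elementary.mult[of U f "\<lambda>x. inverse (g x)"] elementary.inverse[of U g]
  by (simp add: divide_inverse)

lemma elementary_power: "elementary U f \<Longrightarrow> elementary U (\<lambda>x. f x ^ n)"
  by (induction n) (auto intro: elementary.const elementary.mult)

lemma elementary_sum: "(\<And>i. i \<in> I \<Longrightarrow> elementary U (f i)) \<Longrightarrow> elementary U (\<lambda>x. \<Sum>i\<in>I. f i x)"
  by (induction I rule: infinite_finite_induct) (auto intro: elementary.const elementary.add)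

lemmas elementary_intros = elementary.const elementary.coord elementary.sin elementary.cos elementary.add
  elementary.mult elementary.inverse elementary_minus elementary_diff elementary_divide
  elementary_power elementary_sum

context
  fixes U :: "(real^'n::finite) set"
  assumes U: "open U"
begin

text \<open>The induction carries membership of the derivative in the class along with its
  existence, so that differentiation can be iterated.\<close>

lemma elementary_has_partial_ex:
  "elementary U f \<Longrightarrow> \<exists>f'. elementary U f' \<and> (\<forall>x\<in>U. has_partial i f (f' x) x)"
proof (induction rule: elementary.induct)
  case (const k)
  then show ?case by (intro exI[of _ "\<lambda>x. 0"]) (auto intro: elementary_intros has_partial_const)
next
  case (coord j)
  show ?case
    using has_partial_coord[of i j] elementary.const[of U "if i = j then 1 else 0"] by blast
next
  case (sin f)
  then obtain f' where "elementary U f'" "\<forall>x\<in>U. has_partial i f (f' x) x" by blast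
  with sin show ?case
    by (intro exI[of _ "\<lambda>x. cos (f x) * f' x"]) (auto intro: elementary_intros has_partial_sin)
next
  case (cos f)
  then obtain f' where "elementary U f'" "\<forall>x\<in>U. has_partial i f (f' x) x" by blast
  with cos show ?case
    by (intro exI[of _ "\<lambda>x. - sin (f x) * f' x"] conjI ballI elementary_intros has_partial_cos) auto
next
  case (add f g)
  then obtain f' g' where "elementary U f'" "\<forall>x\<in>U. has_partial i f (f' x) x"
    "elementary U g'" "\<forall>x\<in>U. has_partial i g (g' x) x" by blast
  then show ?case
    by (intro exI[of _ "\<lambda>x. f' x + g' x"]) (auto intro: elementary_intros has_partial_add)
next
  case (mult f g)
  then obtain f' g' where "elementary U f'" "\<forall>x\<in>U. has_partial i f (f' x) x"
    "elementary U g'" "\<forall>x\<in>U. has_partial i g (g' x) x" by blast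
  with mult show ?case
    by (intro exI[of _ "\<lambda>x. f x * g' x + f' x * g x"]) (auto intro: elementary_intros has_partial_mult)
next
  case (inverse f)
  then obtain f' where "elementary U f'" "\<forall>x\<in>U. has_partial i f (f' x) x" by blast
  with inverse show ?case
    by (intro exI[of _ "\<lambda>x. - (f' x * (inverse (f x) * inverse (f x)))"] conjI ballI
        elementary_intros has_partial_inverse) auto
next
  case (cong f g)
  then show ?case using has_partial_cong[OF U] by blast
qed

lemma has_partial_partial_deriv:
  "elementary U f \<Longrightarrow> x \<in> U \<Longrightarrow> has_partial i f (partial_deriv i f x) x"
  using elementary_has_partial_ex has_partial_imp_partial_deriv by metis

lemma elementary_partial_deriv: "elementary U f \<Longrightarrow> elementary U (partial_deriv i f)"
proof -
  assume "elementary U f"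
  then obtain f' where "elementary U f'" "\<And>x. x \<in> U \<Longrightarrow> has_partial i f (f' x) x"
    using elementary_has_partial_ex by blast
  then show ?thesis
    by (metis elementary.cong has_partial_imp_partial_deriv)
qed

lemma partial_deriv_cong:
  assumes "elementary U f" "\<And>y. y \<in> U \<Longrightarrow> f y = g y" "x \<in> U"
  shows "partial_deriv i f x = partial_deriv i g x"
  using has_partial_imp_partial_deriv[OF has_partial_cong[OF U assms(3) assms(2)
      has_partial_partial_deriv[OF assms(1,3)]]] by simp

lemma
  assumes "elementary U f" "x \<in> U"
  shows partial_deriv_sin: "partial_deriv i (\<lambda>x. sin (f x)) x = cos (f x) * partial_deriv i f x"
    and partial_deriv_cos: "partial_deriv i (\<lambda>x. cos (f x)) x = - sin (f x) * partial_deriv i f x"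
    and partial_deriv_inverse: "f x \<noteq> 0 \<Longrightarrow> partial_deriv i (\<lambda>x. inverse (f x)) x
      = - (partial_deriv i f x * (inverse (f x) * inverse (f x)))"
    and partial_deriv_minus: "partial_deriv i (\<lambda>x. - f x) x = - partial_deriv i f x"
proof -
  note d = has_partial_partial_deriv[OF assms, of i]
  note [dest] = has_partial_imp_partial_deriv
  show "partial_deriv i (\<lambda>x. sin (f x)) x = cos (f x) * partial_deriv i f x"
    using has_partial_sin[OF d] by blast
  show "partial_deriv i (\<lambda>x. cos (f x)) x = - sin (f x) * partial_deriv i f x"
    using has_partial_cos[OF d] by blast
  show "partial_deriv i (\<lambda>x. inverse (f x)) x
      = - (partial_deriv i f x * (inverse (f x) * inverse (f x)))" if "f x \<noteq> 0"
    using has_partial_inverse[OF d that] by blast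
  show "partial_deriv i (\<lambda>x. - f x) x = - partial_deriv i f x"
    using has_partial_imp_partial_deriv[OF has_partial_mult[OF has_partial_const[of i "-1" x] d]]
    by simp
qed

lemma
  assumes "elementary U f" "elementary U g" "x \<in> U"
  shows partial_deriv_add: "partial_deriv i (\<lambda>x. f x + g x) x = partial_deriv i f x + partial_deriv i g x"
    and partial_deriv_mult: "partial_deriv i (\<lambda>x. f x * g x) x = f x * partial_deriv i g x
      + partial_deriv i f x * g x"
proof -
  note d = has_partial_partial_deriv[OF assms(1,3), of i] has_partial_partial_deriv[OF assms(2,3), of i]
  show "partial_deriv i (\<lambda>x. f x + g x) x = partial_deriv i f x + partial_deriv i g x"
    by (rule has_partial_imp_partial_deriv[OF has_partial_add[OF d]])
  show "partial_deriv i (\<lambda>x. f x * g x) x = f x * partial_deriv i g x + partial_deriv i f x * g x"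
    by (rule has_partial_imp_partial_deriv[OF has_partial_mult[OF d]])
qed

lemma partial_deriv_const: "partial_deriv i (\<lambda>x. k) x = 0"
  and partial_deriv_coord: "partial_deriv i (\<lambda>x. x $ j) x = (if i = j then 1 else 0)"
  by (rule has_partial_imp_partial_deriv[OF has_partial_const])
    (rule has_partial_imp_partial_deriv[OF has_partial_coord])

lemma partial_deriv_sum:
  assumes "\<And>i. i \<in> I \<Longrightarrow> elementary U (f i)" "x \<in> U"
  shows "partial_deriv j (\<lambda>x. \<Sum>i\<in>I. f i x) x = (\<Sum>i\<in>I. partial_deriv j (f i) x)"
  using assms
  by (induction I rule: infinite_finite_induct)
    (simp_all add: partial_deriv_const partial_deriv_add elementary_sum)

text \<open>Takes the place of Schwarz's theorem: differentiating any of the constructions twice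
  gives an expression symmetric in \<open>i\<close> and \<open>j\<close> as soon as the constituents
  have commuting derivatives, so structural induction suffices.\<close>

lemma partial_deriv_commute:
  assumes "elementary U f" "x \<in> U"
  shows "partial_deriv i (partial_deriv j f) x = partial_deriv j (partial_deriv i f) x"
  using assms
proof (induction arbitrary: x rule: elementary.induct)
  case (const k)
  have "partial_deriv j (\<lambda>x::real^'n. k) = (\<lambda>x. 0)" for j by (auto simp: partial_deriv_const)
  then show ?case by (simp add: partial_deriv_const)
next
  case (coord k)
  have "partial_deriv j (\<lambda>x::real^'n. x $ k) = (\<lambda>x. if j = k then 1 else 0)" for j
    by (auto simp: partial_deriv_coord)
  then show ?case by (simp only: partial_deriv_const)
next
  case (sin f)
  note e = elementary_intros elementary_partial_deriv sin.hyps
  \<comment> \<open>The formula for the inner derivative holds only on \<open>U\<close>; openness of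
    \<open>U\<close> lets the outer derivative be taken of it.\<close>
  have "partial_deriv i (partial_deriv j (\<lambda>x. sin (f x))) x
      = partial_deriv i (\<lambda>x. cos (f x) * partial_deriv j f x) x" for i j
    by (rule sym, rule partial_deriv_cong)
      (use sin in \<open>auto intro!: e simp: partial_deriv_sin\<close>)
  then show ?case
    using sin by (simp add: partial_deriv_mult partial_deriv_cos e)
next
  case (cos f)
  note e = elementary_intros elementary_partial_deriv cos.hyps
  have "partial_deriv i (partial_deriv j (\<lambda>x. cos (f x))) x
      = partial_deriv i (\<lambda>x. - sin (f x) * partial_deriv j f x) x" for i j
    by (rule sym, rule partial_deriv_cong)
      (use cos in \<open>auto intro!: e simp: partial_deriv_cos\<close>)
  then show ?case
    using cos by (simp add: partial_deriv_mult partial_deriv_minus partial_deriv_sin e)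
next
  case (add f g)
  note e = elementary_intros elementary_partial_deriv add.hyps
  have "partial_deriv i (partial_deriv j (\<lambda>x. f x + g x)) x
      = partial_deriv i (\<lambda>x. partial_deriv j f x + partial_deriv j g x) x" for i j
    by (rule sym, rule partial_deriv_cong)
      (use add in \<open>auto intro!: e simp: partial_deriv_add\<close>)
  then show ?case
    using add by (simp add: partial_deriv_add e)
next
  case (mult f g)
  note e = elementary_intros elementary_partial_deriv mult.hyps
  have "partial_deriv i (partial_deriv j (\<lambda>x. f x * g x)) x
      = partial_deriv i (\<lambda>x. f x * partial_deriv j g x + partial_deriv j f x * g x) x" for i j
    by (rule sym, rule partial_deriv_cong)
      (use mult in \<open>auto intro!: e simp: partial_deriv_mult\<close>)
  then show ?case
    using mult by (simp add: partial_deriv_add partial_deriv_mult e)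
next
  case (inverse f)
  note e = elementary_intros elementary_partial_deriv inverse.hyps(1)
  have "partial_deriv i (partial_deriv j (\<lambda>x. inverse (f x))) x
      = partial_deriv i (\<lambda>x. - (partial_deriv j f x * (inverse (f x) * inverse (f x)))) x" for i j
    by (rule sym, rule partial_deriv_cong)
      (use inverse in \<open>auto intro!: e simp: partial_deriv_inverse\<close>)
  then show ?case
    using inverse by (simp add: partial_deriv_minus partial_deriv_mult partial_deriv_inverse e)
next
  case (cong f g)
  have *: "partial_deriv j f y = partial_deriv j g y" if "y \<in> U" for j y
    using partial_deriv_cong[OF cong.hyps(1,2) that] .
  have "partial_deriv i (partial_deriv j f) x = partial_deriv i (partial_deriv j g) x" for i j
    by (rule partial_deriv_cong) (use cong * in \<open>auto intro: elementary_partial_deriv\<close>)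
  then show ?case using cong by metis
qed

end

section \<open>Kronecker delta, matrix inverse and reordering of sums\<close>

definition delta :: "'a \<Rightarrow> 'a \<Rightarrow> real" where
  "delta a b = (if a = b then 1 else 0)"

lemma delta_cong: "delta a b * f a = delta b a * f b"
  by (simp add: delta_def)

lemma sum_delta_mult [simp]:
  fixes f :: "'a::finite \<Rightarrow> real"
  shows "(\<Sum>b\<in>UNIV. delta a b * f b) = f a" "(\<Sum>b\<in>UNIV. delta b a * f b) = f a"
    "(\<Sum>b\<in>UNIV. f b * delta a b) = f a" "(\<Sum>b\<in>UNIV. f b * delta b a) = f a"
  by (simp_all add: delta_def if_distrib if_distribR cong: if_cong)

lemma matrix_inv_left:
  fixes A :: "real^'n::finite^'n"
  assumes "invertible A"
  shows "matrix_inv A ** A = mat 1"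
  using someI_ex[OF assms[unfolded invertible_def]] unfolding matrix_inv_def by blast

lemma sum_rotate3:
  fixes F :: "'a::finite \<Rightarrow> 'b::finite \<Rightarrow> 'c::finite \<Rightarrow> real"
  shows "(\<Sum>a\<in>UNIV. \<Sum>b\<in>UNIV. \<Sum>c\<in>UNIV. F a b c) = (\<Sum>c\<in>UNIV. \<Sum>a\<in>UNIV. \<Sum>b\<in>UNIV. F a b c)"
  by (subst (2) sum.swap, subst sum.swap) (rule refl)

section \<open>Orthogonal frames\<close>

text \<open>Uniqueness half of the fundamental theorem of Riemannian geometry: in the Christoffel
  combination of three compatibility equations the symmetry of \<open>G\<close> cancels four of the
  six terms and doubles the other. Candidate symbols can thus be verified without inverting
  \<open>g x\<close>.\<close>

lemma christoffel_unique:
  fixes g :: "'n::finite metric" and G :: "'n \<Rightarrow> 'n \<Rightarrow> 'n \<Rightarrow> real"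
  assumes "invertible (g x)"
    and sym: "\<And>k i j. G k i j = G k j i"
    and compat: "\<And>i j k. partial_deriv k (\<lambda>y. g y $ i $ j) x
      = (\<Sum>l\<in>UNIV. g x $ i $ l * G l k j) + (\<Sum>l\<in>UNIV. g x $ j $ l * G l k i)"
  shows "christoffel g i j k x = G i j k"
proof -
  have inv: "(\<Sum>l\<in>UNIV. inv_metric g x $ i $ l * g x $ l $ e) = delta i e" for e
  proof -
    have "matrix_inv (g x) ** g x = mat 1"
      using assms(1) by (rule matrix_inv_left)
    then show ?thesis
      unfolding inv_metric_def matrix_matrix_mult_def mat_def delta_def
      by (auto simp: vec_eq_iff)
  qed
  have "partial_deriv j (\<lambda>y. g y $ l $ k) x + partial_deriv k (\<lambda>y. g y $ l $ j) x
         - partial_deriv l (\<lambda>y. g y $ j $ k) x = 2 * (\<Sum>e\<in>UNIV. g x $ l $ e * G e j k)" for l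
    unfolding compat using sym[of _ k j] sym[of _ l j] sym[of _ l k] by simp
  then have "christoffel g i j k x = (\<Sum>l\<in>UNIV. \<Sum>e\<in>UNIV. inv_metric g x $ i $ l * g x $ l $ e * G e j k)"
    unfolding christoffel_def by (simp add: sum_distrib_left mult.assoc mult.left_commute)
  also have "\<dots> = (\<Sum>e\<in>UNIV. (\<Sum>l\<in>UNIV. inv_metric g x $ i $ l * g x $ l $ e) * G e j k)"
    by (subst sum.swap) (simp add: sum_distrib_right)
  finally show ?thesis
    unfolding inv by simp
qed

text \<open>\<open>h a\<close> is the squared length of the frame vector \<open>E a\<close>,
  possibly negative and not constant. \<open>C a b c\<close> is the component along
  \<open>E a\<close> of the bracket of \<open>E b\<close> and \<open>E c\<close>, and
  \<open>structure_eq\<close> is the coordinate form of d\<theta> = - (1/2) C \<theta> wedge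
  \<theta>.\<close>

locale orthogonal_frame =
  fixes U :: "(real^'n::finite) set" and g :: "'n metric"
    and \<theta> E :: "'n \<Rightarrow> 'n \<Rightarrow> real^'n \<Rightarrow> real"
    and h :: "'n \<Rightarrow> real^'n \<Rightarrow> real"
    and C :: "'n \<Rightarrow> 'n \<Rightarrow> 'n \<Rightarrow> real^'n \<Rightarrow> real"
  assumes open_U: "open U"
    and el_\<theta>: "elementary U (\<theta> a i)"
    and el_E: "elementary U (E a i)"
    and el_h: "elementary U (h a)"
    and el_C: "elementary U (C a b c)"
    and h_nz: "x \<in> U \<Longrightarrow> h a x \<noteq> 0"
    and metric: "x \<in> U \<Longrightarrow> g x $ i $ j = (\<Sum>a\<in>UNIV. h a x * \<theta> a i x * \<theta> a j x)"
    and dual: "x \<in> U \<Longrightarrow> (\<Sum>i\<in>UNIV. E a i x * \<theta> b i x) = delta a b"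
    and dual': "x \<in> U \<Longrightarrow> (\<Sum>a\<in>UNIV. E a i x * \<theta> a j x) = delta i j"
    and C_skew: "C a b c x = - C a c b x"
    and structure_eq: "x \<in> U \<Longrightarrow> partial_deriv i (\<theta> a j) x - partial_deriv j (\<theta> a i) x
      = - (\<Sum>b\<in>UNIV. \<Sum>c\<in>UNIV. C a b c x * \<theta> b i x * \<theta> c j x)"
begin

definition dir :: "'n \<Rightarrow> (real^'n \<Rightarrow> real) \<Rightarrow> real^'n \<Rightarrow> real" where
  "dir a f x = (\<Sum>i\<in>UNIV. E a i x * partial_deriv i f x)"

text \<open>
  Here \<open>conn a c b\<close> is the component along \<open>E a\<close> of the covariant derivative of \<open>E b\<close> in the
  direction \<open>E c\<close>, given by the Koszul formula.
\<close>

definition conn :: "'n \<Rightarrow> 'n \<Rightarrow> 'n \<Rightarrow> real^'n \<Rightarrow> real" where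
  "conn a c b x = (delta a b * dir c (h a) x + delta a c * dir b (h a) x - delta b c * dir a (h b) x
     + h a x * C a c b x - h b x * C b c a x - h c x * C c b a x) / (2 * h a x)"

text \<open>The connection one-form omega^a_b in coordinate components.\<close>

definition form :: "'n \<Rightarrow> 'n \<Rightarrow> 'n \<Rightarrow> real^'n \<Rightarrow> real" where
  "form a b i x = (\<Sum>c\<in>UNIV. conn a c b x * \<theta> c i x)"

lemma el_dir: "elementary U f \<Longrightarrow> elementary U (dir a f)"
  unfolding dir_def by (intro elementary_intros elementary_partial_deriv open_U el_E)

lemma el_conn: "elementary U (conn a c b)"
  unfolding conn_def
  by (intro elementary_intros el_dir el_h el_C) (simp_all add: h_nz)

lemma el_form: "elementary U (form a b i)"
  unfolding form_def by (intro elementary_intros el_conn el_\<theta>)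

lemma partial_deriv_dir:
  assumes "x \<in> U"
  shows "partial_deriv i f x = (\<Sum>a\<in>UNIV. \<theta> a i x * dir a f x)"
proof -
  have "(\<Sum>a\<in>UNIV. \<theta> a i x * dir a f x)
      = (\<Sum>a\<in>UNIV. \<Sum>j\<in>UNIV. (E a j x * \<theta> a i x) * partial_deriv j f x)"
    unfolding dir_def by (simp add: sum_distrib_left mult_ac)
  also have "\<dots> = (\<Sum>j\<in>UNIV. delta j i * partial_deriv j f x)"
    by (subst sum.swap) (simp flip: sum_distrib_right add: dual'[OF assms])
  finally show ?thesis by simp
qed

lemma torsion_free:
  assumes "x \<in> U"
  shows "conn a c b x - conn a b c x = C a c b x"
  using h_nz[OF assms, of a] C_skew[of a b c x] C_skew[of b c a x] C_skew[of c b a x]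
    and delta_cong[of b c "\<lambda>b. dir a (h b) x"]
  by (simp add: conn_def field_simps)

text \<open>Adding the Koszul formula to itself with \<open>a\<close> and \<open>b\<close> exchanged
  cancels all bracket terms by skewness of \<open>C\<close> and leaves the derivative of the frame
  metric, which is diagonal.\<close>

lemma metric_compat:
  assumes "x \<in> U"
  shows "h a x * conn a c b x + h b x * conn b c a x = delta a b * dir c (h a) x"
proof -
  have "h a x * conn a c b x = (delta a b * dir c (h a) x + delta a c * dir b (h a) x
    - delta b c * dir a (h b) x
     + h a x * C a c b x - h b x * C b c a x - h c x * C c b a x) / 2" for a b
    using h_nz[OF assms, of a] by (simp add: conn_def)
  from this[of a b] this[of b a] show ?thesis
    using delta_cong[of b a "\<lambda>b. dir c (h b) x"] C_skew[of c a b x] by (simp add: field_simps)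
qed

lemma inv_metric_frame:
  assumes "x \<in> U"
  shows "inv_metric g x $ i $ j = (\<Sum>a\<in>UNIV. E a i x * E a j x / h a x)" and "invertible (g x)"
proof -
  define B :: "real^'n^'n" where "B = (\<chi> i j. \<Sum>a\<in>UNIV. E a i x * E a j x / h a x)"
  have *: "(\<Sum>k\<in>UNIV. B $ i $ k * g x $ k $ j) = delta i j" for i j
  proof -
    have "(\<Sum>k\<in>UNIV. B $ i $ k * g x $ k $ j)
      = (\<Sum>k\<in>UNIV. \<Sum>a\<in>UNIV. \<Sum>b\<in>UNIV. (E a k x * \<theta> b k x) * (E a i x / h a x * h b x * \<theta> b j x))"
      unfolding B_def metric[OF assms] by (simp add: sum_product) (simp add: mult_ac)
    also have "\<dots> = (\<Sum>a\<in>UNIV. \<Sum>b\<in>UNIV. \<Sum>k\<in>UNIV. (E a k x * \<theta> b k x) * (E a i x / h a x * h b x * \<theta> b j x))"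
      by (rule sum_rotate3[symmetric])
    also have "\<dots> = (\<Sum>a\<in>UNIV. E a i x / h a x * h a x * \<theta> a j x)"
      by (simp only: sum_distrib_right[symmetric] dual[OF assms] sum_delta_mult)
    also have "\<dots> = delta i j"
      using h_nz[OF assms] by (simp add: dual'[OF assms])
    finally show ?thesis .
  qed
  then have BI: "B ** g x = mat 1"
    unfolding matrix_matrix_mult_def mat_def delta_def by (simp add: vec_eq_iff)
  then have IB: "g x ** B = mat 1"
    using matrix_left_right_inverse by blast
  then show "invertible (g x)" using BI unfolding invertible_def by blast
  \<comment> \<open>\<open>matrix_inv\<close> is some chosen inverse; since \<open>B\<close> is a
    two-sided inverse, the choice can only be \<open>B\<close>.\<close>
  have "matrix_inv (g x) = matrix_inv (g x) ** g x ** B"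
    by (simp add: IB flip: matrix_mul_assoc)
  also have "\<dots> = B"
    using matrix_inv_left[OF \<open>invertible (g x)\<close>] by simp
  finally have "matrix_inv (g x) = B" .
  then show "inv_metric g x $ i $ j = (\<Sum>a\<in>UNIV. E a i x * E a j x / h a x)"
    by (simp add: inv_metric_def B_def)
qed

text \<open>The right-hand side is the frame connection transported to the coordinate basis. It is
  symmetric by \<open>torsion_free\<close> and the structure equation, and compatible with
  \<open>g\<close> by \<open>metric_compat\<close>, so \<open>christoffel_unique\<close> identifies
  it.\<close>

lemma christoffel_frame:
  assumes x: "x \<in> U"
  shows "christoffel g k i j x = (\<Sum>a\<in>UNIV. E a k x * (partial_deriv i (\<theta> a j) x
    + (\<Sum>b\<in>UNIV. form a b i x * \<theta> b j x)))"
proof (rule christoffel_unique)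
  define N where "N a i j = partial_deriv i (\<theta> a j) x + (\<Sum>b\<in>UNIV. form a b i x * \<theta> b j x)" for a i j
  show "invertible (g x)" using x by (rule inv_metric_frame)
  have form_sum: "(\<Sum>b\<in>UNIV. form a b i x * \<theta> b j x)
      = (\<Sum>b\<in>UNIV. \<Sum>c\<in>UNIV. conn a b c x * \<theta> b i x * \<theta> c j x)" for a i j
    unfolding form_def by (subst sum.swap) (simp add: sum_distrib_right)
  have "N a i j - N a j i = 0" for a i j
  proof -
    have "(\<Sum>b\<in>UNIV. form a b j x * \<theta> b i x)
      = (\<Sum>b\<in>UNIV. \<Sum>c\<in>UNIV. conn a c b x * \<theta> b i x * \<theta> c j x)"
      unfolding form_def by (simp add: sum_distrib_left sum_distrib_right mult_ac)
    then have "(\<Sum>b\<in>UNIV. form a b i x * \<theta> b j x) - (\<Sum>b\<in>UNIV. form a b j x * \<theta> b i x)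
        = (\<Sum>b\<in>UNIV. \<Sum>c\<in>UNIV. (conn a b c x - conn a c b x) * \<theta> b i x * \<theta> c j x)"
      by (simp add: form_sum sum_subtractf left_diff_distrib)
    then show ?thesis
      using structure_eq[OF x, of i a j] by (simp add: N_def torsion_free[OF x])
  qed
  then have Nsym: "N a i j = N a j i" for a i j by (metis eq_iff_diff_eq_0)
  show "(\<Sum>a\<in>UNIV. E a k x * (partial_deriv i (\<theta> a j) x + (\<Sum>b\<in>UNIV. form a b i x * \<theta> b j x)))
    = (\<Sum>a\<in>UNIV. E a k x * (partial_deriv j (\<theta> a i) x + (\<Sum>b\<in>UNIV. form a b j x * \<theta> b i x)))" for i j k
    using Nsym unfolding N_def by simp
  have lower: "(\<Sum>l\<in>UNIV. g x $ i $ l * (\<Sum>a\<in>UNIV. E a l x * M a)) = (\<Sum>a\<in>UNIV. h a x * \<theta> a i x * M a)" for i M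
  proof -
    have "(\<Sum>l\<in>UNIV. g x $ i $ l * (\<Sum>a\<in>UNIV. E a l x * M a))
      = (\<Sum>l\<in>UNIV. \<Sum>b\<in>UNIV. \<Sum>a\<in>UNIV. E a l x * \<theta> b l x * (h b x * \<theta> b i x * M a))"
      unfolding metric[OF x] by (simp add: sum_product) (simp add: mult_ac)
    also have "\<dots> = (\<Sum>b\<in>UNIV. \<Sum>a\<in>UNIV. \<Sum>l\<in>UNIV. E a l x * \<theta> b l x * (h b x * \<theta> b i x * M a))"
      by (rule sum_rotate3[symmetric])
    finally show ?thesis
      by (simp flip: sum_distrib_right add: dual[OF x])
  qed
  fix i j k
  note el = el_h el_\<theta> elementary.mult
  have "partial_deriv k (\<lambda>y. \<Sum>a\<in>UNIV. h a y * \<theta> a i y * \<theta> a j y) x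
    = (\<Sum>a\<in>UNIV. h a x * \<theta> a i x * partial_deriv k (\<theta> a j) x
     + (h a x * partial_deriv k (\<theta> a i) x + partial_deriv k (h a) x * \<theta> a i x) * \<theta> a j x)"
    by (simp add: partial_deriv_sum[OF open_U] partial_deriv_mult[OF open_U] el x)
  also have "\<dots> = (\<Sum>a\<in>UNIV. h a x * \<theta> a i x * N a k j) + (\<Sum>a\<in>UNIV. h a x * \<theta> a j x * N a k i)
    + ((\<Sum>a\<in>UNIV. partial_deriv k (h a) x * \<theta> a i x * \<theta> a j x)
       - (\<Sum>a\<in>UNIV. h a x * \<theta> a i x * (\<Sum>b\<in>UNIV. form a b k x * \<theta> b j x))
       - (\<Sum>a\<in>UNIV. h a x * \<theta> a j x * (\<Sum>b\<in>UNIV. form a b k x * \<theta> b i x)))"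
    unfolding N_def by (simp add: sum.distrib sum_subtractf algebra_simps)
  also have "\<dots> = (\<Sum>a\<in>UNIV. h a x * \<theta> a i x * N a k j) + (\<Sum>a\<in>UNIV. h a x * \<theta> a j x * N a k i)"
  proof -
    have "(\<Sum>a\<in>UNIV. h a x * \<theta> a i x * (\<Sum>b\<in>UNIV. form a b k x * \<theta> b j x))
       + (\<Sum>a\<in>UNIV. h a x * \<theta> a j x * (\<Sum>b\<in>UNIV. form a b k x * \<theta> b i x))
     = (\<Sum>a\<in>UNIV. partial_deriv k (h a) x * \<theta> a i x * \<theta> a j x)"
  proof -
    have "(\<Sum>a\<in>UNIV. h a x * \<theta> a j x * (\<Sum>b\<in>UNIV. form a b k x * \<theta> b i x))
      = (\<Sum>a\<in>UNIV. \<Sum>b\<in>UNIV. h b x * form b a k x * (\<theta> a i x * \<theta> b j x))"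
      by (subst sum.swap) (simp add: sum_distrib_left mult_ac)
    then have "(\<Sum>a\<in>UNIV. h a x * \<theta> a i x * (\<Sum>b\<in>UNIV. form a b k x * \<theta> b j x))
       + (\<Sum>a\<in>UNIV. h a x * \<theta> a j x * (\<Sum>b\<in>UNIV. form a b k x * \<theta> b i x))
      = (\<Sum>a\<in>UNIV. \<Sum>b\<in>UNIV. (h a x * form a b k x + h b x * form b a k x) * (\<theta> a i x * \<theta> b j x))"
      by (simp add: sum_distrib_left sum.distrib algebra_simps)
    also have "\<dots> = (\<Sum>a\<in>UNIV. \<Sum>b\<in>UNIV. delta a b * (partial_deriv k (h a) x * (\<theta> a i x * \<theta> b j x)))"
    proof -
      have "h a x * form a b k x + h b x * form b a k x = delta a b * partial_deriv k (h a) x" for a b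
      proof -
        have "h a x * form a b k x + h b x * form b a k x
          = (\<Sum>c\<in>UNIV. (h a x * conn a c b x + h b x * conn b c a x) * \<theta> c k x)"
          unfolding form_def by (simp add: sum_distrib_left sum.distrib algebra_simps)
        then show ?thesis
          by (simp add: metric_compat[OF x] partial_deriv_dir[OF x] sum_distrib_left mult_ac)
      qed
      then show ?thesis by (simp add: mult_ac)
    qed
    also have "\<dots> = (\<Sum>a\<in>UNIV. partial_deriv k (h a) x * \<theta> a i x * \<theta> a j x)"
      by (simp add: mult_ac)
    finally show ?thesis .
  qed
    then show ?thesis by simp
  qed
  moreover have "partial_deriv k (\<lambda>y. g y $ i $ j) x
    = partial_deriv k (\<lambda>y. \<Sum>a\<in>UNIV. h a y * \<theta> a i y * \<theta> a j y) x"
    by (rule partial_deriv_cong[OF open_U, symmetric]) (auto intro!: elementary_sum el simp: metric x)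
  ultimately show "partial_deriv k (\<lambda>y. g y $ i $ j) x
      = (\<Sum>l\<in>UNIV. g x $ i $ l * (\<Sum>a\<in>UNIV. E a l x * (partial_deriv k (\<theta> a j) x
      + (\<Sum>b\<in>UNIV. form a b k x * \<theta> b j x))))
      + (\<Sum>l\<in>UNIV. g x $ j $ l * (\<Sum>a\<in>UNIV. E a l x * (partial_deriv k (\<theta> a i) x
      + (\<Sum>b\<in>UNIV. form a b k x * \<theta> b i x))))"
    unfolding lower N_def by simp
qed

text \<open>The tetrad postulate: the covariant derivative of the coframe in both kinds of index
  vanishes. It trades each derivative of the coframe for a Christoffel term, which cancels in
  tensorial expressions, and a connection-form term, which survives.\<close>

lemma partial_deriv_coframe:
  assumes x: "x \<in> U"
  shows "partial_deriv i (\<theta> a j) x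
    = (\<Sum>k\<in>UNIV. christoffel g k i j x * \<theta> a k x) - (\<Sum>b\<in>UNIV. form a b i x * \<theta> b j x)"
proof -
  define N where "N a = partial_deriv i (\<theta> a j) x + (\<Sum>b\<in>UNIV. form a b i x * \<theta> b j x)" for a
  have "(\<Sum>k\<in>UNIV. christoffel g k i j x * \<theta> a k x) = (\<Sum>k\<in>UNIV. \<Sum>b\<in>UNIV. E b k x * \<theta> a k x * N b)"
    unfolding christoffel_frame[OF x] N_def[symmetric] by (simp add: sum_distrib_left mult_ac)
  also have "\<dots> = N a"
    by (subst sum.swap) (simp flip: sum_distrib_right add: dual[OF x])
  finally show ?thesis by (simp add: N_def)
qed

end

section \<open>Rank-four tensors given by frame components\<close>

definition multilin4 :: "('n::finite \<Rightarrow> 'n \<Rightarrow> 'n \<Rightarrow> 'n \<Rightarrow> real) \<Rightarrow> ('n \<Rightarrow> real) \<Rightarrow> ('n \<Rightarrow> real)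
    \<Rightarrow> ('n \<Rightarrow> real) \<Rightarrow> ('n \<Rightarrow> real) \<Rightarrow> real" where
  "multilin4 t X Y Z V = (\<Sum>a\<in>UNIV. \<Sum>b\<in>UNIV. \<Sum>c\<in>UNIV. \<Sum>d\<in>UNIV. t a b c d * X a * Y b * Z c * V d)"

lemma multilin4_swap:
  "multilin4 t X Y Z V = multilin4 (\<lambda>a b c d. t b a c d) Y X Z V"
  "multilin4 t X Y Z V = multilin4 (\<lambda>a b c d. t a c b d) X Z Y V"
  "multilin4 t X Y Z V = multilin4 (\<lambda>a b c d. t a b d c) X Y V Z"
  unfolding multilin4_def
  by (subst sum.swap, simp add: mult_ac)
    (rule sum.cong, simp, subst sum.swap, simp add: mult_ac,
     rule sum.cong, simp, rule sum.cong, simp, subst sum.swap, simp add: mult_ac)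

lemma multilin4_add:
  "multilin4 (\<lambda>a b c d. t a b c d + u a b c d) X Y Z V = multilin4 t X Y Z V + multilin4 u X Y Z V"
  unfolding multilin4_def by (simp add: sum.distrib distrib_right)

lemma multilin4_diff:
  "multilin4 (\<lambda>a b c d. t a b c d - u a b c d) X Y Z V = multilin4 t X Y Z V - multilin4 u X Y Z V"
  unfolding multilin4_def by (simp add: sum_subtractf left_diff_distrib)

lemma multilin4_scale:
  "multilin4 (\<lambda>a b c d. k * t a b c d) X Y Z V = k * multilin4 t X Y Z V"
  unfolding multilin4_def by (simp add: sum_distrib_left mult_ac)

lemma multilin4_sum:
  "multilin4 (\<lambda>a b c d. \<Sum>e\<in>I. t e a b c d) X Y Z V = (\<Sum>e\<in>I. multilin4 (t e) X Y Z V)"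
  by (induction I rule: infinite_finite_induct)
    (simp_all add: multilin4_add, simp_all add: multilin4_def)

text \<open>The hypothesis has the shape of \<open>partial_deriv_coframe\<close>. The first part
  becomes a Christoffel correction of a coordinate index; the second is moved from the argument to
  the components \<open>t\<close>. The other slots follow by permuting arguments.\<close>

lemma multilin4_slot1:
  fixes t :: "'n::finite \<Rightarrow> 'n \<Rightarrow> 'n \<Rightarrow> 'n \<Rightarrow> real"
  assumes "\<And>a. X' a = (\<Sum>e\<in>UNIV. \<Gamma> e * \<theta> a e) - (\<Sum>e\<in>UNIV. w a e * X e)"
  shows "multilin4 t X' Y Z V = (\<Sum>e\<in>UNIV. \<Gamma> e * multilin4 t (\<lambda>a. \<theta> a e) Y Z V)
    - multilin4 (\<lambda>a b c d. \<Sum>e\<in>UNIV. w e a * t e b c d) X Y Z V"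
proof -
  define F where "F a = (\<Sum>b\<in>UNIV. \<Sum>c\<in>UNIV. \<Sum>d\<in>UNIV. t a b c d * Y b * Z c * V d)" for a
  have F: "multilin4 t X Y Z V = (\<Sum>a\<in>UNIV. F a * X a)" for X
    unfolding multilin4_def F_def by (simp add: sum_distrib_right sum_distrib_left mult_ac)
  have "multilin4 (\<lambda>a b c d. \<Sum>e\<in>UNIV. w e a * t e b c d) X Y Z V
      = (\<Sum>e\<in>UNIV. \<Sum>a\<in>UNIV. F e * (w e a * X a))"
    unfolding multilin4_sum F_def multilin4_def
    by (simp add: sum_distrib_right sum_distrib_left mult_ac)
  moreover have "(\<Sum>e\<in>UNIV. \<Gamma> e * multilin4 t (\<lambda>a. \<theta> a e) Y Z V) = (\<Sum>a\<in>UNIV. \<Sum>e\<in>UNIV. F a * (\<Gamma> e * \<theta> a e))"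
    unfolding F by (subst sum.swap) (simp add: sum_distrib_left mult_ac)
  ultimately show ?thesis
    unfolding F[of X'] assms by (simp add: right_diff_distrib sum_subtractf sum_distrib_left)
qed

lemma multilin4_slot2:
  fixes t :: "'n::finite \<Rightarrow> 'n \<Rightarrow> 'n \<Rightarrow> 'n \<Rightarrow> real"
  assumes "\<And>a. Y' a = (\<Sum>e\<in>UNIV. \<Gamma> e * \<theta> a e) - (\<Sum>e\<in>UNIV. w a e * Y e)"
  shows "multilin4 t X Y' Z V = (\<Sum>e\<in>UNIV. \<Gamma> e * multilin4 t X (\<lambda>a. \<theta> a e) Z V)
    - multilin4 (\<lambda>a b c d. \<Sum>e\<in>UNIV. w e b * t a e c d) X Y Z V"
  using multilin4_slot1[OF assms, where t = "\<lambda>a b. t b a" and Y = X and Z = Z and V = V]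
  by (simp flip: multilin4_swap(1)[of _ X])

lemma multilin4_slot3:
  fixes t :: "'n::finite \<Rightarrow> 'n \<Rightarrow> 'n \<Rightarrow> 'n \<Rightarrow> real"
  assumes "\<And>a. Z' a = (\<Sum>e\<in>UNIV. \<Gamma> e * \<theta> a e) - (\<Sum>e\<in>UNIV. w a e * Z e)"
  shows "multilin4 t X Y Z' V = (\<Sum>e\<in>UNIV. \<Gamma> e * multilin4 t X Y (\<lambda>a. \<theta> a e) V)
    - multilin4 (\<lambda>a b c d. \<Sum>e\<in>UNIV. w e c * t a b e d) X Y Z V"
  using multilin4_slot2[OF assms, where t = "\<lambda>a b c. t a c b" and X = X and Z = Y and V = V]
  by (simp flip: multilin4_swap(2)[of _ X Y])

lemma multilin4_slot4:
  fixes t :: "'n::finite \<Rightarrow> 'n \<Rightarrow> 'n \<Rightarrow> 'n \<Rightarrow> real"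
  assumes "\<And>a. V' a = (\<Sum>e\<in>UNIV. \<Gamma> e * \<theta> a e) - (\<Sum>e\<in>UNIV. w a e * V e)"
  shows "multilin4 t X Y Z V' = (\<Sum>e\<in>UNIV. \<Gamma> e * multilin4 t X Y Z (\<lambda>a. \<theta> a e))
    - multilin4 (\<lambda>a b c d. \<Sum>e\<in>UNIV. w e d * t a b c e) X Y Z V"
  using multilin4_slot3[OF assms, where t = "\<lambda>a b c d. t a b d c" and X = X and Y = Y and V = Z]
  by (simp flip: multilin4_swap(3)[of _ X Y Z])

section \<open>Contraction with the inverse metric as a diagonal quadratic form\<close>

lemma sum_UNIV_pair: "(\<Sum>p\<in>UNIV. f p) = (\<Sum>a\<in>UNIV. \<Sum>b\<in>UNIV. f (a, b))"
  by (simp add: sum.cartesian_product flip: UNIV_Times_UNIV)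

text \<open>Diagonal contractions multiply: treating a tuple of indices as one index of a product
  type reduces contraction over five indices to repeated use of this binary rule.\<close>

lemma contraction_pair:
  fixes W :: "'i::finite \<Rightarrow> 'i \<Rightarrow> real" and W' :: "'j::finite \<Rightarrow> 'j \<Rightarrow> real"
  assumes "\<And>A B. (\<Sum>I\<in>UNIV. \<Sum>J\<in>UNIV. W I J * \<Theta> A I * \<Theta> B J) = delta A B / H A"
    and "\<And>A B. (\<Sum>I\<in>UNIV. \<Sum>J\<in>UNIV. W' I J * \<Theta>' A I * \<Theta>' B J) = delta A B / H' A"
  shows "(\<Sum>I\<in>UNIV. \<Sum>J\<in>UNIV. (case I of (i, i') \<Rightarrow> case J of (j, j') \<Rightarrow> W i j * W' i' j')
      * (case A of (a, a') \<Rightarrow> case I of (i, i') \<Rightarrow> \<Theta> a i * \<Theta>' a' i')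
      * (case B of (b, b') \<Rightarrow> case J of (j, j') \<Rightarrow> \<Theta> b j * \<Theta>' b' j'))
    = delta A B / (case A of (a, a') \<Rightarrow> H a * H' a')"
proof -
  obtain a a' b b' where AB: "A = (a, a')" "B = (b, b')" by fastforce
  have "(\<Sum>I\<in>UNIV. \<Sum>J\<in>UNIV. (case I of (i, i') \<Rightarrow> case J of (j, j') \<Rightarrow> W i j * W' i' j')
      * (case A of (a, a') \<Rightarrow> case I of (i, i') \<Rightarrow> \<Theta> a i * \<Theta>' a' i')
      * (case B of (b, b') \<Rightarrow> case J of (j, j') \<Rightarrow> \<Theta> b j * \<Theta>' b' j'))
    = (\<Sum>i\<in>UNIV. \<Sum>i'\<in>UNIV. \<Sum>j\<in>UNIV. \<Sum>j'\<in>UNIV. (W i j * \<Theta> a i * \<Theta> b j) * (W' i' j' * \<Theta>' a' i' * \<Theta>' b' j'))"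
    by (simp add: AB sum_UNIV_pair mult_ac)
  also have "\<dots> = (\<Sum>i\<in>UNIV. \<Sum>j\<in>UNIV. W i j * \<Theta> a i * \<Theta> b j) * (\<Sum>i'\<in>UNIV. \<Sum>j'\<in>UNIV. W' i' j' * \<Theta>' a' i'
    * \<Theta>' b' j')"
    by (simp only: sum_product)
  finally show ?thesis
    unfolding assms by (auto simp: AB delta_def)
qed

text \<open>The frame diagonalises the contraction \<open>W\<close>, so the double sum over
  components collapses to a weighted sum of squares.\<close>

lemma contraction_quadratic:
  fixes W :: "'i::finite \<Rightarrow> 'i \<Rightarrow> real" and t :: "'a::finite \<Rightarrow> real"
  assumes "\<And>A B. (\<Sum>I\<in>UNIV. \<Sum>J\<in>UNIV. W I J * \<Theta> A I * \<Theta> B J) = delta A B / H A"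
    and "\<And>I. D I = (\<Sum>A\<in>UNIV. t A * \<Theta> A I)"
  shows "(\<Sum>I\<in>UNIV. D I * (\<Sum>J\<in>UNIV. W I J * D J)) = (\<Sum>A\<in>UNIV. (t A)^2 / H A)"
proof -
  have "(\<Sum>I\<in>UNIV. D I * (\<Sum>J\<in>UNIV. W I J * D J))
      = (\<Sum>I\<in>UNIV. \<Sum>J\<in>UNIV. \<Sum>A\<in>UNIV. \<Sum>B\<in>UNIV. t A * t B * (W I J * \<Theta> A I * \<Theta> B J))"
  proof -
    have "D I * (\<Sum>J\<in>UNIV. W I J * D J) = (\<Sum>J\<in>UNIV. W I J * (D I * D J))" for I
      by (simp add: sum_distrib_left mult_ac)
    moreover have "W I J * (D I * D J) = (\<Sum>A\<in>UNIV. \<Sum>B\<in>UNIV. t A * t B * (W I J * \<Theta> A I * \<Theta> B J))" for I J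
      unfolding assms(2) sum_product by (simp add: sum_distrib_left mult_ac)
    ultimately show ?thesis by simp
  qed
  also have "\<dots> = (\<Sum>A\<in>UNIV. \<Sum>B\<in>UNIV. \<Sum>I\<in>UNIV. \<Sum>J\<in>UNIV. t A * t B * (W I J * \<Theta> A I * \<Theta> B J))"
    by (subst sum_rotate3, rule sum.cong[OF refl], rule sum_rotate3)
  also have "\<dots> = (\<Sum>A\<in>UNIV. \<Sum>B\<in>UNIV. t A * t B * (delta A B / H A))"
    unfolding assms(1)[symmetric] by (simp add: sum_distrib_left)
  also have "\<dots> = (\<Sum>A\<in>UNIV. \<Sum>B\<in>UNIV. delta A B * (t A * t B / H A))"
    by (simp add: mult_ac)
  finally show ?thesis unfolding sum_delta_mult by (simp add: power2_eq_square)
qed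

section \<open>Curvature and covariant derivative in the frame\<close>

context orthogonal_frame
begin

text \<open>\<open>matrix_inv\<close> is not among the constructions of the class; membership comes
  through the rule \<open>cong\<close> from the frame expression, which agrees on
  \<open>U\<close>.\<close>

lemma el_christoffel: "elementary U (christoffel g k i j)"
proof (rule elementary.cong)
  show "elementary U (\<lambda>x. \<Sum>a\<in>UNIV. E a k x * (partial_deriv i (\<theta> a j) x + (\<Sum>b\<in>UNIV. form a b i x * \<theta> b j x)))"
    by (intro elementary_intros elementary_partial_deriv[OF open_U] el_E el_\<theta> el_form)
qed (simp add: christoffel_frame)

text \<open>Frame components R^a_bcd. The frame vectors do not commute, and the term with
  \<open>C\<close> is the derivative along the bracket of \<open>E c\<close> and
  \<open>E d\<close>.\<close>

definition curv :: "'n \<Rightarrow> 'n \<Rightarrow> 'n \<Rightarrow> 'n \<Rightarrow> real^'n \<Rightarrow> real" where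
  "curv a b c d x = dir c (conn a d b) x - dir d (conn a c b) x
     + (\<Sum>e\<in>UNIV. conn a c e x * conn e d b x - conn a d e x * conn e c b x - C e c d x * conn a e b x)"

text \<open>Cartan's curvature two-form d omega + omega wedge omega.\<close>

definition curv_form :: "'n \<Rightarrow> 'n \<Rightarrow> 'n \<Rightarrow> 'n \<Rightarrow> real^'n \<Rightarrow> real" where
  "curv_form a b p q x = partial_deriv p (form a b q) x - partial_deriv q (form a b p) x
     + (\<Sum>e\<in>UNIV. form a e p x * form e b q x - form a e q x * form e b p x)"

text \<open>The integrability condition of \<open>partial_deriv_coframe\<close>: differentiate it
  once more and use that second derivatives of the coframe commute. The Christoffel part gives the
  Riemann tensor, the connection-form part the curvature form.\<close>

lemma riemann_up_curv_form:
  assumes x: "x \<in> U"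
  shows "(\<Sum>k\<in>UNIV. \<theta> a k x * riemann_up g k j p q x) = (\<Sum>b\<in>UNIV. curv_form a b p q x * \<theta> b j x)"
proof -
  define G where "G = christoffel g"
  define M where "M p q = (\<Sum>b\<in>UNIV. form a b p x * (\<Sum>k\<in>UNIV. G k q j x * \<theta> b k x))" for p q
  note el = elementary_intros el_\<theta> el_form el_christoffel[folded G_def] elementary_partial_deriv[OF open_U]
  note cof = partial_deriv_coframe[folded G_def]
  have "partial_deriv p (partial_deriv q (\<theta> a j)) x =
     (\<Sum>k\<in>UNIV. (partial_deriv p (G k q j) x + (\<Sum>e\<in>UNIV. G k p e x * G e q j x)) * \<theta> a k x)
     - M p q - M q p
     - (\<Sum>b\<in>UNIV. (partial_deriv p (form a b q) x - (\<Sum>e\<in>UNIV. form a e q x * form e b p x)) * \<theta> b j x)" for p q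
  proof -
    have "partial_deriv p (partial_deriv q (\<theta> a j)) x
      = partial_deriv p (\<lambda>x. (\<Sum>k\<in>UNIV. G k q j x * \<theta> a k x) + (\<Sum>b\<in>UNIV. - form a b q x * \<theta> b j x)) x"
      by (rule partial_deriv_cong[OF open_U]) (auto intro!: el x simp: cof sum_negf)
    also have "\<dots> = (\<Sum>k\<in>UNIV. G k q j x * partial_deriv p (\<theta> a k) x + partial_deriv p (G k q j) x * \<theta> a k x)
      + (\<Sum>b\<in>UNIV. - form a b q x * partial_deriv p (\<theta> b j) x + - partial_deriv p (form a b q) x * \<theta> b j x)"
      by (simp add: partial_deriv_add[OF open_U] partial_deriv_sum[OF open_U] partial_deriv_mult[OF open_U]
          partial_deriv_minus[OF open_U] el x)
    also have "(\<Sum>k\<in>UNIV. G k q j x * partial_deriv p (\<theta> a k) x + partial_deriv p (G k q j) x * \<theta> a k x)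
      = (\<Sum>k\<in>UNIV. (partial_deriv p (G k q j) x + (\<Sum>e\<in>UNIV. G k p e x * G e q j x)) * \<theta> a k x) - M p q"
    proof -
      have "(\<Sum>k\<in>UNIV. G k q j x * (\<Sum>l\<in>UNIV. G l p k x * \<theta> a l x))
        = (\<Sum>k\<in>UNIV. (\<Sum>e\<in>UNIV. G k p e x * G e q j x) * \<theta> a k x)"
        by (simp add: sum_distrib_left sum_distrib_right) (subst sum.swap, simp add: mult_ac)
      moreover have "(\<Sum>k\<in>UNIV. G k q j x * (\<Sum>b\<in>UNIV. form a b p x * \<theta> b k x)) = M p q"
        unfolding M_def by (simp add: sum_distrib_left) (subst sum.swap, simp add: mult_ac)
      ultimately show ?thesis
        by (simp add: cof[OF x] sum.distrib sum_subtractf right_diff_distrib distrib_right)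
    qed
    also have "(\<Sum>b\<in>UNIV. - form a b q x * partial_deriv p (\<theta> b j) x +
      - partial_deriv p (form a b q) x * \<theta> b j x)
      = - M q p - (\<Sum>b\<in>UNIV. (partial_deriv p (form a b q) x
      - (\<Sum>e\<in>UNIV. form a e q x * form e b p x)) * \<theta> b j x)"
    proof -
      have "(\<Sum>b\<in>UNIV. form a b q x * (\<Sum>e\<in>UNIV. form b e p x * \<theta> e j x))
        = (\<Sum>b\<in>UNIV. (\<Sum>e\<in>UNIV. form a e q x * form e b p x) * \<theta> b j x)"
        by (simp add: sum_distrib_left sum_distrib_right) (subst sum.swap, simp add: mult_ac)
      then show ?thesis
        unfolding M_def
        by (simp add: cof[OF x] sum.distrib sum_subtractf right_diff_distrib left_diff_distrib sum_negf)
    qed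
    finally show ?thesis by simp
  qed
  \<comment> \<open>The cross terms \<open>M p q\<close> and \<open>M q p\<close> enter both
    instances symmetrically, so they disappear in the difference.\<close>
  note this[of p q] this[of q p]
  moreover have "partial_deriv p (partial_deriv q (\<theta> a j)) x = partial_deriv q (partial_deriv p (\<theta> a j)) x"
    by (rule partial_deriv_commute[OF open_U el_\<theta> x])
  moreover have "(\<Sum>k\<in>UNIV. \<theta> a k x * riemann_up g k j p q x)
      = (\<Sum>k\<in>UNIV. (partial_deriv p (G k q j) x + (\<Sum>e\<in>UNIV. G k p e x * G e q j x)) * \<theta> a k x)
      - (\<Sum>k\<in>UNIV. (partial_deriv q (G k p j) x + (\<Sum>e\<in>UNIV. G k q e x * G e p j x)) * \<theta> a k x)"
    unfolding riemann_up_def G_def sum_subtractf[symmetric]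
    by (rule sum.cong) (simp_all add: sum_subtractf algebra_simps)
  moreover have "(\<Sum>b\<in>UNIV. curv_form a b p q x * \<theta> b j x)
      = (\<Sum>b\<in>UNIV. (partial_deriv p (form a b q) x - (\<Sum>e\<in>UNIV. form a e q x * form e b p x)) * \<theta> b j x)
      - (\<Sum>b\<in>UNIV. (partial_deriv q (form a b p) x - (\<Sum>e\<in>UNIV. form a e p x * form e b q x)) * \<theta> b j x)"
    unfolding curv_form_def sum_subtractf[symmetric]
    by (rule sum.cong) (simp_all add: sum_subtractf algebra_simps)
  ultimately show ?thesis by linarith
qed

text \<open>In the exterior derivative of omega = conn \<theta>, derivatives of the coefficients
  become \<open>dir\<close> terms, and derivatives of the coframe become, through
  \<open>structure_eq\<close>, the bracket term of \<open>curv\<close>.\<close>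

lemma curv_form_curv:
  assumes x: "x \<in> U"
  shows "curv_form a b p q x = (\<Sum>c\<in>UNIV. \<Sum>d\<in>UNIV. curv a b c d x * \<theta> c p x * \<theta> d q x)"
proof -
  have d: "partial_deriv p (form a b q) x
    = (\<Sum>d\<in>UNIV. conn a d b x * partial_deriv p (\<theta> d q) x + partial_deriv p (conn a d b) x * \<theta> d q x)" for p q
    unfolding form_def
    by (simp add: partial_deriv_sum[OF open_U] partial_deriv_mult[OF open_U] elementary.mult el_conn el_\<theta> x)
  have t1: "(\<Sum>d\<in>UNIV. partial_deriv p (conn a d b) x * \<theta> d q x)
      = (\<Sum>c\<in>UNIV. \<Sum>d\<in>UNIV. dir c (conn a d b) x * \<theta> c p x * \<theta> d q x)"
    unfolding partial_deriv_dir[OF x] sum_distrib_right by (subst sum.swap) (simp add: mult_ac)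
  have t1': "(\<Sum>d\<in>UNIV. partial_deriv q (conn a d b) x * \<theta> d p x)
      = (\<Sum>c\<in>UNIV. \<Sum>d\<in>UNIV. dir d (conn a c b) x * \<theta> c p x * \<theta> d q x)"
    unfolding partial_deriv_dir[OF x] by (simp add: sum_distrib_right sum_distrib_left mult_ac)
  have "(\<Sum>e\<in>UNIV. conn a e b x * partial_deriv p (\<theta> e q) x)
    - (\<Sum>e\<in>UNIV. conn a e b x * partial_deriv q (\<theta> e p) x)
      = (\<Sum>e\<in>UNIV. conn a e b x * (partial_deriv p (\<theta> e q) x - partial_deriv q (\<theta> e p) x))"
    by (simp add: sum_subtractf right_diff_distrib)
  also have "\<dots> = - (\<Sum>e\<in>UNIV. \<Sum>c\<in>UNIV. \<Sum>d\<in>UNIV. C e c d x * conn a e b x * \<theta> c p x * \<theta> d q x)"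
    by (simp add: structure_eq[OF x] sum_negf sum_distrib_left mult_ac)
  also have "\<dots> = - (\<Sum>c\<in>UNIV. \<Sum>d\<in>UNIV. \<Sum>e\<in>UNIV. C e c d x * conn a e b x * \<theta> c p x * \<theta> d q x)"
    by (subst sum_rotate3) (rule refl)
  finally have t2: "(\<Sum>e\<in>UNIV. conn a e b x * partial_deriv p (\<theta> e q) x)
    - (\<Sum>e\<in>UNIV. conn a e b x * partial_deriv q (\<theta> e p) x)
      = - (\<Sum>c\<in>UNIV. \<Sum>d\<in>UNIV. \<Sum>e\<in>UNIV. C e c d x * conn a e b x * \<theta> c p x * \<theta> d q x)" .
  have form2: "(\<Sum>e\<in>UNIV. form a e p x * form e b q x)
      = (\<Sum>e\<in>UNIV. \<Sum>c\<in>UNIV. \<Sum>d\<in>UNIV. conn a c e x * conn e d b x * \<theta> c p x * \<theta> d q x)" for p q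
    unfolding form_def by (simp add: sum_product) (simp add: mult_ac)
  have t3: "(\<Sum>e\<in>UNIV. form a e p x * form e b q x)
      = (\<Sum>c\<in>UNIV. \<Sum>d\<in>UNIV. \<Sum>e\<in>UNIV. conn a c e x * conn e d b x * \<theta> c p x * \<theta> d q x)" for p q
    unfolding form2 by (rule sum_rotate3[symmetric])
  have t3': "(\<Sum>e\<in>UNIV. form a e q x * form e b p x)
      = (\<Sum>c\<in>UNIV. \<Sum>d\<in>UNIV. \<Sum>e\<in>UNIV. conn a d e x * conn e c b x * \<theta> c p x * \<theta> d q x)"
    unfolding t3[of q p] by (subst sum.swap) (simp add: mult_ac)
  have "(\<Sum>c\<in>UNIV. \<Sum>d\<in>UNIV. curv a b c d x * \<theta> c p x * \<theta> d q x)
      = (\<Sum>c\<in>UNIV. \<Sum>d\<in>UNIV. dir c (conn a d b) x * \<theta> c p x * \<theta> d q x)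
      - (\<Sum>c\<in>UNIV. \<Sum>d\<in>UNIV. dir d (conn a c b) x * \<theta> c p x * \<theta> d q x)
      + ((\<Sum>c\<in>UNIV. \<Sum>d\<in>UNIV. \<Sum>e\<in>UNIV. conn a c e x * conn e d b x * \<theta> c p x * \<theta> d q x)
      - (\<Sum>c\<in>UNIV. \<Sum>d\<in>UNIV. \<Sum>e\<in>UNIV. conn a d e x * conn e c b x * \<theta> c p x * \<theta> d q x)
      - (\<Sum>c\<in>UNIV. \<Sum>d\<in>UNIV. \<Sum>e\<in>UNIV. C e c d x * conn a e b x * \<theta> c p x * \<theta> d q x))"
    unfolding curv_def sum.distrib[symmetric] sum_subtractf[symmetric]
    by (intro sum.cong refl)
      (simp only: left_diff_distrib distrib_right sum_subtractf sum_distrib_right)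
  moreover have "curv_form a b p q x
      = ((\<Sum>e\<in>UNIV. conn a e b x * partial_deriv p (\<theta> e q) x)
      + (\<Sum>d\<in>UNIV. partial_deriv p (conn a d b) x * \<theta> d q x))
      - ((\<Sum>e\<in>UNIV. conn a e b x * partial_deriv q (\<theta> e p) x)
      + (\<Sum>d\<in>UNIV. partial_deriv q (conn a d b) x * \<theta> d p x))
      + ((\<Sum>e\<in>UNIV. form a e p x * form e b q x) - (\<Sum>e\<in>UNIV. form a e q x * form e b p x))"
    unfolding curv_form_def d by (simp only: sum.distrib sum_subtractf)
  ultimately show ?thesis
    using t1 t1' t2 t3[of p q] t3' by linarith
qed

lemma riemann_frame:
  assumes x: "x \<in> U"
  shows "riemann g i j k l x = multilin4 (\<lambda>a b c d. h a x * curv a b c d x)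
    (\<lambda>a. \<theta> a i x) (\<lambda>a. \<theta> a j x) (\<lambda>a. \<theta> a k x) (\<lambda>a. \<theta> a l x)"
proof -
  have "riemann g i j k l x = (\<Sum>e\<in>UNIV. \<Sum>a\<in>UNIV. h a x * \<theta> a i x * (\<theta> a e x * riemann_up g e j k l x))"
    unfolding riemann_def metric[OF x] sum_distrib_right by (simp add: mult_ac)
  also have "\<dots> = (\<Sum>a\<in>UNIV. h a x * \<theta> a i x * (\<Sum>e\<in>UNIV. \<theta> a e x * riemann_up g e j k l x))"
    by (subst sum.swap) (simp add: sum_distrib_left)
  also have "\<dots> = (\<Sum>a\<in>UNIV. h a x * \<theta> a i x * (\<Sum>b\<in>UNIV. (\<Sum>c\<in>UNIV. \<Sum>d\<in>UNIV. curv a b c d x * \<theta> c k x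
    * \<theta> d l x) * \<theta> b j x))"
    by (simp add: riemann_up_curv_form[OF x] curv_form_curv[OF x])
  finally show ?thesis
    unfolding multilin4_def by (simp add: sum_distrib_left sum_distrib_right mult_ac)
qed

definition frame_cov :: "('n \<Rightarrow> 'n \<Rightarrow> 'n \<Rightarrow> 'n \<Rightarrow> real^'n \<Rightarrow> real) \<Rightarrow> 'n \<Rightarrow> 'n \<Rightarrow> 'n \<Rightarrow> 'n \<Rightarrow> 'n \<Rightarrow> real^'n \<Rightarrow> real" where
  "frame_cov t f a b c d x = dir f (t a b c d) x
     - (\<Sum>e\<in>UNIV. conn e f a x * t e b c d x) - (\<Sum>e\<in>UNIV. conn e f b x * t a e c d x)
     - (\<Sum>e\<in>UNIV. conn e f c x * t a b e d x) - (\<Sum>e\<in>UNIV. conn e f d x * t a b c e x)"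

text \<open>By the Leibniz rule each of the four coframe factors is differentiated once; the
  Christoffel terms this produces are exactly those subtracted in \<open>cov_deriv4\<close>, leaving
  connection terms that act on the components.\<close>

lemma cov_deriv4_frame:
  assumes x: "x \<in> U" and el_t: "\<And>a b c d. elementary U (t a b c d)"
    and T: "\<And>x i j k l. x \<in> U \<Longrightarrow> T i j k l x = multilin4 (\<lambda>a b c d. t a b c d x)
      (\<lambda>a. \<theta> a i x) (\<lambda>a. \<theta> a j x) (\<lambda>a. \<theta> a k x) (\<lambda>a. \<theta> a l x)"
  shows "cov_deriv4 g T m i j k l x = (\<Sum>f\<in>UNIV. \<theta> f m x * multilin4 (\<lambda>a b c d. frame_cov t f a b c d x)
    (\<lambda>a. \<theta> a i x) (\<lambda>a. \<theta> a j x) (\<lambda>a. \<theta> a k x) (\<lambda>a. \<theta> a l x))"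
proof -
  let ?X = "\<lambda>i a. \<theta> a i x" and ?t = "\<lambda>a b c d. t a b c d x"
  let ?d = "\<lambda>i a. partial_deriv m (\<theta> a i) x"
  note el = elementary_intros el_\<theta> el_t
  have "elementary U (\<lambda>y. multilin4 (\<lambda>a b c d. t a b c d y) (\<lambda>a. \<theta> a i y) (\<lambda>a. \<theta> a j y) (\<lambda>a. \<theta> a k y)
    (\<lambda>a. \<theta> a l y))"
    unfolding multilin4_def by (intro el)
  then have "partial_deriv m (T i j k l) x
    = partial_deriv m (\<lambda>y. multilin4 (\<lambda>a b c d. t a b c d y) (\<lambda>a. \<theta> a i y) (\<lambda>a. \<theta> a j y) (\<lambda>a. \<theta> a k y)
      (\<lambda>a. \<theta> a l y)) x"
    by (intro partial_deriv_cong[OF open_U, symmetric]) (simp_all add: T x)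
  also have "\<dots> = multilin4 (\<lambda>a b c d. partial_deriv m (t a b c d) x) (?X i) (?X j) (?X k) (?X l)
      + multilin4 ?t (?d i) (?X j) (?X k) (?X l) + multilin4 ?t (?X i) (?d j) (?X k) (?X l)
      + multilin4 ?t (?X i) (?X j) (?d k) (?X l) + multilin4 ?t (?X i) (?X j) (?X k) (?d l)"
    unfolding multilin4_def
    by (simp add: partial_deriv_sum[OF open_U] partial_deriv_mult[OF open_U] el x
        sum.distrib[symmetric] distrib_right distrib_left add_ac)
  finally have pd: "partial_deriv m (T i j k l) x = \<dots>" .
  have cof: "?d i a = (\<Sum>e\<in>UNIV. christoffel g e m i x * ?X e a) - (\<Sum>e\<in>UNIV. form a e m x * ?X i e)" for i a
    by (rule partial_deriv_coframe[OF x])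
  have form: "(\<Sum>e\<in>UNIV. form e a m x * F e) = (\<Sum>f\<in>UNIV. \<theta> f m x * (\<Sum>e\<in>UNIV. conn e f a x * F e))" for a F
    unfolding form_def by (simp add: sum_distrib_left sum_distrib_right) (subst sum.swap, simp add: mult_ac)
  show ?thesis
    unfolding cov_deriv4_def pd multilin4_slot1[where X' = "?d i", OF cof] multilin4_slot2[where Y'
      = "?d j", OF cof]
      multilin4_slot3[where Z' = "?d k", OF cof] multilin4_slot4[where V' = "?d l", OF cof]
      frame_cov_def multilin4_diff form multilin4_sum multilin4_scale partial_deriv_dir[OF x, of _ "t _ _
      _ _"]
    by (simp add: T[OF x] sum.distrib sum_subtractf right_diff_distrib)
qed

lemma contraction_frame:
  assumes x: "x \<in> U"
  shows "(\<Sum>i\<in>UNIV. \<Sum>j\<in>UNIV. inv_metric g x $ i $ j * \<theta> a i x * \<theta> b j x) = delta a b / h a x"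
proof -
  have "(\<Sum>i\<in>UNIV. \<Sum>j\<in>UNIV. inv_metric g x $ i $ j * \<theta> a i x * \<theta> b j x)
    = (\<Sum>i\<in>UNIV. \<Sum>j\<in>UNIV. \<Sum>c\<in>UNIV. (E c i x * \<theta> a i x) * (E c j x * \<theta> b j x) / h c x)"
    by (simp add: inv_metric_frame(1)[OF x] sum_distrib_right sum_distrib_left mult_ac)
  also have "\<dots> = (\<Sum>c\<in>UNIV. (\<Sum>i\<in>UNIV. E c i x * \<theta> a i x) * (\<Sum>j\<in>UNIV. E c j x * \<theta> b j x) / h c x)"
    by (subst sum_rotate3) (simp add: sum_product sum_divide_distrib)
  also have "\<dots> = (\<Sum>c\<in>UNIV. delta c a * (delta c b / h c x))"
    by (simp add: dual[OF x])
  finally show ?thesis unfolding sum_delta_mult .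
qed

text \<open>\<open>t\<close> is any explicit expression agreeing with the lowered curvature on
  \<open>U\<close>; it is differentiated in place of \<open>curv\<close>, so its symmetries and its
  derivatives can be read off directly.\<close>

lemma karlhede_invariant_frame:
  assumes x: "x \<in> U" and el_t: "\<And>a b c d. elementary U (t a b c d)"
    and t: "\<And>x a b c d. x \<in> U \<Longrightarrow> h a x * curv a b c d x = t a b c d x"
  shows "karlhede_invariant g x = (\<Sum>f\<in>UNIV. \<Sum>a\<in>UNIV. \<Sum>b\<in>UNIV. \<Sum>c\<in>UNIV. \<Sum>d\<in>UNIV.
    (frame_cov t f a b c d x)^2 / (h f x * (h a x * (h b x * (h c x * h d x)))))"
proof -
  let ?D = "cov_deriv4 g (riemann g)"
  have D: "?D m i j k l x = (\<Sum>f\<in>UNIV. \<theta> f m x * multilin4 (\<lambda>a b c d. frame_cov t f a b c d x)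
    (\<lambda>a. \<theta> a i x) (\<lambda>a. \<theta> a j x) (\<lambda>a. \<theta> a k x) (\<lambda>a. \<theta> a l x))" for m i j k l
    by (rule cov_deriv4_frame[OF x el_t]) (simp add: riemann_frame t)
  \<comment> \<open>One index, then pairs, up to nested quintuples, in the order of the nested
    product type used for \<open>I\<close> and \<open>A\<close>.\<close>
  note c1 = contraction_frame[OF x]
  note c2 = contraction_pair[OF c1 c1]
  note c3 = contraction_pair[OF c1 c2]
  note c4 = contraction_pair[OF c1 c3]
  note c5 = contraction_pair[OF c1 c4]
  have "karlhede_invariant g x = (\<Sum>(m, i, j, k, l)\<in>UNIV. ?D m i j k l x * raise5 g ?D m i j k l x)"
    unfolding karlhede_invariant_def by (simp add: sum.cartesian_product flip: UNIV_Times_UNIV)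
  also have "\<dots> = (\<Sum>I\<in>UNIV. (case I of (m, i, j, k, l) \<Rightarrow> ?D m i j k l x) * (\<Sum>J\<in>UNIV.
      (case I of (m, i, j, k, l) \<Rightarrow> case J of (m', i', j', k', l') \<Rightarrow>
         inv_metric g x $ m $ m' * (inv_metric g x $ i $ i' * (inv_metric g x $ j $ j'
        * (inv_metric g x $ k $ k' * inv_metric g x $ l $ l'))))
        * (case J of (m, i, j, k, l) \<Rightarrow> ?D m i j k l x)))"
    unfolding raise5_def by (simp add: sum.cartesian_product split_def mult_ac flip: UNIV_Times_UNIV)
  also have "\<dots> = (\<Sum>A\<in>UNIV. (case A of (f, a, b, c, d) \<Rightarrow> frame_cov t f a b c d x)^2
      / (case A of (f, a, b, c, d) \<Rightarrow> h f x * (h a x * (h b x * (h c x * h d x)))))"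
  proof (rule contraction_quadratic)
    fix I :: "'n \<times> 'n \<times> 'n \<times> 'n \<times> 'n"
    show "(case I of (m, i, j, k, l) \<Rightarrow> ?D m i j k l x)
      = (\<Sum>A\<in>UNIV. (case A of (f, a, b, c, d) \<Rightarrow> frame_cov t f a b c d x)
      * (case A of (f, a, b, c, d) \<Rightarrow> case I of (m, i, j, k, l) \<Rightarrow> \<theta> f m x * (\<theta> a i x * (\<theta> b j x
      * (\<theta> c k x * \<theta> d l x)))))"
      unfolding D multilin4_def sum_distrib_left
      by (simp add: sum.cartesian_product split_def mult_ac flip: UNIV_Times_UNIV)
  next
    fix A B :: "'n \<times> 'n \<times> 'n \<times> 'n \<times> 'n"
    show "(\<Sum>I\<in>UNIV. \<Sum>J\<in>UNIV. (case I of (m, i, j, k, l) \<Rightarrow> case J of (m', i', j', k', l') \<Rightarrow>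
         inv_metric g x $ m $ m' * (inv_metric g x $ i $ i' * (inv_metric g x $ j $ j'
        * (inv_metric g x $ k $ k' * inv_metric g x $ l $ l'))))
        * (case A of (f, a, b, c, d) \<Rightarrow> case I of (m, i, j, k, l) \<Rightarrow> \<theta> f m x * (\<theta> a i x * (\<theta> b j x
        * (\<theta> c k x * \<theta> d l x))))
        * (case B of (f, a, b, c, d) \<Rightarrow> case J of (m, i, j, k, l) \<Rightarrow> \<theta> f m x * (\<theta> a i x * (\<theta> b j x
        * (\<theta> c k x * \<theta> d l x)))))
      = delta A B / (case A of (f, a, b, c, d) \<Rightarrow> h f x * (h a x * (h b x * (h c x * h d x))))"
      using c5[of A B] by (simp add: split_def)
  qed
  finally show ?thesis
    by (simp add: sum.cartesian_product split_def flip: UNIV_Times_UNIV)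
qed

lemma curv_skew: "curv a b d c x = - curv a b c d x"
  unfolding curv_def
  by (subst C_skew) (simp add: sum_negf[symmetric] flip: sum.distrib sum_subtractf, simp add:
    sum_subtractf sum_negf sum.distrib algebra_simps)

lemma dir_const: "dir i (\<lambda>x. k) x = 0"
  by (simp add: dir_def partial_deriv_const[OF open_U])

lemma
  assumes "elementary U f" "elementary U f'" "x \<in> U"
  shows dir_mult: "dir i (\<lambda>x. f x * f' x) x = f x * dir i f' x + dir i f x * f' x"
    and dir_add: "dir i (\<lambda>x. f x + f' x) x = dir i f x + dir i f' x"
  unfolding dir_def partial_deriv_mult[OF open_U assms] partial_deriv_add[OF open_U assms]
  by (simp_all add: sum_distrib_left sum_distrib_right sum.distrib algebra_simps)

lemma dir_linear:
  assumes "elementary U f" "elementary U f'" "x \<in> U"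
  shows "dir i (\<lambda>x. k * f x + l * f' x) x = k * dir i f x + l * dir i f' x"
  using assms by (simp add: dir_add dir_mult dir_const elementary_intros)

lemma dir_minus:
  assumes "elementary U f" "x \<in> U"
  shows "dir i (\<lambda>x. - f x) x = - dir i f x"
  unfolding dir_def partial_deriv_minus[OF open_U assms] by (simp add: sum_negf)

text \<open>Covariant differentiation respects the symmetries of the tensor. With
  \<open>frame_cov_pair\<close> this cuts the 256 components in each direction to 21.\<close>

lemma frame_cov_skew12:
  assumes "\<And>a b c d. elementary U (t a b c d)" "x \<in> U"
    and t: "\<And>a b c d x. t b a c d x = - t a b c d x"
  shows "frame_cov t f b a c d x = - frame_cov t f a b c d x"
proof -
  have "dir f (t b a c d) x = - dir f (t a b c d) x"
  proof -
    have "t b a c d = (\<lambda>x. - t a b c d x)" using t by blast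
    then show ?thesis using dir_minus[OF assms(1,2)] by simp
  qed
  then show ?thesis
    unfolding frame_cov_def t[of b _ _ _ x] t[of _ a _ _ x] by (simp add: sum_negf)
qed

lemma frame_cov_pair:
  assumes t: "\<And>a b c d. t c d a b = t a b c d"
  shows "frame_cov t f c d a b x = frame_cov t f a b c d x"
  unfolding frame_cov_def using t by (simp add: algebra_simps)

end

section \<open>Index sums under the Riemann symmetries\<close>

lemma sum_symmetric_4:
  fixes G :: "4 \<Rightarrow> 4 \<Rightarrow> real"
  assumes "\<And>i j. G j i = G i j" "\<And>i. G i i = 0"
  shows "(\<Sum>i\<in>UNIV. \<Sum>j\<in>UNIV. G i j) = 2 * (G 1 2 + G 1 3 + G 1 4 + G 2 3 + G 2 4 + G 3 4)"
  unfolding sum_4 assms(2) assms(1)[of 2 1] assms(1)[of 3 1] assms(1)[of 4 1] assms(1)[of 3 2]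
    assms(1)[of 4 2] assms(1)[of 4 3]
  by simp

text \<open>\<open>G\<close> will be a squared component divided by weights, so skewness of the
  component turns into symmetry with vanishing diagonal. Among the six index pairs, an equal choice
  of both pairs is met 2 * 2 times, an unequal one 2 * 2 * 2 times.\<close>

lemma sum_riemann_symmetric:
  fixes G :: "4 \<Rightarrow> 4 \<Rightarrow> 4 \<Rightarrow> 4 \<Rightarrow> real"
  assumes s: "\<And>i j k l. G j i k l = G i j k l" and p: "\<And>i j k l. G k l i j = G i j k l"
    and z: "\<And>i k l. G i i k l = 0"
  shows "(\<Sum>i\<in>UNIV. \<Sum>j\<in>UNIV. \<Sum>k\<in>UNIV. \<Sum>l\<in>UNIV. G i j k l)
    = 4 * (G 1 2 1 2 + G 1 3 1 3 + G 1 4 1 4 + G 2 3 2 3 + G 2 4 2 4 + G 3 4 3 4)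
    + 8 * (G 1 2 1 3 + G 1 2 1 4 + G 1 2 2 3 + G 1 2 2 4 + G 1 2 3 4
      + G 1 3 1 4 + G 1 3 2 3 + G 1 3 2 4 + G 1 3 3 4
      + G 1 4 2 3 + G 1 4 2 4 + G 1 4 3 4 + G 2 3 2 4 + G 2 3 3 4 + G 2 4 3 4)"
proof -
  have s': "G i j l k = G i j k l" for i j k l
    using p[of i j l k] s[of k l i j] p[of i j k l] by simp
  have z': "G i j k k = 0" for i j k
    using p[of i j k k] z[of k i j] by simp
  have "(\<Sum>i\<in>UNIV. \<Sum>j\<in>UNIV. \<Sum>k\<in>UNIV. \<Sum>l\<in>UNIV. G i j k l)
    = (\<Sum>i\<in>UNIV. \<Sum>j\<in>UNIV. 2 * (G i j 1 2 + G i j 1 3 + G i j 1 4 + G i j 2 3 + G i j 2 4 + G i j 3 4))"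
    by (intro sum.cong refl sum_symmetric_4 s' z')
  also have "\<dots> = 2 * ((\<Sum>k\<in>{(1, 2), (1, 3), (1, 4), (2, 3), (2, 4), (3, 4)}.
      2 * (G (fst k) (snd k) 1 2 + G (fst k) (snd k) 1 3 + G (fst k) (snd k) 1 4
        + G (fst k) (snd k) 2 3 + G (fst k) (snd k) 2 4 + G (fst k) (snd k) 3 4)))"
    by (subst sum_symmetric_4) (simp_all add: s z)
  finally show ?thesis
    by (simp add: p[of 1 2 1 3] p[of 1 2 1 4] p[of 1 2 2 3] p[of 1 2 2 4] p[of 1 2 3 4]
      p[of 1 3 1 4] p[of 1 3 2 3] p[of 1 3 2 4] p[of 1 3 3 4] p[of 1 4 2 3]
      p[of 1 4 2 4] p[of 1 4 3 4] p[of 2 3 2 4] p[of 2 3 3 4] p[of 2 4 3 4])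
qed

section \<open>The adapted frame\<close>

locale akds =
  fixes a m \<Lambda> \<alpha> :: real
begin

definition S :: "real \<Rightarrow> real \<Rightarrow> real" where "S r c = r^2 + a^2 * c^2"
definition W :: "real \<Rightarrow> real \<Rightarrow> real" where "W r c = 1 - \<alpha> * r * c"

text \<open>
  \<open>\<xi> + \<i> \<eta>\<close> is the inverse of \<open>r - \<i> a c\<close>, where \<open>c = cos \<theta>\<close>. In terms of \<open>\<xi>, \<eta>\<close> and
  \<open>\<beta>, \<gamma>\<close> all connection coefficients below are polynomials.
\<close>

definition \<sigma> :: "real \<Rightarrow> real \<Rightarrow> real" where "\<sigma> r c = 1 / S r c"
definition \<xi> :: "real \<Rightarrow> real \<Rightarrow> real" where "\<xi> r c = r / S r c"
definition \<eta> :: "real \<Rightarrow> real \<Rightarrow> real" where "\<eta> r c = a * c / S r c"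
definition \<beta> :: "real \<Rightarrow> real \<Rightarrow> real" where "\<beta> r c = \<alpha> * c / W r c"
definition \<gamma> :: "real \<Rightarrow> real \<Rightarrow> real" where "\<gamma> r c = \<alpha> * r / W r c"

definition Q :: "real \<Rightarrow> real" where
  "Q r = (a^2 - 2 * m * r + r^2) * (1 - \<alpha>^2 * r^2) - 1/3 * \<Lambda> * (a^2 + r^2) * r^2"
definition Q1 :: "real \<Rightarrow> real" where
  "Q1 r = (2 * r - 2 * m) * (1 - \<alpha>^2 * r^2) - 2 * \<alpha>^2 * r * (a^2 - 2 * m * r + r^2)
     - 1/3 * \<Lambda> * (2 * a^2 * r + 4 * r^3)"
definition Q2 :: "real \<Rightarrow> real" where
  "Q2 r = 2 * (1 - \<alpha>^2 * r^2) - 4 * \<alpha>^2 * r * (2 * r - 2 * m) - 2 * \<alpha>^2 * (a^2 - 2 * m * r + r^2)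
     - 1/3 * \<Lambda> * (2 * a^2 + 12 * r^2)"

definition X :: "real \<Rightarrow> real" where
  "X c = (1 - 2 * \<alpha> * m * c + (\<alpha>^2 * a^2 + 1/3 * \<Lambda> * a^2) * c^2) * (1 - c^2)"
definition X1 :: "real \<Rightarrow> real" where
  "X1 c = (2 * (\<alpha>^2 * a^2 + 1/3 * \<Lambda> * a^2) * c - 2 * \<alpha> * m) * (1 - c^2)
     - 2 * c * (1 - 2 * \<alpha> * m * c + (\<alpha>^2 * a^2 + 1/3 * \<Lambda> * a^2) * c^2)"
definition X2 :: "real \<Rightarrow> real" where
  "X2 c = 2 * (\<alpha>^2 * a^2 + 1/3 * \<Lambda> * a^2) * (1 - c^2)
     - 4 * c * (2 * (\<alpha>^2 * a^2 + 1/3 * \<Lambda> * a^2) * c - 2 * \<alpha> * m)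
     - 2 * (1 - 2 * \<alpha> * m * c + (\<alpha>^2 * a^2 + 1/3 * \<Lambda> * a^2) * c^2)"

definition regular :: "real \<Rightarrow> real \<Rightarrow> bool" where
  "regular r c \<longleftrightarrow> S r c \<noteq> 0 \<and> W r c \<noteq> 0 \<and> Q r \<noteq> 0 \<and> X c \<noteq> 0"

definition chart :: "(real^4) set" where
  "chart = {x. regular (x $ 2) (cos (x $ 3))}"

definition lift :: "(real \<Rightarrow> real \<Rightarrow> real) \<Rightarrow> real^4 \<Rightarrow> real" where
  "lift f x = f (x $ 2) (cos (x $ 3))"

text \<open>
  The coframe \<open>u, dr / Q, d(cos \<theta>) / X, w\<close>. Scaling \<open>dr\<close> and \<open>d(cos \<theta>)\<close> this way removes all
  denominators \<open>Q\<close> and \<open>X\<close> from the connection coefficients.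
\<close>

definition coframe :: "4 \<Rightarrow> 4 \<Rightarrow> real^4 \<Rightarrow> real" where
  "coframe b i x =
     (if b = 1 then (if i = 1 then 1 else if i = 4 then - a * (1 - (cos (x $ 3))^2) else 0)
      else if b = 2 then (if i = 2 then 1 / Q (x $ 2) else 0)
      else if b = 3 then (if i = 3 then - sin (x $ 3) / X (cos (x $ 3)) else 0)
      else (if i = 1 then a else if i = 4 then - ((x $ 2)^2 + a^2) else 0))"

definition frame :: "4 \<Rightarrow> 4 \<Rightarrow> real^4 \<Rightarrow> real" where
  "frame b i x =
     (if b = 1 then (if i = 1 then ((x $ 2)^2 + a^2) / lift S x else if i = 4 then a / lift S x else 0)
      else if b = 2 then (if i = 2 then Q (x $ 2) else 0)
      else if b = 3 then (if i = 3 then - X (cos (x $ 3)) / sin (x $ 3) else 0)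
      else (if i = 1 then - a * (1 - (cos (x $ 3))^2) / lift S x else if i = 4 then - 1 / lift S x else 0))"

text \<open>Squared lengths of the frame vectors: S / Q * dr^2 equals S * Q * (dr / Q)^2, and with
  dc = - sin \<theta> d\<theta> likewise S / P * d\<theta>^2 equals S * X * (dc / X)^2; all are
  divided by W^2.\<close>

definition weight :: "4 \<Rightarrow> real \<Rightarrow> real \<Rightarrow> real" where
  "weight i r c =
     (if i = 1 then - Q r * \<sigma> r c / (W r c)^2 else
     (if i = 2 then Q r / (\<sigma> r c * (W r c)^2) else
     (if i = 3 then X c / (\<sigma> r c * (W r c)^2) else
     (if i = 4 then X c * \<sigma> r c / (W r c)^2 else
      0))))"

lemma weight_simps [simp]:
  "weight 1 r c = - Q r * \<sigma> r c / (W r c)^2"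
  "weight 2 r c = Q r / (\<sigma> r c * (W r c)^2)"
  "weight 3 r c = X c / (\<sigma> r c * (W r c)^2)"
  "weight 4 r c = X c * \<sigma> r c / (W r c)^2"
  by (simp_all add: weight_def)

text \<open>The values come from dphi = (a u - w) / S: then du = 2 a c dc wedge dphi and dw = - 2 r
  dr wedge dphi, while dr / Q and dc / X are closed.\<close>

definition struct :: "4 \<Rightarrow> 4 \<Rightarrow> 4 \<Rightarrow> real \<Rightarrow> real \<Rightarrow> real" where
  "struct i j k r c =
     (if (i, j, k) \<in> {(1, 3, 1)} then - 2 * a * \<eta> r c * X c else
     (if (i, j, k) \<in> {(1, 1, 3)} then 2 * a * \<eta> r c * X c else
     (if (i, j, k) \<in> {(1, 3, 4)} then 2 * \<eta> r c * X c else
     (if (i, j, k) \<in> {(1, 4, 3)} then - 2 * \<eta> r c * X c else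
     (if (i, j, k) \<in> {(4, 2, 1)} then 2 * a * \<xi> r c * Q r else
     (if (i, j, k) \<in> {(4, 1, 2)} then - 2 * a * \<xi> r c * Q r else
     (if (i, j, k) \<in> {(4, 2, 4)} then - 2 * \<xi> r c * Q r else
     (if (i, j, k) \<in> {(4, 4, 2)} then 2 * \<xi> r c * Q r else
      0))))))))"

text \<open>The complete table lets goals expanded by \<open>forall_4\<close> be evaluated by
  rewriting; the case form of the definition serves the proofs by \<open>elementary_if\<close>. The
  later tables have the same purpose.\<close>

lemma struct_simps [simp]:
  "struct 1 1 1 r c = 0"
  "struct 1 1 2 r c = 0"
  "struct 1 1 3 r c = 2 * a * \<eta> r c * X c"
  "struct 1 1 4 r c = 0"
  "struct 1 2 1 r c = 0"
  "struct 1 2 2 r c = 0"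
  "struct 1 2 3 r c = 0"
  "struct 1 2 4 r c = 0"
  "struct 1 3 1 r c = - 2 * a * \<eta> r c * X c"
  "struct 1 3 2 r c = 0"
  "struct 1 3 3 r c = 0"
  "struct 1 3 4 r c = 2 * \<eta> r c * X c"
  "struct 1 4 1 r c = 0"
  "struct 1 4 2 r c = 0"
  "struct 1 4 3 r c = - 2 * \<eta> r c * X c"
  "struct 1 4 4 r c = 0"
  "struct 2 1 1 r c = 0"
  "struct 2 1 2 r c = 0"
  "struct 2 1 3 r c = 0"
  "struct 2 1 4 r c = 0"
  "struct 2 2 1 r c = 0"
  "struct 2 2 2 r c = 0"
  "struct 2 2 3 r c = 0"
  "struct 2 2 4 r c = 0"
  "struct 2 3 1 r c = 0"
  "struct 2 3 2 r c = 0"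
  "struct 2 3 3 r c = 0"
  "struct 2 3 4 r c = 0"
  "struct 2 4 1 r c = 0"
  "struct 2 4 2 r c = 0"
  "struct 2 4 3 r c = 0"
  "struct 2 4 4 r c = 0"
  "struct 3 1 1 r c = 0"
  "struct 3 1 2 r c = 0"
  "struct 3 1 3 r c = 0"
  "struct 3 1 4 r c = 0"
  "struct 3 2 1 r c = 0"
  "struct 3 2 2 r c = 0"
  "struct 3 2 3 r c = 0"
  "struct 3 2 4 r c = 0"
  "struct 3 3 1 r c = 0"
  "struct 3 3 2 r c = 0"
  "struct 3 3 3 r c = 0"
  "struct 3 3 4 r c = 0"
  "struct 3 4 1 r c = 0"
  "struct 3 4 2 r c = 0"
  "struct 3 4 3 r c = 0"
  "struct 3 4 4 r c = 0"
  "struct 4 1 1 r c = 0"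
  "struct 4 1 2 r c = - 2 * a * \<xi> r c * Q r"
  "struct 4 1 3 r c = 0"
  "struct 4 1 4 r c = 0"
  "struct 4 2 1 r c = 2 * a * \<xi> r c * Q r"
  "struct 4 2 2 r c = 0"
  "struct 4 2 3 r c = 0"
  "struct 4 2 4 r c = - 2 * \<xi> r c * Q r"
  "struct 4 3 1 r c = 0"
  "struct 4 3 2 r c = 0"
  "struct 4 3 3 r c = 0"
  "struct 4 3 4 r c = 0"
  "struct 4 4 1 r c = 0"
  "struct 4 4 2 r c = 2 * \<xi> r c * Q r"
  "struct 4 4 3 r c = 0"
  "struct 4 4 4 r c = 0"
  by (simp_all add: struct_def)

text \<open>Closed form of \<open>conn\<close>, in the same order: component, direction,
  differentiated frame vector.\<close>

definition akds_conn :: "4 \<Rightarrow> 4 \<Rightarrow> 4 \<Rightarrow> real \<Rightarrow> real \<Rightarrow> real" where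
  "akds_conn i j k r c =
     (if (i, j, k) \<in> {(1, 2, 1), (1, 1, 2)} then Q1 r / 2 + Q r * (\<beta> r c - \<xi> r c) else
     (if (i, j, k) \<in> {(1, 3, 1)} then X c * (\<gamma> r c - a * \<eta> r c) else
     (if (i, j, k) \<in> {(1, 1, 3), (2, 3, 2), (2, 2, 3)} then X c * (\<gamma> r c + a * \<eta> r c) else
     (if (i, j, k) \<in> {(2, 2, 2)} then Q1 r / 2 + Q r * (\<beta> r c + \<xi> r c) else
     (if (i, j, k) \<in> {(3, 2, 3), (3, 3, 2), (4, 4, 2)} then Q r * (\<xi> r c + \<beta> r c) else
     (if (i, j, k) \<in> {(3, 3, 3)} then X1 c / 2 + X c * (\<gamma> r c + a * \<eta> r c) else
     (if (i, j, k) \<in> {(4, 2, 4)} then Q r * (\<beta> r c - \<xi> r c) else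
     (if (i, j, k) \<in> {(4, 3, 4), (4, 4, 3)} then X1 c / 2 + X c * (\<gamma> r c - a * \<eta> r c) else
     (if (i, j, k) \<in> {(2, 1, 1)} then (\<sigma> r c)^2 * (Q1 r / 2 + Q r * (\<beta> r c - \<xi> r c)) else
     (if (i, j, k) \<in> {(3, 1, 1)} then (\<sigma> r c)^2 * Q r * (\<gamma> r c + a * \<eta> r c) else
     (if (i, j, k) \<in> {(3, 2, 2)} then - Q r * (\<gamma> r c + a * \<eta> r c) else
     (if (i, j, k) \<in> {(2, 3, 3)} then - X c * (\<xi> r c + \<beta> r c) else
     (if (i, j, k) \<in> {(2, 4, 4)} then - X c * (\<sigma> r c)^2 * (\<xi> r c + \<beta> r c) else
     (if (i, j, k) \<in> {(3, 4, 4)} then - ((\<sigma> r c)^2 * (X1 c / 2 + X c * (\<gamma> r c - a * \<eta> r c))) else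
     (if (i, j, k) \<in> {(1, 3, 4)} then X c * \<eta> r c else
     (if (i, j, k) \<in> {(1, 4, 3)} then - X c * \<eta> r c else
     (if (i, j, k) \<in> {(3, 1, 4), (3, 4, 1)} then - Q r * (\<sigma> r c)^2 * \<eta> r c else
     (if (i, j, k) \<in> {(4, 1, 3), (4, 3, 1)} then Q r * \<eta> r c else
     (if (i, j, k) \<in> {(4, 2, 1)} then a * \<xi> r c * Q r else
     (if (i, j, k) \<in> {(4, 1, 2)} then - a * \<xi> r c * Q r else
     (if (i, j, k) \<in> {(2, 1, 4), (2, 4, 1)} then a * \<xi> r c * X c * (\<sigma> r c)^2 else
     (if (i, j, k) \<in> {(1, 2, 4), (1, 4, 2)} then a * \<xi> r c * X c else
      0))))))))))))))))))))))"

lemma akds_conn_simps [simp]: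
  "akds_conn 1 1 1 r c = 0"
  "akds_conn 1 1 2 r c = Q1 r / 2 + Q r * (\<beta> r c - \<xi> r c)"
  "akds_conn 1 1 3 r c = X c * (\<gamma> r c + a * \<eta> r c)"
  "akds_conn 1 1 4 r c = 0"
  "akds_conn 1 2 1 r c = Q1 r / 2 + Q r * (\<beta> r c - \<xi> r c)"
  "akds_conn 1 2 2 r c = 0"
  "akds_conn 1 2 3 r c = 0"
  "akds_conn 1 2 4 r c = a * \<xi> r c * X c"
  "akds_conn 1 3 1 r c = X c * (\<gamma> r c - a * \<eta> r c)"
  "akds_conn 1 3 2 r c = 0"
  "akds_conn 1 3 3 r c = 0"
  "akds_conn 1 3 4 r c = X c * \<eta> r c"
  "akds_conn 1 4 1 r c = 0"
  "akds_conn 1 4 2 r c = a * \<xi> r c * X c"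
  "akds_conn 1 4 3 r c = - X c * \<eta> r c"
  "akds_conn 1 4 4 r c = 0"
  "akds_conn 2 1 1 r c = (\<sigma> r c)^2 * (Q1 r / 2 + Q r * (\<beta> r c - \<xi> r c))"
  "akds_conn 2 1 2 r c = 0"
  "akds_conn 2 1 3 r c = 0"
  "akds_conn 2 1 4 r c = a * \<xi> r c * X c * (\<sigma> r c)^2"
  "akds_conn 2 2 1 r c = 0"
  "akds_conn 2 2 2 r c = Q1 r / 2 + Q r * (\<beta> r c + \<xi> r c)"
  "akds_conn 2 2 3 r c = X c * (\<gamma> r c + a * \<eta> r c)"
  "akds_conn 2 2 4 r c = 0"
  "akds_conn 2 3 1 r c = 0"
  "akds_conn 2 3 2 r c = X c * (\<gamma> r c + a * \<eta> r c)"
  "akds_conn 2 3 3 r c = - X c * (\<xi> r c + \<beta> r c)"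
  "akds_conn 2 3 4 r c = 0"
  "akds_conn 2 4 1 r c = a * \<xi> r c * X c * (\<sigma> r c)^2"
  "akds_conn 2 4 2 r c = 0"
  "akds_conn 2 4 3 r c = 0"
  "akds_conn 2 4 4 r c = - X c * (\<sigma> r c)^2 * (\<xi> r c + \<beta> r c)"
  "akds_conn 3 1 1 r c = (\<sigma> r c)^2 * Q r * (\<gamma> r c + a * \<eta> r c)"
  "akds_conn 3 1 2 r c = 0"
  "akds_conn 3 1 3 r c = 0"
  "akds_conn 3 1 4 r c = - Q r * (\<sigma> r c)^2 * \<eta> r c"
  "akds_conn 3 2 1 r c = 0"
  "akds_conn 3 2 2 r c = - Q r * (\<gamma> r c + a * \<eta> r c)"
  "akds_conn 3 2 3 r c = Q r * (\<xi> r c + \<beta> r c)"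
  "akds_conn 3 2 4 r c = 0"
  "akds_conn 3 3 1 r c = 0"
  "akds_conn 3 3 2 r c = Q r * (\<xi> r c + \<beta> r c)"
  "akds_conn 3 3 3 r c = X1 c / 2 + X c * (\<gamma> r c + a * \<eta> r c)"
  "akds_conn 3 3 4 r c = 0"
  "akds_conn 3 4 1 r c = - Q r * (\<sigma> r c)^2 * \<eta> r c"
  "akds_conn 3 4 2 r c = 0"
  "akds_conn 3 4 3 r c = 0"
  "akds_conn 3 4 4 r c = - ((\<sigma> r c)^2 * (X1 c / 2 + X c * (\<gamma> r c - a * \<eta> r c)))"
  "akds_conn 4 1 1 r c = 0"
  "akds_conn 4 1 2 r c = - a * \<xi> r c * Q r"
  "akds_conn 4 1 3 r c = Q r * \<eta> r c"
  "akds_conn 4 1 4 r c = 0"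
  "akds_conn 4 2 1 r c = a * \<xi> r c * Q r"
  "akds_conn 4 2 2 r c = 0"
  "akds_conn 4 2 3 r c = 0"
  "akds_conn 4 2 4 r c = Q r * (\<beta> r c - \<xi> r c)"
  "akds_conn 4 3 1 r c = Q r * \<eta> r c"
  "akds_conn 4 3 2 r c = 0"
  "akds_conn 4 3 3 r c = 0"
  "akds_conn 4 3 4 r c = X1 c / 2 + X c * (\<gamma> r c - a * \<eta> r c)"
  "akds_conn 4 4 1 r c = 0"
  "akds_conn 4 4 2 r c = Q r * (\<xi> r c + \<beta> r c)"
  "akds_conn 4 4 3 r c = X1 c / 2 + X c * (\<gamma> r c - a * \<eta> r c)"
  "akds_conn 4 4 4 r c = 0"
  by (simp_all add: akds_conn_def)

section \<open>Derivatives of the basic functions\<close>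

lemma has_derivs [derivative_intros]:
  "((\<lambda>r. S r c) has_real_derivative 2 * r) (at r)"
  "((\<lambda>c. S r c) has_real_derivative 2 * a^2 * c) (at c)"
  "((\<lambda>r. W r c) has_real_derivative - \<alpha> * c) (at r)"
  "((\<lambda>c. W r c) has_real_derivative - \<alpha> * r) (at c)"
  "(Q has_real_derivative Q1 r) (at r)" "(Q1 has_real_derivative Q2 r) (at r)"
  "(X has_real_derivative X1 c) (at c)" "(X1 has_real_derivative X2 c) (at c)"
  unfolding S_def W_def Q_def Q1_def Q2_def X_def X1_def X2_def
  by (auto intro!: derivative_eq_intros) (simp_all add: field_simps power2_eq_square power3_eq_cube)

text \<open>With z = \<xi> + i \<eta> = 1 / (r - i a c) the last four rules are the real and
  imaginary parts of dz/dr = - z^2 and dz/dc = i a z^2.\<close>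

lemma has_derivs_coeffs [derivative_intros]:
  assumes "S r c \<noteq> 0"
  shows "((\<lambda>r. \<sigma> r c) has_real_derivative - 2 * \<xi> r c * \<sigma> r c) (at r)"
    and "((\<lambda>c. \<sigma> r c) has_real_derivative - 2 * a * \<eta> r c * \<sigma> r c) (at c)"
    and "((\<lambda>r. \<xi> r c) has_real_derivative (\<eta> r c)^2 - (\<xi> r c)^2) (at r)"
    and "((\<lambda>c. \<xi> r c) has_real_derivative - 2 * a * \<xi> r c * \<eta> r c) (at c)"
    and "((\<lambda>r. \<eta> r c) has_real_derivative - 2 * \<xi> r c * \<eta> r c) (at r)"
    and "((\<lambda>c. \<eta> r c) has_real_derivative a * ((\<xi> r c)^2 - (\<eta> r c)^2)) (at c)"
  unfolding \<sigma>_def \<xi>_def \<eta>_def using assms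
  by (auto intro!: derivative_eq_intros)
    (simp_all add: field_simps power2_eq_square, simp_all add: S_def algebra_simps power2_eq_square)

text \<open>\<beta> and \<gamma> are the negative logarithmic derivatives of \<open>W\<close> in r
  and c. Their mixed derivative is \<alpha> / W^2; since S = r^2 + a^2 c^2 gives \<gamma> \<xi> + a
  \<beta> \<eta> = \<alpha> / W, it is again a polynomial in the chosen functions, which makes them
  closed under differentiation.\<close>

lemma has_derivs_coeffs' [derivative_intros]:
  assumes "S r c \<noteq> 0" "W r c \<noteq> 0"
  shows "((\<lambda>r. \<beta> r c) has_real_derivative (\<beta> r c)^2) (at r)"
    and "((\<lambda>c. \<gamma> r c) has_real_derivative (\<gamma> r c)^2) (at c)"
    and "((\<lambda>c. \<beta> r c) has_real_derivative
      \<beta> r c * \<gamma> r c + \<gamma> r c * \<xi> r c + a * \<beta> r c * \<eta> r c) (at c)"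
    and "((\<lambda>r. \<gamma> r c) has_real_derivative
      \<beta> r c * \<gamma> r c + \<gamma> r c * \<xi> r c + a * \<beta> r c * \<eta> r c) (at r)"
proof -
  have d: "\<alpha> / (W r c)^2 = \<beta> r c * \<gamma> r c + \<gamma> r c * \<xi> r c + a * \<beta> r c * \<eta> r c"
    unfolding \<beta>_def \<gamma>_def \<xi>_def \<eta>_def using assms
    by (simp add: field_simps power2_eq_square) (simp add: S_def W_def algebra_simps power2_eq_square)
  show "((\<lambda>r. \<beta> r c) has_real_derivative (\<beta> r c)^2) (at r)"
    "((\<lambda>c. \<gamma> r c) has_real_derivative (\<gamma> r c)^2) (at c)"
    unfolding \<beta>_def \<gamma>_def using assms
    by (auto intro!: derivative_eq_intros simp: field_simps power2_eq_square)
  show "((\<lambda>c. \<beta> r c) has_real_derivative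
      \<beta> r c * \<gamma> r c + \<gamma> r c * \<xi> r c + a * \<beta> r c * \<eta> r c) (at c)"
    "((\<lambda>r. \<gamma> r c) has_real_derivative
      \<beta> r c * \<gamma> r c + \<gamma> r c * \<xi> r c + a * \<beta> r c * \<eta> r c) (at r)"
    unfolding d[symmetric] unfolding \<beta>_def \<gamma>_def using assms
    by (auto intro!: derivative_eq_intros simp: field_simps power2_eq_square)
      (simp_all add: W_def algebra_simps)
qed

lemma sigma_nonzero: "S r c \<noteq> 0 \<Longrightarrow> \<sigma> r c \<noteq> 0"
  by (simp add: \<sigma>_def)

text \<open>Both sides are a \<alpha> r c / (S W). Ring normalisation cannot see this relation
  between the four functions, so it is supplied as a rewrite rule; the second form applies inside
  longer products.\<close>

lemma eta_gamma:
  shows "\<eta> r c * \<gamma> r c = a * (\<beta> r c * \<xi> r c)"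
    and "\<eta> r c * (\<gamma> r c * z) = a * (\<beta> r c * (\<xi> r c * z))"
  by (simp_all add: \<xi>_def \<eta>_def \<beta>_def \<gamma>_def mult_ac)

section \<open>The chart and the frame conditions\<close>

lemma open_chart: "open chart"
  unfolding chart_def regular_def S_def W_def Q_def X_def
  by (intro open_Collect_conj open_Collect_neq continuous_intros)

lemma chartD:
  assumes "x \<in> chart"
  shows "S (x $ 2) (cos (x $ 3)) \<noteq> 0" "W (x $ 2) (cos (x $ 3)) \<noteq> 0" "Q (x $ 2) \<noteq> 0" "X (cos (x $ 3)) \<noteq> 0"
    "sin (x $ 3) \<noteq> 0"
proof -
  show "S (x $ 2) (cos (x $ 3)) \<noteq> 0" "W (x $ 2) (cos (x $ 3)) \<noteq> 0" "Q (x $ 2) \<noteq> 0"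
    and *: "X (cos (x $ 3)) \<noteq> 0"
    using assms unfolding chart_def regular_def by auto
  show "sin (x $ 3) \<noteq> 0"
    using * unfolding X_def by (auto simp: cos_squared_eq)
qed

lemma elementary_basic:
  "elementary U (\<lambda>x. S (x $ 2) (cos (x $ 3)))" "elementary U (\<lambda>x. W (x $ 2) (cos (x $ 3)))"
  "elementary U (\<lambda>x. Q (x $ 2))" "elementary U (\<lambda>x. Q1 (x $ 2))"
  "elementary U (\<lambda>x. X (cos (x $ 3)))" "elementary U (\<lambda>x. X1 (cos (x $ 3)))"
  unfolding S_def W_def Q_def Q1_def X_def X1_def by (intro elementary_intros)+

lemma elementary_coeffs:
  "elementary chart (\<lambda>x. \<sigma> (x $ 2) (cos (x $ 3)))" "elementary chart (\<lambda>x. \<xi> (x $ 2) (cos (x $ 3)))"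
  "elementary chart (\<lambda>x. \<eta> (x $ 2) (cos (x $ 3)))"
  unfolding \<sigma>_def \<xi>_def \<eta>_def by (intro elementary_intros elementary_basic; simp add: chartD)+

lemma elementary_if:
  "(P \<Longrightarrow> elementary U f) \<Longrightarrow> (\<not> P \<Longrightarrow> elementary U f') \<Longrightarrow> elementary U (\<lambda>x. if P then f x else f' x)"
  by (cases P) simp_all

lemma elementary_weight: "elementary chart (lift (weight i))"
  unfolding lift_def weight_def
  by (intro elementary_if elementary_intros elementary_basic elementary_coeffs) (simp_all add: chartD \<sigma>_def)

lemma elementary_struct: "elementary chart (lift (struct i j k))"
  unfolding lift_def struct_def
  by (intro elementary_if elementary_intros elementary_basic elementary_coeffs)

lemma elementary_coframe: "elementary chart (coframe b i)"
  unfolding coframe_def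
  by (intro elementary_if elementary_intros elementary_basic) (simp_all add: chartD)

lemma elementary_frame: "elementary chart (frame b i)"
  unfolding frame_def lift_def
  by (intro elementary_if elementary_intros elementary_basic) (simp_all add: chartD)

text \<open>A coordinate line moves only one argument of \<open>f\<close>, so two one-variable
  derivatives determine all four partial derivatives.\<close>

lemma has_partial_lift:
  assumes "((\<lambda>r. f r (cos (x $ 3))) has_real_derivative Dr) (at (x $ 2))"
    and "(f (x $ 2) has_real_derivative Dc) (at (cos (x $ 3)))"
  shows "has_partial i (lift f) (if i = 2 then Dr else if i = 3 then - sin (x $ 3) * Dc else 0) x"
proof -
  have "((\<lambda>s. f (x $ 2) (cos (x $ 3 + s))) has_real_derivative Dc * (- sin (x $ 3))) (at 0)"
    by (rule DERIV_chain2[where f = "f (x $ 2)"]) (auto intro!: derivative_eq_intros assms(2))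
  moreover have "((\<lambda>s. f (x $ 2 + s) (cos (x $ 3))) has_real_derivative Dr * 1) (at 0)"
    by (rule DERIV_chain2[where f = "\<lambda>r. f r (cos (x $ 3))"]) (auto intro!: derivative_eq_intros assms(1))
  ultimately show ?thesis
    using exhaust_4[of i] unfolding has_partial_def lift_def
    by (auto simp: axis_def mult.commute)
qed

lemma metric_frame:
  assumes "x \<in> chart"
  shows "akds_metric a m \<Lambda> \<alpha> x $ i $ j = (\<Sum>b\<in>UNIV. lift (weight b) x * coframe b i x * coframe b j x)"
proof -
  have P: "X (cos (x $ 3)) = akds_P a m \<Lambda> \<alpha> (x $ 3) * (sin (x $ 3))^2"
    by (simp add: X_def akds_P_def sin_squared_eq)
  have *: "akds_P a m \<Lambda> \<alpha> (x $ 3) \<noteq> 0"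
    using chartD(4)[OF assms] by (auto simp: P)
  have Q: "akds_Q a m \<Lambda> \<alpha> (x $ 2) = Q (x $ 2)" by (simp add: akds_Q_def Q_def)
  have W: "akds_Omega \<alpha> (x $ 2) (x $ 3) = W (x $ 2) (cos (x $ 3))" by (simp add: akds_Omega_def W_def)
  have S: "akds_rho2 a (x $ 2) (x $ 3) = S (x $ 2) (cos (x $ 3))" by (simp add: akds_rho2_def S_def)
  have "\<forall>i j. akds_metric a m \<Lambda> \<alpha> x $ i $ j = (\<Sum>b\<in>UNIV. lift (weight b) x * coframe b i x * coframe b j x)"
    unfolding akds_metric_def Let_def forall_4 sum_4 Q W S lift_def weight_simps
    using chartD[OF assms] * 
    by (simp add: axis_def coframe_def P \<sigma>_def)
       (simp add: cos_squared_eq field_simps, simp add: power2_eq_square)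
  then show ?thesis by blast
qed

lemma frame_dual:
  assumes "x \<in> chart"
  shows "(\<Sum>i\<in>UNIV. frame b i x * coframe d i x) = delta b d"
    and "(\<Sum>b\<in>UNIV. frame b i x * coframe b j x) = delta i j"
proof -
  have S: "(x $ 2)^2 + a^2 * (cos (x $ 3))^2 = lift S x" "lift S x \<noteq> 0" "sin (x $ 3) \<noteq> 0"
    "Q (x $ 2) \<noteq> 0" "X (cos (x $ 3)) \<noteq> 0"
    using chartD[OF assms] by (simp_all add: lift_def S_def)
  have "\<forall>b d. (\<Sum>i\<in>UNIV. frame b i x * coframe d i x) = delta b d"
    unfolding forall_4 sum_4 frame_def coframe_def delta_def
    using S(2-5) by (simp add: field_simps) (simp add: S(1)[symmetric] algebra_simps power2_eq_square)
  then show "(\<Sum>i\<in>UNIV. frame b i x * coframe d i x) = delta b d" by blast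
  have "\<forall>i j. (\<Sum>b\<in>UNIV. frame b i x * coframe b j x) = delta i j"
    unfolding forall_4 sum_4 frame_def coframe_def delta_def
    using S(2-5) by (simp add: field_simps) (simp add: S(1)[symmetric] algebra_simps power2_eq_square)
  then show "(\<Sum>b\<in>UNIV. frame b i x * coframe b j x) = delta i j" by blast
qed

lemma partial_deriv_akds_coframe:
  assumes "i \<noteq> j"
  shows "partial_deriv i (coframe b j) x =
     (if b = 1 \<and> i = 3 \<and> j = 4 then - 2 * a * cos (x $ 3) * sin (x $ 3)
      else if b = 4 \<and> i = 2 \<and> j = 4 then - 2 * x $ 2 else 0)"
proof -
  have "\<forall>b i j. i \<noteq> j \<longrightarrow> has_partial i (coframe b j)
     (if b = 1 \<and> i = 3 \<and> j = 4 then - 2 * a * cos (x $ 3) * sin (x $ 3)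
      else if b = 4 \<and> i = 2 \<and> j = 4 then - 2 * x $ 2 else 0) x"
    unfolding forall_4 has_partial_def coframe_def
    by (simp add: axis_def) (auto intro!: derivative_eq_intros)
  then show ?thesis using assms by (intro has_partial_imp_partial_deriv) blast
qed

lemma coframe_structure:
  assumes "x \<in> chart"
  shows "partial_deriv i (coframe b j) x - partial_deriv j (coframe b i) x
      = - (\<Sum>d\<in>UNIV. \<Sum>e\<in>UNIV. lift (struct b d e) x * coframe d i x * coframe e j x)"
proof -
  have S: "S (x $ 2) (cos (x $ 3)) \<noteq> 0" "Q (x $ 2) \<noteq> 0" "X (cos (x $ 3)) \<noteq> 0"
    and Sd: "S (x $ 2) (cos (x $ 3)) = (x $ 2)^2 + a^2 * (cos (x $ 3))^2"
    using chartD[OF assms] by (simp_all add: S_def)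
  have "\<forall>b i j. i \<noteq> j \<longrightarrow> partial_deriv i (coframe b j) x - partial_deriv j (coframe b i) x
      = - (\<Sum>d\<in>UNIV. \<Sum>e\<in>UNIV. lift (struct b d e) x * coframe d i x * coframe e j x)"
    unfolding forall_4 sum_4 lift_def struct_simps using S
    by (simp add: partial_deriv_akds_coframe coframe_def \<xi>_def \<eta>_def)
      (simp add: field_simps, simp add: Sd algebra_simps power2_eq_square)
  moreover have "\<forall>b i. (\<Sum>d\<in>UNIV. \<Sum>e\<in>UNIV. lift (struct b d e) x * coframe d i x * coframe e i x) = 0"
    unfolding forall_4 sum_4 lift_def struct_simps by (simp add: coframe_def)
  ultimately show ?thesis by (cases "i = j") auto
qed

sublocale orthogonal_frame chart "akds_metric a m \<Lambda> \<alpha>" coframe frame "\<lambda>b. lift (weight b)" "\<lambda>b d e. lift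
  (struct b d e)"
proof
  fix b c d x
  have "\<forall>b c d. struct b c d r e = - struct b d c r e" for r e
    unfolding forall_4 struct_simps by simp
  then show "lift (struct b c d) x = - lift (struct b d c) x"
    unfolding lift_def by blast
  show "lift (weight b) x \<noteq> 0" if "x \<in> chart"
    using exhaust_4[of b] chartD[OF that] by (auto simp: lift_def \<sigma>_def)
qed (simp_all add: open_chart elementary_coframe elementary_frame elementary_weight elementary_struct
      metric_frame frame_dual coframe_structure)

text \<open>The chain-rule factor - sin \<theta> cancels against the one in the third frame vector,
  so the frame acts as Q d/dr and X d/dc, and \<theta> occurs only through its cosine.\<close>

lemma dir_lift:
  assumes "x \<in> chart"
    and "((\<lambda>r. f r (cos (x $ 3))) has_real_derivative Dr) (at (x $ 2))"
    and "(f (x $ 2) has_real_derivative Dc) (at (cos (x $ 3)))"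
  shows "dir i (lift f) x = (if i = 2 then Q (x $ 2) * Dr else if i = 3 then X (cos (x $ 3)) * Dc else 0)"
  using exhaust_4[of i] chartD[OF assms(1)]
  unfolding dir_def sum_4 has_partial_imp_partial_deriv[OF has_partial_lift[OF assms(2,3)]]
  by (auto simp: frame_def)

lemma dir_cong:
  assumes "elementary chart f" "\<And>y. y \<in> chart \<Longrightarrow> f y = f' y" "x \<in> chart"
  shows "dir i f x = dir i f' x"
  unfolding dir_def using partial_deriv_cong[OF open_chart assms] by simp

text \<open>The shape is metric compatibility with equal indices. Expressing derivatives of weights
  by \<open>akds_conn\<close> evaluates the Koszul formula and later makes connection terms
  cancel.\<close>

lemma dir_weight:
  assumes x: "x \<in> chart" and rc: "r = x $ 2" "c = cos (x $ 3)"
  shows "dir i (lift (weight j)) x = 2 * weight j r c * akds_conn j i j r c"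
proof -
  note nz = chartD(1-4)[OF x, folded rc]
  note \<sigma> = sigma_nonzero[OF nz(1)]
  define L where "L = (\<lambda>i. 2 * weight j r c * akds_conn j i j r c)"
  have "((\<lambda>r. weight j r c) has_real_derivative L 2 / Q r) (at r)"
    unfolding L_def using exhaust_4[of j] nz \<sigma>
    by (elim disjE; simp only: weight_simps akds_conn_simps)
      (rule derivative_eq_intros refl | simp add: \<beta>_def \<gamma>_def field_simps power2_eq_square; fail)+
  moreover have "(weight j r has_real_derivative L 3 / X c) (at c)"
    unfolding L_def using exhaust_4[of j] nz \<sigma>
    by (elim disjE; simp only: weight_simps[abs_def] akds_conn_simps)
      (rule derivative_eq_intros refl | simp add: \<beta>_def \<gamma>_def field_simps power2_eq_square; fail)+
  ultimately have "dir i (lift (weight j)) x = (if i = 2 then Q r * (L 2 / Q r) else if i = 3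
    then X c * (L 3 / X c) else 0)"
    using dir_lift[OF x, of "weight j"] rc by blast
  moreover have "L 1 = 0" "L 4 = 0"
    unfolding L_def using exhaust_4[of j] by auto
  ultimately show ?thesis
    using exhaust_4[of i] nz by (auto simp: L_def)
qed

lemma conn_akds_conn:
  assumes x: "x \<in> chart"
  shows "conn b d e x = lift (akds_conn b d e) x"
proof -
  define r c where rc: "r = x $ 2" "c = cos (x $ 3)"
  note nz = chartD(1-4)[OF x, folded rc]
  have "\<forall>b d e. conn b d e x = akds_conn b d e r c"
    unfolding forall_4 conn_def dir_weight[OF x rc] lift_def rc[symmetric]
    using nz by (simp add: delta_def \<sigma>_def) (simp add: field_simps power2_eq_square power3_eq_cube)
  then show ?thesis unfolding lift_def rc by blast
qed

text \<open>The first index selects the variable, 2 for r and 3 for c. These are plain partial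
  derivatives of \<open>akds_conn\<close>, without the factor Q or X of the frame vector.\<close>

definition akds_dconn :: "4 \<Rightarrow> 4 \<Rightarrow> 4 \<Rightarrow> 4 \<Rightarrow> real \<Rightarrow> real \<Rightarrow> real" where
  "akds_dconn i j k l r c =
     (if (i, j, k, l) \<in> {(2, 1, 2, 1), (2, 1, 1, 2)} then Q2 r / 2 + (Q1 r * (\<beta> r c - \<xi> r c)
       + Q r * ((\<beta> r c)^2 - ((\<eta> r c)^2 - (\<xi> r c)^2))) else
     (if (i, j, k, l) \<in> {(3, 1, 2, 1), (3, 1, 1, 2), (3, 4, 2, 4)} then Q r * (\<beta> r c * \<gamma> r c
       + \<gamma> r c * \<xi> r c + a * \<beta> r c * \<eta> r c + 2 * a * \<xi> r c * \<eta> r c) else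
     (if (i, j, k, l) \<in> {(2, 1, 3, 1), (2, 4, 3, 4), (2, 4, 4, 3)} then X c * (\<beta> r c * \<gamma> r c
       + \<gamma> r c * \<xi> r c + a * \<beta> r c * \<eta> r c + a * (2 * \<xi> r c * \<eta> r c)) else
     (if (i, j, k, l) \<in> {(3, 1, 3, 1)} then X1 c * (\<gamma> r c - a * \<eta> r c) + X c * ((\<gamma> r c)^2
       - a * (a * ((\<xi> r c)^2 - (\<eta> r c)^2))) else
     (if (i, j, k, l) \<in> {(2, 1, 1, 3), (2, 2, 3, 2), (2, 2, 2, 3), (2, 3, 3, 3)}
       then X c * (\<beta> r c * \<gamma> r c + \<gamma> r c * \<xi> r c + a * \<beta> r c * \<eta> r c - a * (2 * \<xi> r c * \<eta> r c)) else
     (if (i, j, k, l) \<in> {(3, 1, 1, 3), (3, 2, 3, 2), (3, 2, 2, 3)} then X1 c * (\<gamma> r c + a * \<eta> r c)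
       + X c * ((\<gamma> r c)^2 + a * (a * ((\<xi> r c)^2 - (\<eta> r c)^2))) else
     (if (i, j, k, l) \<in> {(2, 2, 2, 2)} then Q2 r / 2 + (Q1 r * (\<beta> r c + \<xi> r c) + Q r * ((\<beta> r c)^2
       + ((\<eta> r c)^2 - (\<xi> r c)^2))) else
     (if (i, j, k, l) \<in> {(3, 2, 2, 2)} then Q r * (\<beta> r c * \<gamma> r c + \<gamma> r c * \<xi> r c + a * \<beta> r c * \<eta> r c
       - 2 * a * \<xi> r c * \<eta> r c) else
     (if (i, j, k, l) \<in> {(2, 3, 2, 3), (2, 3, 3, 2), (2, 4, 4, 2)} then Q1 r * (\<xi> r c + \<beta> r c)
       + Q r * ((\<eta> r c)^2 - (\<xi> r c)^2 + (\<beta> r c)^2) else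
     (if (i, j, k, l) \<in> {(3, 3, 2, 3), (3, 3, 3, 2), (3, 4, 4, 2)} then Q r * (- 2 * a * \<xi> r c * \<eta> r c
       + (\<beta> r c * \<gamma> r c + \<gamma> r c * \<xi> r c + a * \<beta> r c * \<eta> r c)) else
     (if (i, j, k, l) \<in> {(3, 3, 3, 3)} then X2 c / 2 + (X1 c * (\<gamma> r c + a * \<eta> r c) + X c * ((\<gamma> r c)^2
       + a * (a * ((\<xi> r c)^2 - (\<eta> r c)^2)))) else
     (if (i, j, k, l) \<in> {(2, 4, 2, 4)} then Q1 r * (\<beta> r c - \<xi> r c) + Q r * ((\<beta> r c)^2 - ((\<eta> r c)^2
       - (\<xi> r c)^2)) else
     (if (i, j, k, l) \<in> {(3, 4, 3, 4), (3, 4, 4, 3)} then X2 c / 2 + (X1 c * (\<gamma> r c - a * \<eta> r c)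
       + X c * ((\<gamma> r c)^2 - a * (a * ((\<xi> r c)^2 - (\<eta> r c)^2)))) else
     (if (i, j, k, l) \<in> {(2, 2, 1, 1)} then - 2 * \<sigma> r c * (2 * \<xi> r c * \<sigma> r c) * (Q1 r / 2
       + Q r * (\<beta> r c - \<xi> r c)) + (\<sigma> r c)^2 * (Q2 r / 2 + (Q1 r * (\<beta> r c - \<xi> r c) + Q r * ((\<beta> r c)^2
       - ((\<eta> r c)^2 - (\<xi> r c)^2)))) else
     (if (i, j, k, l) \<in> {(3, 2, 1, 1)} then - 2 * \<sigma> r c * (2 * a * \<eta> r c * \<sigma> r c) * (Q1 r / 2
       + Q r * (\<beta> r c - \<xi> r c)) + (\<sigma> r c)^2 * (Q r * (\<beta> r c * \<gamma> r c + \<gamma> r c * \<xi> r c + a * \<beta> r c * \<eta> r c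
       + 2 * a * \<xi> r c * \<eta> r c)) else
     (if (i, j, k, l) \<in> {(2, 3, 1, 1)} then (- 2 * \<sigma> r c * (2 * \<xi> r c * \<sigma> r c) * Q r
       + (\<sigma> r c)^2 * Q1 r) * (\<gamma> r c + a * \<eta> r c) + (\<sigma> r c)^2 * Q r * (\<beta> r c * \<gamma> r c + \<gamma> r c * \<xi> r c
       + a * \<beta> r c * \<eta> r c - a * (2 * \<xi> r c * \<eta> r c)) else
     (if (i, j, k, l) \<in> {(3, 3, 1, 1)} then - 2 * \<sigma> r c * (2 * a * \<eta> r c * \<sigma> r c) * Q r * (\<gamma> r c
       + a * \<eta> r c) + (\<sigma> r c)^2 * Q r * ((\<gamma> r c)^2 + a * (a * ((\<xi> r c)^2 - (\<eta> r c)^2))) else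
     (if (i, j, k, l) \<in> {(2, 3, 2, 2)} then - (Q1 r * (\<gamma> r c + a * \<eta> r c) + Q r * (\<beta> r c * \<gamma> r c
       + \<gamma> r c * \<xi> r c + a * \<beta> r c * \<eta> r c - a * (2 * \<xi> r c * \<eta> r c))) else
     (if (i, j, k, l) \<in> {(3, 3, 2, 2)} then - Q r * ((\<gamma> r c)^2 + a * (a * ((\<xi> r c)^2 - (\<eta> r c)^2))) else
     (if (i, j, k, l) \<in> {(2, 2, 3, 3)} then - X c * ((\<eta> r c)^2 - (\<xi> r c)^2 + (\<beta> r c)^2) else
     (if (i, j, k, l) \<in> {(3, 2, 3, 3)} then - (X1 c * (\<xi> r c + \<beta> r c) + X c * (- 2 * a * \<xi> r c * \<eta> r c
       + (\<beta> r c * \<gamma> r c + \<gamma> r c * \<xi> r c + a * \<beta> r c * \<eta> r c))) else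
     (if (i, j, k, l) \<in> {(2, 2, 4, 4)} then - ((- X c * (2 * \<sigma> r c * (2 * \<xi> r c * \<sigma> r c)) * (\<xi> r c
       + \<beta> r c) + X c * (\<sigma> r c)^2 * ((\<eta> r c)^2 - (\<xi> r c)^2 + (\<beta> r c)^2))) else
     (if (i, j, k, l) \<in> {(3, 2, 4, 4)} then - (((X1 c * (\<sigma> r c)^2
       - X c * (2 * \<sigma> r c * (2 * a * \<eta> r c * \<sigma> r c))) * (\<xi> r c + \<beta> r c)
       + X c * (\<sigma> r c)^2 * (- 2 * a * \<xi> r c * \<eta> r c + (\<beta> r c * \<gamma> r c + \<gamma> r c * \<xi> r c
       + a * \<beta> r c * \<eta> r c)))) else
     (if (i, j, k, l) \<in> {(2, 3, 4, 4)} then - ((- 2 * \<sigma> r c * (2 * \<xi> r c * \<sigma> r c) * (X1 c / 2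
       + X c * (\<gamma> r c - a * \<eta> r c)) + (\<sigma> r c)^2 * (X c * (\<beta> r c * \<gamma> r c + \<gamma> r c * \<xi> r c
       + a * \<beta> r c * \<eta> r c + a * (2 * \<xi> r c * \<eta> r c))))) else
     (if (i, j, k, l) \<in> {(3, 3, 4, 4)} then - ((- 2 * \<sigma> r c * (2 * a * \<eta> r c * \<sigma> r c) * (X1 c / 2
       + X c * (\<gamma> r c - a * \<eta> r c)) + (\<sigma> r c)^2 * (X2 c / 2 + (X1 c * (\<gamma> r c - a * \<eta> r c)
       + X c * ((\<gamma> r c)^2 - a * (a * ((\<xi> r c)^2 - (\<eta> r c)^2))))))) else
     (if (i, j, k, l) \<in> {(2, 1, 3, 4)} then - X c * (2 * \<xi> r c * \<eta> r c) else
     (if (i, j, k, l) \<in> {(3, 1, 3, 4)} then X1 c * \<eta> r c + X c * (a * ((\<xi> r c)^2 - (\<eta> r c)^2)) else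
     (if (i, j, k, l) \<in> {(2, 1, 4, 3)} then X c * (2 * \<xi> r c * \<eta> r c) else
     (if (i, j, k, l) \<in> {(3, 1, 4, 3)} then - ((X1 c * \<eta> r c + X c * (a * ((\<xi> r c)^2 - (\<eta> r c)^2)))) else
     (if (i, j, k, l) \<in> {(2, 3, 1, 4), (2, 3, 4, 1)} then - (((Q1 r * (\<sigma> r c)^2
       - Q r * (2 * \<sigma> r c * (2 * \<xi> r c * \<sigma> r c))) * \<eta> r c - Q r * (\<sigma> r c)^2 * (2 * \<xi> r c * \<eta> r c))) else
     (if (i, j, k, l) \<in> {(3, 3, 1, 4), (3, 3, 4, 1)} then
       - ((- Q r * (2 * \<sigma> r c * (2 * a * \<eta> r c * \<sigma> r c)) * \<eta> r c + Q r * (\<sigma> r c)^2 * (a * ((\<xi> r c)^2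
       - (\<eta> r c)^2)))) else
     (if (i, j, k, l) \<in> {(2, 4, 1, 3), (2, 4, 3, 1)} then Q1 r * \<eta> r c - Q r * (2 * \<xi> r c * \<eta> r c) else
     (if (i, j, k, l) \<in> {(3, 4, 1, 3), (3, 4, 3, 1)} then Q r * (a * ((\<xi> r c)^2 - (\<eta> r c)^2)) else
     (if (i, j, k, l) \<in> {(2, 4, 2, 1)} then a * ((\<eta> r c)^2 - (\<xi> r c)^2) * Q r + a * \<xi> r c * Q1 r else
     (if (i, j, k, l) \<in> {(3, 4, 2, 1)} then - a * (2 * a * \<xi> r c * \<eta> r c) * Q r else
     (if (i, j, k, l) \<in> {(2, 4, 1, 2)} then - ((a * ((\<eta> r c)^2 - (\<xi> r c)^2) * Q r + a * \<xi> r c * Q1 r)) else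
     (if (i, j, k, l) \<in> {(3, 4, 1, 2)} then a * (2 * a * \<xi> r c * \<eta> r c) * Q r else
     (if (i, j, k, l) \<in> {(2, 2, 1, 4), (2, 2, 4, 1)} then a * ((\<eta> r c)^2 - (\<xi> r c)^2) * X c * (\<sigma> r c)^2
       - a * \<xi> r c * X c * (2 * \<sigma> r c * (2 * \<xi> r c * \<sigma> r c)) else
     (if (i, j, k, l) \<in> {(3, 2, 1, 4), (3, 2, 4, 1)} then (- a * (2 * a * \<xi> r c * \<eta> r c) * X c
       + a * \<xi> r c * X1 c) * (\<sigma> r c)^2 - a * \<xi> r c * X c * (2 * \<sigma> r c * (2 * a * \<eta> r c * \<sigma> r c)) else
     (if (i, j, k, l) \<in> {(2, 1, 2, 4), (2, 1, 4, 2)} then a * ((\<eta> r c)^2 - (\<xi> r c)^2) * X c else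
     (if (i, j, k, l) \<in> {(3, 1, 2, 4), (3, 1, 4, 2)} then - a * (2 * a * \<xi> r c * \<eta> r c) * X c
       + a * \<xi> r c * X1 c else
      0)))))))))))))))))))))))))))))))))))))))))"

lemma akds_dconn_simps [simp]:
  "akds_dconn 2 1 1 1 r c = 0"
  "akds_dconn 2 1 1 2 r c = Q2 r / 2 + (Q1 r * (\<beta> r c - \<xi> r c) + Q r * ((\<beta> r c)^2 - ((\<eta> r c)^2 - (\<xi> r c)^2)))"
  "akds_dconn 2 1 1 3 r c = X c * (\<beta> r c * \<gamma> r c + \<gamma> r c * \<xi> r c + a * \<beta> r c * \<eta> r c
    - a * (2 * \<xi> r c * \<eta> r c))"
  "akds_dconn 2 1 1 4 r c = 0"
  "akds_dconn 2 1 2 1 r c = Q2 r / 2 + (Q1 r * (\<beta> r c - \<xi> r c) + Q r * ((\<beta> r c)^2 - ((\<eta> r c)^2 - (\<xi> r c)^2)))"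
  "akds_dconn 2 1 2 2 r c = 0"
  "akds_dconn 2 1 2 3 r c = 0"
  "akds_dconn 2 1 2 4 r c = a * ((\<eta> r c)^2 - (\<xi> r c)^2) * X c"
  "akds_dconn 2 1 3 1 r c = X c * (\<beta> r c * \<gamma> r c + \<gamma> r c * \<xi> r c + a * \<beta> r c * \<eta> r c
    + a * (2 * \<xi> r c * \<eta> r c))"
  "akds_dconn 2 1 3 2 r c = 0"
  "akds_dconn 2 1 3 3 r c = 0"
  "akds_dconn 2 1 3 4 r c = - X c * (2 * \<xi> r c * \<eta> r c)"
  "akds_dconn 2 1 4 1 r c = 0"
  "akds_dconn 2 1 4 2 r c = a * ((\<eta> r c)^2 - (\<xi> r c)^2) * X c"
  "akds_dconn 2 1 4 3 r c = X c * (2 * \<xi> r c * \<eta> r c)"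
  "akds_dconn 2 1 4 4 r c = 0"
  "akds_dconn 2 2 1 1 r c = - 2 * \<sigma> r c * (2 * \<xi> r c * \<sigma> r c) * (Q1 r / 2 + Q r * (\<beta> r c - \<xi> r c))
    + (\<sigma> r c)^2 * (Q2 r / 2 + (Q1 r * (\<beta> r c - \<xi> r c) + Q r * ((\<beta> r c)^2 - ((\<eta> r c)^2 - (\<xi> r c)^2))))"
  "akds_dconn 2 2 1 2 r c = 0"
  "akds_dconn 2 2 1 3 r c = 0"
  "akds_dconn 2 2 1 4 r c = a * ((\<eta> r c)^2 - (\<xi> r c)^2) * X c * (\<sigma> r c)^2
    - a * \<xi> r c * X c * (2 * \<sigma> r c * (2 * \<xi> r c * \<sigma> r c))"
  "akds_dconn 2 2 2 1 r c = 0"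
  "akds_dconn 2 2 2 2 r c = Q2 r / 2 + (Q1 r * (\<beta> r c + \<xi> r c) + Q r * ((\<beta> r c)^2 + ((\<eta> r c)^2 - (\<xi> r c)^2)))"
  "akds_dconn 2 2 2 3 r c = X c * (\<beta> r c * \<gamma> r c + \<gamma> r c * \<xi> r c + a * \<beta> r c * \<eta> r c
    - a * (2 * \<xi> r c * \<eta> r c))"
  "akds_dconn 2 2 2 4 r c = 0"
  "akds_dconn 2 2 3 1 r c = 0"
  "akds_dconn 2 2 3 2 r c = X c * (\<beta> r c * \<gamma> r c + \<gamma> r c * \<xi> r c + a * \<beta> r c * \<eta> r c
    - a * (2 * \<xi> r c * \<eta> r c))"
  "akds_dconn 2 2 3 3 r c = - X c * ((\<eta> r c)^2 - (\<xi> r c)^2 + (\<beta> r c)^2)"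
  "akds_dconn 2 2 3 4 r c = 0"
  "akds_dconn 2 2 4 1 r c = a * ((\<eta> r c)^2 - (\<xi> r c)^2) * X c * (\<sigma> r c)^2
    - a * \<xi> r c * X c * (2 * \<sigma> r c * (2 * \<xi> r c * \<sigma> r c))"
  "akds_dconn 2 2 4 2 r c = 0"
  "akds_dconn 2 2 4 3 r c = 0"
  "akds_dconn 2 2 4 4 r c = - ((- X c * (2 * \<sigma> r c * (2 * \<xi> r c * \<sigma> r c)) * (\<xi> r c + \<beta> r c)
    + X c * (\<sigma> r c)^2 * ((\<eta> r c)^2 - (\<xi> r c)^2 + (\<beta> r c)^2)))"
  "akds_dconn 2 3 1 1 r c = (- 2 * \<sigma> r c * (2 * \<xi> r c * \<sigma> r c) * Q r + (\<sigma> r c)^2 * Q1 r) * (\<gamma> r c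
    + a * \<eta> r c) + (\<sigma> r c)^2 * Q r * (\<beta> r c * \<gamma> r c + \<gamma> r c * \<xi> r c + a * \<beta> r c * \<eta> r c
      - a * (2 * \<xi> r c * \<eta> r c))"
  "akds_dconn 2 3 1 2 r c = 0"
  "akds_dconn 2 3 1 3 r c = 0"
  "akds_dconn 2 3 1 4 r c = - (((Q1 r * (\<sigma> r c)^2 - Q r * (2 * \<sigma> r c * (2 * \<xi> r c * \<sigma> r c))) * \<eta> r c
    - Q r * (\<sigma> r c)^2 * (2 * \<xi> r c * \<eta> r c)))"
  "akds_dconn 2 3 2 1 r c = 0"
  "akds_dconn 2 3 2 2 r c = - (Q1 r * (\<gamma> r c + a * \<eta> r c) + Q r * (\<beta> r c * \<gamma> r c + \<gamma> r c * \<xi> r c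
    + a * \<beta> r c * \<eta> r c - a * (2 * \<xi> r c * \<eta> r c)))"
  "akds_dconn 2 3 2 3 r c = Q1 r * (\<xi> r c + \<beta> r c) + Q r * ((\<eta> r c)^2 - (\<xi> r c)^2 + (\<beta> r c)^2)"
  "akds_dconn 2 3 2 4 r c = 0"
  "akds_dconn 2 3 3 1 r c = 0"
  "akds_dconn 2 3 3 2 r c = Q1 r * (\<xi> r c + \<beta> r c) + Q r * ((\<eta> r c)^2 - (\<xi> r c)^2 + (\<beta> r c)^2)"
  "akds_dconn 2 3 3 3 r c = X c * (\<beta> r c * \<gamma> r c + \<gamma> r c * \<xi> r c + a * \<beta> r c * \<eta> r c
    - a * (2 * \<xi> r c * \<eta> r c))"
  "akds_dconn 2 3 3 4 r c = 0"
  "akds_dconn 2 3 4 1 r c = - (((Q1 r * (\<sigma> r c)^2 - Q r * (2 * \<sigma> r c * (2 * \<xi> r c * \<sigma> r c))) * \<eta> r c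
    - Q r * (\<sigma> r c)^2 * (2 * \<xi> r c * \<eta> r c)))"
  "akds_dconn 2 3 4 2 r c = 0"
  "akds_dconn 2 3 4 3 r c = 0"
  "akds_dconn 2 3 4 4 r c = - ((- 2 * \<sigma> r c * (2 * \<xi> r c * \<sigma> r c) * (X1 c / 2 + X c * (\<gamma> r c
    - a * \<eta> r c)) + (\<sigma> r c)^2 * (X c * (\<beta> r c * \<gamma> r c + \<gamma> r c * \<xi> r c + a * \<beta> r c * \<eta> r c
      + a * (2 * \<xi> r c * \<eta> r c)))))"
  "akds_dconn 2 4 1 1 r c = 0"
  "akds_dconn 2 4 1 2 r c = - ((a * ((\<eta> r c)^2 - (\<xi> r c)^2) * Q r + a * \<xi> r c * Q1 r))"
  "akds_dconn 2 4 1 3 r c = Q1 r * \<eta> r c - Q r * (2 * \<xi> r c * \<eta> r c)"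
  "akds_dconn 2 4 1 4 r c = 0"
  "akds_dconn 2 4 2 1 r c = a * ((\<eta> r c)^2 - (\<xi> r c)^2) * Q r + a * \<xi> r c * Q1 r"
  "akds_dconn 2 4 2 2 r c = 0"
  "akds_dconn 2 4 2 3 r c = 0"
  "akds_dconn 2 4 2 4 r c = Q1 r * (\<beta> r c - \<xi> r c) + Q r * ((\<beta> r c)^2 - ((\<eta> r c)^2 - (\<xi> r c)^2))"
  "akds_dconn 2 4 3 1 r c = Q1 r * \<eta> r c - Q r * (2 * \<xi> r c * \<eta> r c)"
  "akds_dconn 2 4 3 2 r c = 0"
  "akds_dconn 2 4 3 3 r c = 0"
  "akds_dconn 2 4 3 4 r c = X c * (\<beta> r c * \<gamma> r c + \<gamma> r c * \<xi> r c + a * \<beta> r c * \<eta> r c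
    + a * (2 * \<xi> r c * \<eta> r c))"
  "akds_dconn 2 4 4 1 r c = 0"
  "akds_dconn 2 4 4 2 r c = Q1 r * (\<xi> r c + \<beta> r c) + Q r * ((\<eta> r c)^2 - (\<xi> r c)^2 + (\<beta> r c)^2)"
  "akds_dconn 2 4 4 3 r c = X c * (\<beta> r c * \<gamma> r c + \<gamma> r c * \<xi> r c + a * \<beta> r c * \<eta> r c
    + a * (2 * \<xi> r c * \<eta> r c))"
  "akds_dconn 2 4 4 4 r c = 0"
  "akds_dconn 3 1 1 1 r c = 0"
  "akds_dconn 3 1 1 2 r c = Q r * (\<beta> r c * \<gamma> r c + \<gamma> r c * \<xi> r c + a * \<beta> r c * \<eta> r c + 2 * a * \<xi> r c * \<eta> r c)"
  "akds_dconn 3 1 1 3 r c = X1 c * (\<gamma> r c + a * \<eta> r c) + X c * ((\<gamma> r c)^2 + a * (a * ((\<xi> r c)^2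
    - (\<eta> r c)^2)))"
  "akds_dconn 3 1 1 4 r c = 0"
  "akds_dconn 3 1 2 1 r c = Q r * (\<beta> r c * \<gamma> r c + \<gamma> r c * \<xi> r c + a * \<beta> r c * \<eta> r c + 2 * a * \<xi> r c * \<eta> r c)"
  "akds_dconn 3 1 2 2 r c = 0"
  "akds_dconn 3 1 2 3 r c = 0"
  "akds_dconn 3 1 2 4 r c = - a * (2 * a * \<xi> r c * \<eta> r c) * X c + a * \<xi> r c * X1 c"
  "akds_dconn 3 1 3 1 r c = X1 c * (\<gamma> r c - a * \<eta> r c) + X c * ((\<gamma> r c)^2 - a * (a * ((\<xi> r c)^2
    - (\<eta> r c)^2)))"
  "akds_dconn 3 1 3 2 r c = 0"
  "akds_dconn 3 1 3 3 r c = 0"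
  "akds_dconn 3 1 3 4 r c = X1 c * \<eta> r c + X c * (a * ((\<xi> r c)^2 - (\<eta> r c)^2))"
  "akds_dconn 3 1 4 1 r c = 0"
  "akds_dconn 3 1 4 2 r c = - a * (2 * a * \<xi> r c * \<eta> r c) * X c + a * \<xi> r c * X1 c"
  "akds_dconn 3 1 4 3 r c = - ((X1 c * \<eta> r c + X c * (a * ((\<xi> r c)^2 - (\<eta> r c)^2))))"
  "akds_dconn 3 1 4 4 r c = 0"
  "akds_dconn 3 2 1 1 r c = - 2 * \<sigma> r c * (2 * a * \<eta> r c * \<sigma> r c) * (Q1 r / 2 + Q r * (\<beta> r c - \<xi> r c))
    + (\<sigma> r c)^2 * (Q r * (\<beta> r c * \<gamma> r c + \<gamma> r c * \<xi> r c + a * \<beta> r c * \<eta> r c + 2 * a * \<xi> r c * \<eta> r c))"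
  "akds_dconn 3 2 1 2 r c = 0"
  "akds_dconn 3 2 1 3 r c = 0"
  "akds_dconn 3 2 1 4 r c = (- a * (2 * a * \<xi> r c * \<eta> r c) * X c + a * \<xi> r c * X1 c) * (\<sigma> r c)^2
    - a * \<xi> r c * X c * (2 * \<sigma> r c * (2 * a * \<eta> r c * \<sigma> r c))"
  "akds_dconn 3 2 2 1 r c = 0"
  "akds_dconn 3 2 2 2 r c = Q r * (\<beta> r c * \<gamma> r c + \<gamma> r c * \<xi> r c + a * \<beta> r c * \<eta> r c - 2 * a * \<xi> r c * \<eta> r c)"
  "akds_dconn 3 2 2 3 r c = X1 c * (\<gamma> r c + a * \<eta> r c) + X c * ((\<gamma> r c)^2 + a * (a * ((\<xi> r c)^2
    - (\<eta> r c)^2)))"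
  "akds_dconn 3 2 2 4 r c = 0"
  "akds_dconn 3 2 3 1 r c = 0"
  "akds_dconn 3 2 3 2 r c = X1 c * (\<gamma> r c + a * \<eta> r c) + X c * ((\<gamma> r c)^2 + a * (a * ((\<xi> r c)^2
    - (\<eta> r c)^2)))"
  "akds_dconn 3 2 3 3 r c = - (X1 c * (\<xi> r c + \<beta> r c) + X c * (- 2 * a * \<xi> r c * \<eta> r c + (\<beta> r c * \<gamma> r c
    + \<gamma> r c * \<xi> r c + a * \<beta> r c * \<eta> r c)))"
  "akds_dconn 3 2 3 4 r c = 0"
  "akds_dconn 3 2 4 1 r c = (- a * (2 * a * \<xi> r c * \<eta> r c) * X c + a * \<xi> r c * X1 c) * (\<sigma> r c)^2
    - a * \<xi> r c * X c * (2 * \<sigma> r c * (2 * a * \<eta> r c * \<sigma> r c))"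
  "akds_dconn 3 2 4 2 r c = 0"
  "akds_dconn 3 2 4 3 r c = 0"
  "akds_dconn 3 2 4 4 r c = - (((X1 c * (\<sigma> r c)^2 - X c * (2 * \<sigma> r c * (2 * a * \<eta> r c * \<sigma> r c)))
    * (\<xi> r c + \<beta> r c) + X c * (\<sigma> r c)^2 * (- 2 * a * \<xi> r c * \<eta> r c + (\<beta> r c * \<gamma> r c + \<gamma> r c * \<xi> r c
      + a * \<beta> r c * \<eta> r c))))"
  "akds_dconn 3 3 1 1 r c = - 2 * \<sigma> r c * (2 * a * \<eta> r c * \<sigma> r c) * Q r * (\<gamma> r c + a * \<eta> r c)
    + (\<sigma> r c)^2 * Q r * ((\<gamma> r c)^2 + a * (a * ((\<xi> r c)^2 - (\<eta> r c)^2)))"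
  "akds_dconn 3 3 1 2 r c = 0"
  "akds_dconn 3 3 1 3 r c = 0"
  "akds_dconn 3 3 1 4 r c = - ((- Q r * (2 * \<sigma> r c * (2 * a * \<eta> r c * \<sigma> r c)) * \<eta> r c
    + Q r * (\<sigma> r c)^2 * (a * ((\<xi> r c)^2 - (\<eta> r c)^2))))"
  "akds_dconn 3 3 2 1 r c = 0"
  "akds_dconn 3 3 2 2 r c = - Q r * ((\<gamma> r c)^2 + a * (a * ((\<xi> r c)^2 - (\<eta> r c)^2)))"
  "akds_dconn 3 3 2 3 r c = Q r * (- 2 * a * \<xi> r c * \<eta> r c + (\<beta> r c * \<gamma> r c + \<gamma> r c * \<xi> r c
    + a * \<beta> r c * \<eta> r c))"
  "akds_dconn 3 3 2 4 r c = 0"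
  "akds_dconn 3 3 3 1 r c = 0"
  "akds_dconn 3 3 3 2 r c = Q r * (- 2 * a * \<xi> r c * \<eta> r c + (\<beta> r c * \<gamma> r c + \<gamma> r c * \<xi> r c
    + a * \<beta> r c * \<eta> r c))"
  "akds_dconn 3 3 3 3 r c = X2 c / 2 + (X1 c * (\<gamma> r c + a * \<eta> r c) + X c * ((\<gamma> r c)^2
    + a * (a * ((\<xi> r c)^2 - (\<eta> r c)^2))))"
  "akds_dconn 3 3 3 4 r c = 0"
  "akds_dconn 3 3 4 1 r c = - ((- Q r * (2 * \<sigma> r c * (2 * a * \<eta> r c * \<sigma> r c)) * \<eta> r c
    + Q r * (\<sigma> r c)^2 * (a * ((\<xi> r c)^2 - (\<eta> r c)^2))))"
  "akds_dconn 3 3 4 2 r c = 0"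
  "akds_dconn 3 3 4 3 r c = 0"
  "akds_dconn 3 3 4 4 r c = - ((- 2 * \<sigma> r c * (2 * a * \<eta> r c * \<sigma> r c) * (X1 c / 2 + X c * (\<gamma> r c
    - a * \<eta> r c)) + (\<sigma> r c)^2 * (X2 c / 2 + (X1 c * (\<gamma> r c - a * \<eta> r c) + X c * ((\<gamma> r c)^2
      - a * (a * ((\<xi> r c)^2 - (\<eta> r c)^2)))))))"
  "akds_dconn 3 4 1 1 r c = 0"
  "akds_dconn 3 4 1 2 r c = a * (2 * a * \<xi> r c * \<eta> r c) * Q r"
  "akds_dconn 3 4 1 3 r c = Q r * (a * ((\<xi> r c)^2 - (\<eta> r c)^2))"
  "akds_dconn 3 4 1 4 r c = 0"
  "akds_dconn 3 4 2 1 r c = - a * (2 * a * \<xi> r c * \<eta> r c) * Q r"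
  "akds_dconn 3 4 2 2 r c = 0"
  "akds_dconn 3 4 2 3 r c = 0"
  "akds_dconn 3 4 2 4 r c = Q r * (\<beta> r c * \<gamma> r c + \<gamma> r c * \<xi> r c + a * \<beta> r c * \<eta> r c + 2 * a * \<xi> r c * \<eta> r c)"
  "akds_dconn 3 4 3 1 r c = Q r * (a * ((\<xi> r c)^2 - (\<eta> r c)^2))"
  "akds_dconn 3 4 3 2 r c = 0"
  "akds_dconn 3 4 3 3 r c = 0"
  "akds_dconn 3 4 3 4 r c = X2 c / 2 + (X1 c * (\<gamma> r c - a * \<eta> r c) + X c * ((\<gamma> r c)^2
    - a * (a * ((\<xi> r c)^2 - (\<eta> r c)^2))))"
  "akds_dconn 3 4 4 1 r c = 0"
  "akds_dconn 3 4 4 2 r c = Q r * (- 2 * a * \<xi> r c * \<eta> r c + (\<beta> r c * \<gamma> r c + \<gamma> r c * \<xi> r c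
    + a * \<beta> r c * \<eta> r c))"
  "akds_dconn 3 4 4 3 r c = X2 c / 2 + (X1 c * (\<gamma> r c - a * \<eta> r c) + X c * ((\<gamma> r c)^2
    - a * (a * ((\<xi> r c)^2 - (\<eta> r c)^2))))"
  "akds_dconn 3 4 4 4 r c = 0"
  by (simp_all add: akds_dconn_def)

lemma dir_conn:
  assumes x: "x \<in> chart" and rc: "r = x $ 2" "c = cos (x $ 3)"
  shows "dir i (conn b d e) x = (if i = 2 then Q r * akds_dconn 2 b d e r c else if i = 3
    then X c * akds_dconn 3 b d e r c else 0)"
proof -
  note nz = chartD(1-4)[OF x, folded rc]
  have "\<forall>b d e. ((\<lambda>r. akds_conn b d e r c) has_real_derivative akds_dconn 2 b d e r c) (at r)"
    unfolding forall_4 akds_conn_simps akds_dconn_simps using nz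
    by (intro conjI) ((rule derivative_eq_intros refl | simp add: field_simps power2_eq_square
      power3_eq_cube power4_eq_xxxx; fail)+)
  moreover have "\<forall>b d e. (akds_conn b d e r has_real_derivative akds_dconn 3 b d e r c) (at c)"
    unfolding forall_4 akds_conn_simps[abs_def] akds_dconn_simps using nz
    by (intro conjI) ((rule derivative_eq_intros refl | simp add: field_simps power2_eq_square
      power3_eq_cube power4_eq_xxxx; fail)+)
  ultimately have "dir i (lift (akds_conn b d e)) x
      = (if i = 2 then Q r * akds_dconn 2 b d e r c else if i = 3 then X c * akds_dconn 3 b d e r c else 0)"
    using dir_lift[OF x, of "akds_conn b d e"] rc by blast
  then show ?thesis
    using dir_cong[OF el_conn conn_akds_conn x] by simp
qed

section \<open>The curvature tensor\<close>

text \<open>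
  The real and imaginary parts of \<open>\<Psi>\<close>; recall \<open>1 / (r + \<i> a c) = (r - \<i> a c) / S\<close>.
\<close>

definition psi_re :: "real \<Rightarrow> real \<Rightarrow> real" where
  "psi_re r c = - m * (W r c)^3 * ((r^3 - 3 * r * a^2 * c^2) + \<alpha> * a * (a^3 * c^3
    - 3 * r^2 * a * c)) / (S r c)^3"
definition psi_im :: "real \<Rightarrow> real \<Rightarrow> real" where
  "psi_im r c = - m * (W r c)^3 * ((a^3 * c^3 - 3 * r^2 * a * c) - \<alpha> * a * (r^3
    - 3 * r * a^2 * c^2)) / (S r c)^3"

text \<open>\<open>curv_12\<close> and \<open>curv_34\<close> belong to the two principal planes,
  \<open>curv_13\<close> to the four other coordinate planes of the frame, and
  \<open>curv_mixed\<close> to the components with four distinct indices.\<close>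

definition curv_12 :: "real \<Rightarrow> real \<Rightarrow> real" where
  "curv_12 r c = X c * (3 * a^2 * (\<xi> r c)^2 - 2 * a^2 * \<xi> r c * \<beta> r c - a^2 * (\<eta> r c)^2 - (\<gamma> r c)^2)
     + Q r * ((\<eta> r c)^2 - 3 * (\<xi> r c)^2 + 2 * \<xi> r c * \<beta> r c - (\<beta> r c)^2)
     + Q1 r * (2 * \<xi> r c - \<beta> r c) - Q2 r / 2"

definition curv_34 :: "real \<Rightarrow> real \<Rightarrow> real" where
  "curv_34 r c = Q r * (3 * (\<eta> r c)^2 - 2 * \<xi> r c * \<beta> r c - (\<xi> r c)^2 - (\<beta> r c)^2)
     + X c * (a^2 * (\<xi> r c)^2 - 3 * a^2 * (\<eta> r c)^2 + 2 * a^2 * \<xi> r c * \<beta> r c - (\<gamma> r c)^2)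
     + X1 c * (2 * a * \<eta> r c - \<gamma> r c) - X2 c / 2"

definition curv_13 :: "real \<Rightarrow> real \<Rightarrow> real" where
  "curv_13 r c = X c * (a^2 * (\<eta> r c)^2 - a^2 * (\<xi> r c)^2 - (\<gamma> r c)^2)
    + Q r * ((\<xi> r c)^2 - (\<eta> r c)^2 - (\<beta> r c)^2) - Q1 r * (\<xi> r c + \<beta> r c) / 2 - X1 c * (a * \<eta> r c + \<gamma> r c) / 2"

definition curv_mixed :: "real \<Rightarrow> real \<Rightarrow> real" where
  "curv_mixed r c = 2 * \<xi> r c * \<eta> r c * (Q r - a^2 * X c) + a * \<xi> r c * X1 c / 2 - \<eta> r c * Q1 r / 2"

text \<open>Here Q, X and their derivatives remain symbolic. Both orders of the first pair are
  listed because the raised first index, with unequal weights, spoils skewness there; in the last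
  pair skewness leaves only k < l.\<close>

lemma curv_values:
  assumes x: "x \<in> chart" and rc: "r = x $ 2" "c = cos (x $ 3)"
  shows
    "curv 1 1 1 2 x = 0"
    "curv 1 1 1 3 x = 0"
    "curv 1 1 1 4 x = 0"
    "curv 1 1 2 3 x = 0"
    "curv 1 1 2 4 x = 0"
    "curv 1 1 3 4 x = 0"
    "curv 1 2 1 2 x = Q r * curv_12 r c"
    "curv 1 2 1 3 x = 0"
    "curv 1 2 1 4 x = 0"
    "curv 1 2 2 3 x = 0"
    "curv 1 2 2 4 x = 0"
    "curv 1 2 3 4 x = 2 * X c * curv_mixed r c"
    "curv 1 3 1 2 x = 0"
    "curv 1 3 1 3 x = X c * curv_13 r c"
    "curv 1 3 1 4 x = 0"
    "curv 1 3 2 3 x = 0"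
    "curv 1 3 2 4 x = X c * curv_mixed r c"
    "curv 1 3 3 4 x = 0"
    "curv 1 4 1 2 x = 0"
    "curv 1 4 1 3 x = 0"
    "curv 1 4 1 4 x = (\<sigma> r c)^2 * X c * curv_13 r c"
    "curv 1 4 2 3 x = - (X c * curv_mixed r c)"
    "curv 1 4 2 4 x = 0"
    "curv 1 4 3 4 x = 0"
    "curv 2 1 1 2 x = (\<sigma> r c)^2 * Q r * curv_12 r c"
    "curv 2 1 1 3 x = 0"
    "curv 2 1 1 4 x = 0"
    "curv 2 1 2 3 x = 0"
    "curv 2 1 2 4 x = 0"
    "curv 2 1 3 4 x = 2 * (\<sigma> r c)^2 * X c * curv_mixed r c"
    "curv 2 2 1 2 x = 0"
    "curv 2 2 1 3 x = 0"
    "curv 2 2 1 4 x = 0"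
    "curv 2 2 2 3 x = 0"
    "curv 2 2 2 4 x = 0"
    "curv 2 2 3 4 x = 0"
    "curv 2 3 1 2 x = 0"
    "curv 2 3 1 3 x = 0"
    "curv 2 3 1 4 x = (\<sigma> r c)^2 * X c * curv_mixed r c"
    "curv 2 3 2 3 x = X c * curv_13 r c"
    "curv 2 3 2 4 x = 0"
    "curv 2 3 3 4 x = 0"
    "curv 2 4 1 2 x = 0"
    "curv 2 4 1 3 x = - ((\<sigma> r c)^2 * X c * curv_mixed r c)"
    "curv 2 4 1 4 x = 0"
    "curv 2 4 2 3 x = 0"
    "curv 2 4 2 4 x = (\<sigma> r c)^2 * X c * curv_13 r c"
    "curv 2 4 3 4 x = 0"
    "curv 3 1 1 2 x = 0"
    "curv 3 1 1 3 x = (\<sigma> r c)^2 * Q r * curv_13 r c"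
    "curv 3 1 1 4 x = 0"
    "curv 3 1 2 3 x = 0"
    "curv 3 1 2 4 x = (\<sigma> r c)^2 * Q r * curv_mixed r c"
    "curv 3 1 3 4 x = 0"
    "curv 3 2 1 2 x = 0"
    "curv 3 2 1 3 x = 0"
    "curv 3 2 1 4 x = - ((\<sigma> r c)^2 * Q r * curv_mixed r c)"
    "curv 3 2 2 3 x = - (Q r * curv_13 r c)"
    "curv 3 2 2 4 x = 0"
    "curv 3 2 3 4 x = 0"
    "curv 3 3 1 2 x = 0"
    "curv 3 3 1 3 x = 0"
    "curv 3 3 1 4 x = 0"
    "curv 3 3 2 3 x = 0"
    "curv 3 3 2 4 x = 0"
    "curv 3 3 3 4 x = 0"
    "curv 3 4 1 2 x = - (2 * (\<sigma> r c)^2 * Q r * curv_mixed r c)"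
    "curv 3 4 1 3 x = 0"
    "curv 3 4 1 4 x = 0"
    "curv 3 4 2 3 x = 0"
    "curv 3 4 2 4 x = 0"
    "curv 3 4 3 4 x = (\<sigma> r c)^2 * X c * curv_34 r c"
    "curv 4 1 1 2 x = 0"
    "curv 4 1 1 3 x = 0"
    "curv 4 1 1 4 x = (\<sigma> r c)^2 * Q r * curv_13 r c"
    "curv 4 1 2 3 x = - (Q r * curv_mixed r c)"
    "curv 4 1 2 4 x = 0"
    "curv 4 1 3 4 x = 0"
    "curv 4 2 1 2 x = 0"
    "curv 4 2 1 3 x = Q r * curv_mixed r c"
    "curv 4 2 1 4 x = 0"
    "curv 4 2 2 3 x = 0"
    "curv 4 2 2 4 x = - (Q r * curv_13 r c)"
    "curv 4 2 3 4 x = 0"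
    "curv 4 3 1 2 x = 2 * Q r * curv_mixed r c"
    "curv 4 3 1 3 x = 0"
    "curv 4 3 1 4 x = 0"
    "curv 4 3 2 3 x = 0"
    "curv 4 3 2 4 x = 0"
    "curv 4 3 3 4 x = - (X c * curv_34 r c)"
    "curv 4 4 1 2 x = 0"
    "curv 4 4 1 3 x = 0"
    "curv 4 4 1 4 x = 0"
    "curv 4 4 2 3 x = 0"
    "curv 4 4 2 4 x = 0"
    "curv 4 4 3 4 x = 0"
  unfolding curv_def dir_conn[OF x rc] conn_akds_conn[OF x] sum_4 lift_def rc[symmetric]
    curv_12_def curv_13_def curv_34_def curv_mixed_def
  by (simp_all add: algebra_simps add_divide_distrib diff_divide_distrib power2_eq_square
      eta_gamma)

text \<open>
  The field equations enter here: the second derivatives of the metric only occur in four combinations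
  \<open>curv_12\<close>, \<open>curv_13\<close>, \<open>curv_34\<close> and \<open>curv_mixed\<close>, and these reduce to \<open>\<Psi>\<close> for the given \<open>Q\<close> and \<open>X\<close>.
\<close>

lemma curv_12_numerator:
  "X c * (3 * a^2 * r^2 * (W r c)^2 - 2 * a^2 * r * \<alpha> * c * S r c * W r c - a^4 * c^2 * (W r c)^2
    - \<alpha>^2 * r^2 * (S r c)^2)
    + Q r * (a^2 * c^2 * (W r c)^2 - 3 * r^2 * (W r c)^2 + 2 * r * \<alpha> * c * S r c * W r c
      - \<alpha>^2 * c^2 * (S r c)^2)
    + Q1 r * (2 * r * S r c * (W r c)^2 - \<alpha> * c * (S r c)^2 * W r c) - Q2 r * (S r c)^2 * (W r c)^2 / 2
   = \<Lambda> / 3 * (S r c)^3 + 2 * m * (W r c)^3 * ((r^3 - 3 * r * a^2 * c^2) + \<alpha> * a * (a^3 * c^3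
     - 3 * r^2 * a * c))"
proof -
  \<comment> \<open>Writing \<Lambda> as 3 * L turns every \<Lambda> / 3 into a polynomial term for
    the normalisation.\<close>
  obtain L where L: "\<Lambda> = 3 * L" by (metis mult.commute nonzero_divide_eq_eq zero_neq_numeral)
  show ?thesis
    unfolding S_def W_def Q_def Q1_def Q2_def X_def unfolding L
    by (simp add: field_simps power2_eq_square power3_eq_cube power4_eq_xxxx)
qed

lemma curv_13_numerator:
  "X c * (a^4 * c^2 * (W r c)^2 - a^2 * r^2 * (W r c)^2 - \<alpha>^2 * r^2 * (S r c)^2)
    + Q r * (r^2 * (W r c)^2 - a^2 * c^2 * (W r c)^2 - \<alpha>^2 * c^2 * (S r c)^2)
    - Q1 r * (r * S r c * (W r c)^2 + \<alpha> * c * (S r c)^2 * W r c) / 2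
    - X1 c * (a^2 * c * S r c * (W r c)^2 + \<alpha> * r * (S r c)^2 * W r c) / 2
   = \<Lambda> / 3 * (S r c)^3 - m * (W r c)^3 * ((r^3 - 3 * r * a^2 * c^2) + \<alpha> * a * (a^3 * c^3 - 3 * r^2 * a * c))"
proof -
  obtain L where L: "\<Lambda> = 3 * L" by (metis mult.commute nonzero_divide_eq_eq zero_neq_numeral)
  show ?thesis
    unfolding S_def W_def Q_def Q1_def X1_def X_def unfolding L
    by (simp add: field_simps power2_eq_square power3_eq_cube power4_eq_xxxx)
qed

lemma curv_34_numerator:
  "Q r * (3 * a^2 * c^2 * (W r c)^2 - 2 * r * \<alpha> * c * S r c * W r c - r^2 * (W r c)^2 - \<alpha>^2 * c^2 * (S r c)^2)
    + X c * (a^2 * r^2 * (W r c)^2 - 3 * a^4 * c^2 * (W r c)^2 + 2 * a^2 * r * \<alpha> * c * S r c * W r c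
      - \<alpha>^2 * r^2 * (S r c)^2)
    + X1 c * (2 * a^2 * c * S r c * (W r c)^2 - \<alpha> * r * (S r c)^2 * W r c) - X2 c * (S r c)^2 * (W r c)^2 / 2
   = \<Lambda> / 3 * (S r c)^3 + 2 * m * (W r c)^3 * ((r^3 - 3 * r * a^2 * c^2) + \<alpha> * a * (a^3 * c^3
     - 3 * r^2 * a * c))"
proof -
  obtain L where L: "\<Lambda> = 3 * L" by (metis mult.commute nonzero_divide_eq_eq zero_neq_numeral)
  show ?thesis
    unfolding S_def W_def Q_def X_def X1_def X2_def unfolding L
    by (simp add: field_simps power2_eq_square power3_eq_cube power4_eq_xxxx)
qed

lemma curv_mixed_numerator:
  "2 * r * a * c * (Q r - a^2 * X c) + a * r * S r c * X1 c / 2 - a * c * S r c * Q1 r / 2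
   = m * W r c * ((a^3 * c^3 - 3 * r^2 * a * c) - \<alpha> * a * (r^3 - 3 * r * a^2 * c^2))"
proof -
  obtain L where L: "\<Lambda> = 3 * L" by (metis mult.commute nonzero_divide_eq_eq zero_neq_numeral)
  show ?thesis
    unfolding S_def W_def Q_def X_def X1_def Q1_def unfolding L
    by (simp add: field_simps power2_eq_square power3_eq_cube power4_eq_xxxx)
qed

text \<open>Multiplying by S^2 W^2 (by S^2 alone for \<open>curv_mixed\<close>, which is free of
  \<beta> and \<gamma>) gives precisely the left-hand sides of the numerator identities.\<close>

lemma curv_psi:
  assumes "S r c \<noteq> 0" "W r c \<noteq> 0"
  shows "curv_12 r c = (\<Lambda> / 3 - 2 * psi_re r c) * (S r c / (W r c)^2)"
    and "curv_13 r c = (\<Lambda> / 3 + psi_re r c) * (S r c / (W r c)^2)"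
    and "curv_34 r c = (\<Lambda> / 3 - 2 * psi_re r c) * (S r c / (W r c)^2)"
    and "curv_mixed r c = - psi_im r c * (S r c / (W r c)^2)"
proof -
  note defs = \<xi>_def \<eta>_def \<beta>_def \<gamma>_def
  note pow = power2_eq_square power3_eq_cube power4_eq_xxxx
  have "curv_12 r c * ((S r c)^2 * (W r c)^2) = X c * (3 * a^2 * r^2 * (W r c)^2
    - 2 * a^2 * r * \<alpha> * c * S r c * W r c - a^4 * c^2 * (W r c)^2 - \<alpha>^2 * r^2 * (S r c)^2)
    + Q r * (a^2 * c^2 * (W r c)^2 - 3 * r^2 * (W r c)^2 + 2 * r * \<alpha> * c * S r c * W r c
      - \<alpha>^2 * c^2 * (S r c)^2)
    + Q1 r * (2 * r * S r c * (W r c)^2 - \<alpha> * c * (S r c)^2 * W r c) - Q2 r * (S r c)^2 * (W r c)^2 / 2"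
    unfolding curv_12_def defs using assms by (simp add: field_simps pow)
  then have "curv_12 r c = (\<Lambda> / 3 * (S r c)^3 + 2 * m * (W r c)^3 * ((r^3 - 3 * r * a^2 * c^2)
    + \<alpha> * a * (a^3 * c^3 - 3 * r^2 * a * c))) / ((S r c)^2 * (W r c)^2)"
    unfolding curv_12_numerator using assms by (simp add: eq_divide_eq)
  also have "\<dots> = (\<Lambda> / 3 - 2 * psi_re r c) * (S r c / (W r c)^2)"
    unfolding psi_re_def using assms by (simp add: field_simps pow)
  finally show "curv_12 r c = \<dots>" .
  have "curv_13 r c * ((S r c)^2 * (W r c)^2) = X c * (a^4 * c^2 * (W r c)^2 - a^2 * r^2 * (W r c)^2
    - \<alpha>^2 * r^2 * (S r c)^2)
    + Q r * (r^2 * (W r c)^2 - a^2 * c^2 * (W r c)^2 - \<alpha>^2 * c^2 * (S r c)^2)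
    - Q1 r * (r * S r c * (W r c)^2 + \<alpha> * c * (S r c)^2 * W r c) / 2
    - X1 c * (a^2 * c * S r c * (W r c)^2 + \<alpha> * r * (S r c)^2 * W r c) / 2"
    unfolding curv_13_def defs using assms by (simp add: field_simps pow)
  then have "curv_13 r c = (\<Lambda> / 3 * (S r c)^3 - m * (W r c)^3 * ((r^3 - 3 * r * a^2 * c^2)
    + \<alpha> * a * (a^3 * c^3 - 3 * r^2 * a * c))) / ((S r c)^2 * (W r c)^2)"
    unfolding curv_13_numerator using assms by (simp add: eq_divide_eq)
  also have "\<dots> = (\<Lambda> / 3 + psi_re r c) * (S r c / (W r c)^2)"
    unfolding psi_re_def using assms by (simp add: field_simps pow)
  finally show "curv_13 r c = \<dots>" .
  have "curv_34 r c * ((S r c)^2 * (W r c)^2) = Q r * (3 * a^2 * c^2 * (W r c)^2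
    - 2 * r * \<alpha> * c * S r c * W r c - r^2 * (W r c)^2 - \<alpha>^2 * c^2 * (S r c)^2)
    + X c * (a^2 * r^2 * (W r c)^2 - 3 * a^4 * c^2 * (W r c)^2 + 2 * a^2 * r * \<alpha> * c * S r c * W r c
      - \<alpha>^2 * r^2 * (S r c)^2)
    + X1 c * (2 * a^2 * c * S r c * (W r c)^2 - \<alpha> * r * (S r c)^2 * W r c) - X2 c * (S r c)^2 * (W r c)^2 / 2"
    unfolding curv_34_def defs using assms by (simp add: field_simps pow)
  then have "curv_34 r c = (\<Lambda> / 3 * (S r c)^3 + 2 * m * (W r c)^3 * ((r^3 - 3 * r * a^2 * c^2)
    + \<alpha> * a * (a^3 * c^3 - 3 * r^2 * a * c))) / ((S r c)^2 * (W r c)^2)"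
    unfolding curv_34_numerator using assms by (simp add: eq_divide_eq)
  also have "\<dots> = (\<Lambda> / 3 - 2 * psi_re r c) * (S r c / (W r c)^2)"
    unfolding psi_re_def using assms by (simp add: field_simps pow)
  finally show "curv_34 r c = \<dots>" .
  have "curv_mixed r c * (S r c)^2 = 2 * r * a * c * (Q r - a^2 * X c) + a * r * S r c * X1 c / 2
    - a * c * S r c * Q1 r / 2"
    unfolding curv_mixed_def defs using assms by (simp add: field_simps pow)
  then have "curv_mixed r c = m * W r c * ((a^3 * c^3 - 3 * r^2 * a * c) - \<alpha> * a * (r^3
    - 3 * r * a^2 * c^2)) / (S r c)^2"
    unfolding curv_mixed_numerator using assms by (simp add: eq_divide_eq)
  also have "\<dots> = - psi_im r c * (S r c / (W r c)^2)"
    unfolding psi_im_def using assms by (simp add: field_simps pow)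
  finally show "curv_mixed r c = \<dots>" .
qed

section \<open>The lowered curvature in closed form\<close>

definition levi_civita :: "4 \<Rightarrow> 4 \<Rightarrow> 4 \<Rightarrow> 4 \<Rightarrow> real" where
  "levi_civita i j k l =
     (if (i, j, k, l) \<in> {(1, 2, 3, 4), (1, 3, 4, 2), (1, 4, 2, 3), (2, 1, 4, 3), (2, 3, 1, 4), (2, 4, 3, 1),
       (3, 1, 2, 4), (3, 2, 4, 1), (3, 4, 1, 2), (4, 1, 3, 2), (4, 2, 1, 3), (4, 3, 2, 1)} then 1
      else if (i, j, k, l) \<in> {(1, 2, 4, 3), (1, 3, 2, 4), (1, 4, 3, 2), (2, 1, 3, 4), (2, 3, 4, 1),
      (2, 4, 1, 3),
       (3, 1, 4, 2), (3, 2, 1, 4), (3, 4, 2, 1), (4, 1, 2, 3), (4, 2, 3, 1), (4, 3, 1, 2)} then - 1 else 0)"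

lemma levi_civita_simps [simp]:
  "levi_civita i i k l = 0" "levi_civita i j i l = 0" "levi_civita i j k i = 0"
  "levi_civita i j j l = 0" "levi_civita i j k j = 0" "levi_civita i j k k = 0"
  "levi_civita 1 2 3 4 = 1"
  "levi_civita 1 2 4 3 = - 1"
  "levi_civita 1 3 2 4 = - 1"
  "levi_civita 1 3 4 2 = 1"
  "levi_civita 1 4 2 3 = 1"
  "levi_civita 1 4 3 2 = - 1"
  "levi_civita 2 1 3 4 = - 1"
  "levi_civita 2 1 4 3 = 1"
  "levi_civita 2 3 1 4 = 1"
  "levi_civita 2 3 4 1 = - 1"
  "levi_civita 2 4 1 3 = - 1"
  "levi_civita 2 4 3 1 = 1"
  "levi_civita 3 1 2 4 = 1"
  "levi_civita 3 1 4 2 = - 1"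
  "levi_civita 3 2 1 4 = - 1"
  "levi_civita 3 2 4 1 = 1"
  "levi_civita 3 4 1 2 = 1"
  "levi_civita 3 4 2 1 = - 1"
  "levi_civita 4 1 2 3 = - 1"
  "levi_civita 4 1 3 2 = 1"
  "levi_civita 4 2 1 3 = 1"
  "levi_civita 4 2 3 1 = - 1"
  "levi_civita 4 3 1 2 = - 1"
  "levi_civita 4 3 2 1 = 1"
  by (auto simp: levi_civita_def)

text \<open>The trace-free pattern -2, 1, 1 of a type D Weyl tensor, one value for each pair of
  complementary planes; -2 goes to the principal planes.\<close>

definition sec_coeff :: "4 \<Rightarrow> 4 \<Rightarrow> real" where
  "sec_coeff i j = (if (i, j) \<in> {(1, 2), (2, 1), (3, 4), (4, 3)} then - 2 else 1)"

lemma sec_coeff_simps [simp]: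
  "sec_coeff 1 1 = 1"
  "sec_coeff 1 2 = - 2"
  "sec_coeff 1 3 = 1"
  "sec_coeff 1 4 = 1"
  "sec_coeff 2 1 = - 2"
  "sec_coeff 2 2 = 1"
  "sec_coeff 2 3 = 1"
  "sec_coeff 2 4 = 1"
  "sec_coeff 3 1 = 1"
  "sec_coeff 3 2 = 1"
  "sec_coeff 3 3 = 1"
  "sec_coeff 3 4 = - 2"
  "sec_coeff 4 1 = 1"
  "sec_coeff 4 2 = 1"
  "sec_coeff 4 3 = - 2"
  "sec_coeff 4 4 = 1"
  by (simp_all add: sec_coeff_def)

text \<open>A constant-curvature pattern whose factor depends on the plane, plus a dual part. The
  product of the four weights is - (Q X / W^4)^2, so Q X / W^4 is, up to sign, the component of the
  volume form in this frame.\<close>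

definition akds_riem :: "4 \<Rightarrow> 4 \<Rightarrow> 4 \<Rightarrow> 4 \<Rightarrow> real \<Rightarrow> real \<Rightarrow> real" where
  "akds_riem i j k l r c =
     (delta i k * delta j l - delta i l * delta j k)
       * (weight i r c * weight j r c * (\<Lambda> / 3 + sec_coeff i j * psi_re r c))
     - levi_civita i j k l * (sec_coeff i j * (Q r * X c * psi_im r c / (W r c)^4))"

lemma riemann_components:
  assumes x: "x \<in> chart"
  shows "lift (weight i) x * curv i j k l x = lift (akds_riem i j k l) x"
proof -
  define r c where rc: "r = x $ 2" "c = cos (x $ 3)"
  note nz = chartD(1-4)[OF x, folded rc]
  have sk: "curv i j 2 1 x = - curv i j 1 2 x" "curv i j 3 1 x = - curv i j 1 3 x" "curv i j 4 1 x =
    - curv i j 1 4 x"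
    "curv i j 3 2 x = - curv i j 2 3 x" "curv i j 4 2 x = - curv i j 2 4 x" "curv i j 4 3 x =
      - curv i j 3 4 x"
    "curv i j k k x = 0" for i j k
    using curv_skew[of i j _ _ x] curv_skew[of i j k k x] by (auto simp: eq_neg_iff_add_eq_0)
  have "\<forall>i j k l. weight i r c * curv i j k l x = akds_riem i j k l r c"
    unfolding forall_4 akds_riem_def weight_simps sec_coeff_simps levi_civita_simps sk curv_values[OF x
      rc] curv_psi[OF nz(1,2)] \<sigma>_def using nz
    by (intro conjI) (simp_all add: delta_def field_simps power2_eq_square power3_eq_cube power4_eq_xxxx)
  then show ?thesis unfolding lift_def rc by blast
qed

section \<open>The covariant derivative of the curvature tensor\<close>

lemma levi_civita_skew: "levi_civita j i k l = - levi_civita i j k l"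
proof -
  have "\<forall>i j k l. levi_civita j i k l = - levi_civita i j k l"
    unfolding forall_4 by simp
  then show ?thesis by blast
qed

lemma akds_riem_skew: "akds_riem j i k l r c = - akds_riem i j k l r c"
  using levi_civita_skew[of j i k l]
  by (auto simp: akds_riem_def delta_def sec_coeff_def)

text \<open>The only asymmetric ingredient is \<open>sec_coeff i j\<close>; it takes equal values on
  complementary planes, and \<open>levi_civita\<close> vanishes unless the pairs are
  complementary.\<close>

lemma akds_riem_pair: "akds_riem k l i j r c = akds_riem i j k l r c"
proof -
  have "\<forall>i j k l. akds_riem k l i j r c = akds_riem i j k l r c"
    unfolding forall_4 akds_riem_def by (simp add: delta_def)
  then show ?thesis by blast
qed

text \<open>Logarithmic differentiation: the r-derivative of \<Psi> is -3 (\<xi> - i \<eta> +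
  \<beta>) \<Psi> and the c-derivative is -3 (\<gamma> + a \<eta> + i a \<xi>) \<Psi>. These four
  functions are the real and imaginary parts.\<close>

definition psi_re_r :: "real \<Rightarrow> real \<Rightarrow> real" where
  "psi_re_r r c = - 3 * ((\<xi> r c + \<beta> r c) * psi_re r c + \<eta> r c * psi_im r c)"
definition psi_im_r :: "real \<Rightarrow> real \<Rightarrow> real" where
  "psi_im_r r c = 3 * (\<eta> r c * psi_re r c - (\<xi> r c + \<beta> r c) * psi_im r c)"
definition psi_re_c :: "real \<Rightarrow> real \<Rightarrow> real" where
  "psi_re_c r c = - 3 * ((\<gamma> r c + a * \<eta> r c) * psi_re r c - a * \<xi> r c * psi_im r c)"
definition psi_im_c :: "real \<Rightarrow> real \<Rightarrow> real" where
  "psi_im_c r c = - 3 * ((\<gamma> r c + a * \<eta> r c) * psi_im r c + a * \<xi> r c * psi_re r c)"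

text \<open>\<Psi> = - m (1 - i \<alpha> a) W^3 (\<xi> - i \<eta>)^3, a form to which the polynomial
  derivative rules apply.\<close>

lemma psi_alt:
  assumes "S r c \<noteq> 0"
  shows "psi_re r c = - m * (W r c)^3 * ((\<xi> r c)^3 - 3 * \<xi> r c * (\<eta> r c)^2 + \<alpha> * a * ((\<eta> r c)^3
    - 3 * (\<xi> r c)^2 * \<eta> r c))"
    and "psi_im r c = - m * (W r c)^3 * ((\<eta> r c)^3 - 3 * (\<xi> r c)^2 * \<eta> r c - \<alpha> * a * ((\<xi> r c)^3
      - 3 * \<xi> r c * (\<eta> r c)^2))"
  unfolding psi_re_def psi_im_def \<xi>_def \<eta>_def using assms
  by (simp_all add: field_simps power2_eq_square power3_eq_cube)

lemma psi_derivs: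
  assumes "S r c \<noteq> 0" "W r c \<noteq> 0"
  shows "((\<lambda>r. psi_re r c) has_real_derivative psi_re_r r c) (at r)"
    and "(psi_re r has_real_derivative psi_re_c r c) (at c)"
    and "((\<lambda>r. psi_im r c) has_real_derivative psi_im_r r c) (at r)"
    and "(psi_im r has_real_derivative psi_im_c r c) (at c)"
proof -
  have W: "- \<alpha> * c = - \<beta> r c * W r c" "- \<alpha> * r = - \<gamma> r c * W r c"
    using assms by (simp_all add: \<beta>_def \<gamma>_def)
  have Wd: "((\<lambda>r. W r c) has_real_derivative - \<beta> r c * W r c) (at r)" "((\<lambda>c. W r c) has_real_derivative
    - \<gamma> r c * W r c) (at c)"
    unfolding W[symmetric] by (rule has_derivs)+
  \<comment> \<open>\<open>psi_alt\<close> requires S to be nonzero, so it replaces the function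
    only in a neighbourhood of the point.\<close>
  have ev: "\<forall>\<^sub>F r in nhds r. S r c \<noteq> 0" "\<forall>\<^sub>F c in nhds c. S r c \<noteq> 0"
    using assms(1) unfolding S_def
    by (auto intro!: eventually_nhds_in_open[of "{r. r^2 + a^2 * c^2 \<noteq> 0}" r, simplified]
        eventually_nhds_in_open[of "{c. r^2 + a^2
        * c^2 \<noteq> 0}" c, simplified] open_Collect_neq continuous_intros)
  \<comment> \<open>Makes the rules \<open>Wd\<close> the ones used, so that derivatives of
    \<open>W\<close> appear as multiples of \<open>W\<close>.\<close>
  note [derivative_intros del] = has_derivs(3,4)
  note d = psi_re_r_def psi_im_r_def psi_re_c_def psi_im_c_def psi_alt[OF assms(1)]
  show "((\<lambda>r. psi_re r c) has_real_derivative psi_re_r r c) (at r)"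
    by (subst DERIV_cong_ev[OF refl _ refl], rule eventually_mono[OF ev(1)], erule psi_alt)
      (use assms in \<open>auto intro!: derivative_eq_intros Wd simp: d\<close>, simp add: algebra_simps
      power2_eq_square power3_eq_cube)
  show "(psi_re r has_real_derivative psi_re_c r c) (at c)"
    by (subst DERIV_cong_ev[OF refl _ refl], rule eventually_mono[OF ev(2)], erule psi_alt)
      (use assms in \<open>auto intro!: derivative_eq_intros Wd simp: d\<close>, simp add: algebra_simps
      power2_eq_square power3_eq_cube)
  show "((\<lambda>r. psi_im r c) has_real_derivative psi_im_r r c) (at r)"
    by (subst DERIV_cong_ev[OF refl _ refl], rule eventually_mono[OF ev(1)], erule psi_alt)
      (use assms in \<open>auto intro!: derivative_eq_intros Wd simp: d\<close>, simp add: algebra_simps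
      power2_eq_square power3_eq_cube)
  show "(psi_im r has_real_derivative psi_im_c r c) (at c)"
    by (subst DERIV_cong_ev[OF refl _ refl], rule eventually_mono[OF ev(2)], erule psi_alt)
      (use assms in \<open>auto intro!: derivative_eq_intros Wd simp: d\<close>, simp add: algebra_simps
      power2_eq_square power3_eq_cube)
qed

lemma elementary_psi: "elementary chart (lift psi_re)" "elementary chart (lift psi_im)"
  unfolding lift_def psi_re_def psi_im_def
  by (intro elementary_intros elementary_basic; simp add: chartD)+

definition mixed :: "real \<Rightarrow> real \<Rightarrow> real" where "mixed r c = Q r * X c * psi_im r c / (W r c)^4"

lemma elementary_mixed: "elementary chart (lift mixed)"
  using elementary_psi unfolding lift_def mixed_def
  by (intro elementary_intros elementary_basic) (simp_all add: chartD)

lemma dir_mixed: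
  assumes x: "x \<in> chart" and rc: "r = x $ 2" "c = cos (x $ 3)"
  shows "dir i (lift mixed) x =
    (if i = 2 then Q r * X c / (W r c)^4 * ((Q1 r + 4 * Q r * \<beta> r c) * psi_im r c + Q r * psi_im_r r c)
     else if i = 3 then Q r * X c / (W r c)^4 * ((X1 c + 4 * X c * \<gamma> r c) * psi_im r c
       + X c * psi_im_c r c) else 0)"
proof -
  note nz = chartD(1-4)[OF x, folded rc]
  have "((\<lambda>r. mixed r c) has_real_derivative X c / (W r c)^4 * ((Q1 r + 4 * Q r * \<beta> r c) * psi_im r c
    + Q r * psi_im_r r c)) (at r)"
    unfolding mixed_def using nz
    by (auto intro!: derivative_eq_intros psi_derivs) (simp add: \<beta>_def field_simps eval_nat_numeral)
  moreover have "(mixed r has_real_derivative Q r / (W r c)^4 * ((X1 c + 4 * X c * \<gamma> r c) * psi_im r c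
    + X c * psi_im_c r c)) (at c)"
    unfolding mixed_def[abs_def] using nz
    by (auto intro!: derivative_eq_intros psi_derivs) (simp add: \<gamma>_def field_simps eval_nat_numeral)
  ultimately show ?thesis
    using dir_lift[OF x, of mixed] rc by simp
qed

lemma dir_psi_re:
  assumes x: "x \<in> chart" and rc: "r = x $ 2" "c = cos (x $ 3)"
  shows "dir i (lift psi_re) x = (if i = 2 then Q r * psi_re_r r c else if i = 3
    then X c * psi_re_c r c else 0)"
  using dir_lift[OF x psi_derivs(1,2)] chartD(1,2)[OF x] rc by simp

lemma akds_riem_lift:
  "lift (akds_riem i j k l) = (\<lambda>x. (delta i k * delta j l - delta i l * delta j k)
      * (lift (weight i) x * lift (weight j) x * (\<Lambda> / 3 + sec_coeff i j * lift psi_re x))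
      + - (levi_civita i j k l * sec_coeff i j) * lift mixed x)"
  by (auto simp: lift_def akds_riem_def mixed_def)

lemma elementary_riem: "elementary chart (lift (akds_riem i j k l))"
  unfolding akds_riem_lift
  by (intro elementary_intros elementary_weight elementary_psi elementary_mixed)

text \<open>For the constant-curvature pattern the derivatives of the weights give twice the
  diagonal connection coefficients, which cancel the diagonal connection terms of
  \<open>frame_cov\<close>.\<close>

lemma dir_riem:
  assumes x: "x \<in> chart" and rc: "r = x $ 2" "c = cos (x $ 3)"
  shows "dir f (lift (akds_riem i j k l)) x = (delta i k * delta j l - delta i l * delta j k)
      * (weight i r c * weight j r c * (2 * (akds_conn i f i r c + akds_conn j f j r c) * (\<Lambda> / 3
      + sec_coeff i j * psi_re r c)
         + sec_coeff i j * dir f (lift psi_re) x))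
      - levi_civita i j k l * sec_coeff i j * dir f (lift mixed) x"
proof -
  note e = elementary_intros elementary_weight elementary_psi elementary_mixed
  have "dir f (\<lambda>x. lift (weight i) x * lift (weight j) x * (\<Lambda> / 3 + sec_coeff i j * lift psi_re x)) x
    = weight i r c * weight j r c * (2 * (akds_conn i f i r c + akds_conn j f j r c) * (\<Lambda> / 3
      + sec_coeff i j * psi_re r c)
         + sec_coeff i j * dir f (lift psi_re) x)"
    using x by (simp add: dir_mult dir_add dir_const e dir_weight[OF x rc])
      (simp add: lift_def rc algebra_simps)
  then show ?thesis
    unfolding akds_riem_lift using x by (subst dir_linear) (auto intro!: e)
qed

text \<open>\<Lambda> drops out because the constant-curvature part is parallel. Nothing depends on
  t and phi, so in directions 1 and 4 only connection terms contribute: they tilt the principal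
  planes and multiply the curvature difference 3 \<Psi>, and by the form of \<open>psi_re_r\<close>
  and its companions this again gives derivatives of \<Psi>, as the Bianchi identity
  demands.\<close>

lemma frame_cov_values:
  assumes x: "x \<in> chart" and rc: "r = x $ 2" "c = cos (x $ 3)"
  shows
    "frame_cov (\<lambda>i j k l. lift (akds_riem i j k l)) 1 1 2 1 2 x = 0"
    "frame_cov (\<lambda>i j k l. lift (akds_riem i j k l)) 1 1 2 1 3 x = 0"
    "frame_cov (\<lambda>i j k l. lift (akds_riem i j k l)) 1 1 2 1 4 x
      = (Q r)^2 * X c * (\<sigma> r c)^2 * psi_im_c r c / (W r c)^4"
    "frame_cov (\<lambda>i j k l. lift (akds_riem i j k l)) 1 1 2 2 3 x =
      - ((Q r)^2 * X c * psi_re_c r c / (W r c)^4)"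
    "frame_cov (\<lambda>i j k l. lift (akds_riem i j k l)) 1 1 2 2 4 x = 0"
    "frame_cov (\<lambda>i j k l. lift (akds_riem i j k l)) 1 1 2 3 4 x = 0"
    "frame_cov (\<lambda>i j k l. lift (akds_riem i j k l)) 1 1 3 1 3 x = 0"
    "frame_cov (\<lambda>i j k l. lift (akds_riem i j k l)) 1 1 3 1 4 x = 0"
    "frame_cov (\<lambda>i j k l. lift (akds_riem i j k l)) 1 1 3 2 3 x = 0"
    "frame_cov (\<lambda>i j k l. lift (akds_riem i j k l)) 1 1 3 2 4 x = 0"
    "frame_cov (\<lambda>i j k l. lift (akds_riem i j k l)) 1 1 3 3 4 x = 0"
    "frame_cov (\<lambda>i j k l. lift (akds_riem i j k l)) 1 1 4 1 4 x = 0"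
    "frame_cov (\<lambda>i j k l. lift (akds_riem i j k l)) 1 1 4 2 3 x = 0"
    "frame_cov (\<lambda>i j k l. lift (akds_riem i j k l)) 1 1 4 2 4 x = 0"
    "frame_cov (\<lambda>i j k l. lift (akds_riem i j k l)) 1 1 4 3 4 x =
      - (Q r * (X c)^2 * (\<sigma> r c)^2 * psi_re_c r c / (W r c)^4)"
    "frame_cov (\<lambda>i j k l. lift (akds_riem i j k l)) 1 2 3 2 3 x = 0"
    "frame_cov (\<lambda>i j k l. lift (akds_riem i j k l)) 1 2 3 2 4 x = 0"
    "frame_cov (\<lambda>i j k l. lift (akds_riem i j k l)) 1 2 3 3 4 x =
      - (Q r * (X c)^2 * psi_im_c r c / (W r c)^4)"
    "frame_cov (\<lambda>i j k l. lift (akds_riem i j k l)) 1 2 4 2 4 x = 0"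
    "frame_cov (\<lambda>i j k l. lift (akds_riem i j k l)) 1 2 4 3 4 x = 0"
    "frame_cov (\<lambda>i j k l. lift (akds_riem i j k l)) 1 3 4 3 4 x = 0"
    "frame_cov (\<lambda>i j k l. lift (akds_riem i j k l)) 2 1 2 1 2 x = 2 * (Q r)^3 * psi_re_r r c / (W r c)^4"
    "frame_cov (\<lambda>i j k l. lift (akds_riem i j k l)) 2 1 2 1 3 x = (Q r)^2 * X c * psi_re_c r c / (W r c)^4"
    "frame_cov (\<lambda>i j k l. lift (akds_riem i j k l)) 2 1 2 1 4 x = 0"
    "frame_cov (\<lambda>i j k l. lift (akds_riem i j k l)) 2 1 2 2 3 x = 0"
    "frame_cov (\<lambda>i j k l. lift (akds_riem i j k l)) 2 1 2 2 4 x =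
      - ((Q r)^2 * X c * psi_im_c r c / (W r c)^4)"
    "frame_cov (\<lambda>i j k l. lift (akds_riem i j k l)) 2 1 2 3 4 x
      = 2 * (Q r)^2 * X c * psi_im_r r c / (W r c)^4"
    "frame_cov (\<lambda>i j k l. lift (akds_riem i j k l)) 2 1 3 1 3 x =
      - ((Q r)^2 * X c * psi_re_r r c / (W r c)^4)"
    "frame_cov (\<lambda>i j k l. lift (akds_riem i j k l)) 2 1 3 1 4 x = 0"
    "frame_cov (\<lambda>i j k l. lift (akds_riem i j k l)) 2 1 3 2 3 x = 0"
    "frame_cov (\<lambda>i j k l. lift (akds_riem i j k l)) 2 1 3 2 4 x = (Q r)^2 * X c * psi_im_r r c / (W r c)^4"
    "frame_cov (\<lambda>i j k l. lift (akds_riem i j k l)) 2 1 3 3 4 x = Q r * (X c)^2 * psi_im_c r c / (W r c)^4"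
    "frame_cov (\<lambda>i j k l. lift (akds_riem i j k l)) 2 1 4 1 4 x =
      - ((Q r)^2 * X c * (\<sigma> r c)^2 * psi_re_r r c / (W r c)^4)"
    "frame_cov (\<lambda>i j k l. lift (akds_riem i j k l)) 2 1 4 2 3 x =
      - ((Q r)^2 * X c * psi_im_r r c / (W r c)^4)"
    "frame_cov (\<lambda>i j k l. lift (akds_riem i j k l)) 2 1 4 2 4 x = 0"
    "frame_cov (\<lambda>i j k l. lift (akds_riem i j k l)) 2 1 4 3 4 x = 0"
    "frame_cov (\<lambda>i j k l. lift (akds_riem i j k l)) 2 2 3 2 3 x
      = (Q r)^2 * X c * psi_re_r r c / ((\<sigma> r c)^2 * (W r c)^4)"
    "frame_cov (\<lambda>i j k l. lift (akds_riem i j k l)) 2 2 3 2 4 x = 0"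
    "frame_cov (\<lambda>i j k l. lift (akds_riem i j k l)) 2 2 3 3 4 x = 0"
    "frame_cov (\<lambda>i j k l. lift (akds_riem i j k l)) 2 2 4 2 4 x = (Q r)^2 * X c * psi_re_r r c / (W r c)^4"
    "frame_cov (\<lambda>i j k l. lift (akds_riem i j k l)) 2 2 4 3 4 x = Q r * (X c)^2 * psi_re_c r c / (W r c)^4"
    "frame_cov (\<lambda>i j k l. lift (akds_riem i j k l)) 2 3 4 3 4 x =
      - (2 * Q r * (X c)^2 * psi_re_r r c / (W r c)^4)"
    "frame_cov (\<lambda>i j k l. lift (akds_riem i j k l)) 3 1 2 1 2 x
      = 2 * (Q r)^2 * X c * psi_re_c r c / (W r c)^4"
    "frame_cov (\<lambda>i j k l. lift (akds_riem i j k l)) 3 1 2 1 3 x =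
      - ((Q r)^2 * X c * psi_re_r r c / (W r c)^4)"
    "frame_cov (\<lambda>i j k l. lift (akds_riem i j k l)) 3 1 2 1 4 x = 0"
    "frame_cov (\<lambda>i j k l. lift (akds_riem i j k l)) 3 1 2 2 3 x = 0"
    "frame_cov (\<lambda>i j k l. lift (akds_riem i j k l)) 3 1 2 2 4 x = (Q r)^2 * X c * psi_im_r r c / (W r c)^4"
    "frame_cov (\<lambda>i j k l. lift (akds_riem i j k l)) 3 1 2 3 4 x
      = 2 * Q r * (X c)^2 * psi_im_c r c / (W r c)^4"
    "frame_cov (\<lambda>i j k l. lift (akds_riem i j k l)) 3 1 3 1 3 x =
      - (Q r * (X c)^2 * psi_re_c r c / (W r c)^4)"
    "frame_cov (\<lambda>i j k l. lift (akds_riem i j k l)) 3 1 3 1 4 x = 0"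
    "frame_cov (\<lambda>i j k l. lift (akds_riem i j k l)) 3 1 3 2 3 x = 0"
    "frame_cov (\<lambda>i j k l. lift (akds_riem i j k l)) 3 1 3 2 4 x = Q r * (X c)^2 * psi_im_c r c / (W r c)^4"
    "frame_cov (\<lambda>i j k l. lift (akds_riem i j k l)) 3 1 3 3 4 x =
      - (Q r * (X c)^2 * psi_im_r r c / (W r c)^4)"
    "frame_cov (\<lambda>i j k l. lift (akds_riem i j k l)) 3 1 4 1 4 x =
      - (Q r * (X c)^2 * (\<sigma> r c)^2 * psi_re_c r c / (W r c)^4)"
    "frame_cov (\<lambda>i j k l. lift (akds_riem i j k l)) 3 1 4 2 3 x =
      - (Q r * (X c)^2 * psi_im_c r c / (W r c)^4)"
    "frame_cov (\<lambda>i j k l. lift (akds_riem i j k l)) 3 1 4 2 4 x = 0"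
    "frame_cov (\<lambda>i j k l. lift (akds_riem i j k l)) 3 1 4 3 4 x = 0"
    "frame_cov (\<lambda>i j k l. lift (akds_riem i j k l)) 3 2 3 2 3 x
      = Q r * (X c)^2 * psi_re_c r c / ((\<sigma> r c)^2 * (W r c)^4)"
    "frame_cov (\<lambda>i j k l. lift (akds_riem i j k l)) 3 2 3 2 4 x = 0"
    "frame_cov (\<lambda>i j k l. lift (akds_riem i j k l)) 3 2 3 3 4 x = 0"
    "frame_cov (\<lambda>i j k l. lift (akds_riem i j k l)) 3 2 4 2 4 x = Q r * (X c)^2 * psi_re_c r c / (W r c)^4"
    "frame_cov (\<lambda>i j k l. lift (akds_riem i j k l)) 3 2 4 3 4 x =
      - (Q r * (X c)^2 * psi_re_r r c / (W r c)^4)"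
    "frame_cov (\<lambda>i j k l. lift (akds_riem i j k l)) 3 3 4 3 4 x = - (2 * (X c)^3 * psi_re_c r c / (W r c)^4)"
    "frame_cov (\<lambda>i j k l. lift (akds_riem i j k l)) 4 1 2 1 2 x = 0"
    "frame_cov (\<lambda>i j k l. lift (akds_riem i j k l)) 4 1 2 1 3 x = 0"
    "frame_cov (\<lambda>i j k l. lift (akds_riem i j k l)) 4 1 2 1 4 x =
      - ((Q r)^2 * X c * (\<sigma> r c)^2 * psi_re_r r c / (W r c)^4)"
    "frame_cov (\<lambda>i j k l. lift (akds_riem i j k l)) 4 1 2 2 3 x =
      - ((Q r)^2 * X c * psi_im_r r c / (W r c)^4)"
    "frame_cov (\<lambda>i j k l. lift (akds_riem i j k l)) 4 1 2 2 4 x = 0"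
    "frame_cov (\<lambda>i j k l. lift (akds_riem i j k l)) 4 1 2 3 4 x = 0"
    "frame_cov (\<lambda>i j k l. lift (akds_riem i j k l)) 4 1 3 1 3 x = 0"
    "frame_cov (\<lambda>i j k l. lift (akds_riem i j k l)) 4 1 3 1 4 x = 0"
    "frame_cov (\<lambda>i j k l. lift (akds_riem i j k l)) 4 1 3 2 3 x = 0"
    "frame_cov (\<lambda>i j k l. lift (akds_riem i j k l)) 4 1 3 2 4 x = 0"
    "frame_cov (\<lambda>i j k l. lift (akds_riem i j k l)) 4 1 3 3 4 x = 0"
    "frame_cov (\<lambda>i j k l. lift (akds_riem i j k l)) 4 1 4 1 4 x = 0"
    "frame_cov (\<lambda>i j k l. lift (akds_riem i j k l)) 4 1 4 2 3 x = 0"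
    "frame_cov (\<lambda>i j k l. lift (akds_riem i j k l)) 4 1 4 2 4 x = 0"
    "frame_cov (\<lambda>i j k l. lift (akds_riem i j k l)) 4 1 4 3 4 x =
      - (Q r * (X c)^2 * (\<sigma> r c)^2 * psi_im_r r c / (W r c)^4)"
    "frame_cov (\<lambda>i j k l. lift (akds_riem i j k l)) 4 2 3 2 3 x = 0"
    "frame_cov (\<lambda>i j k l. lift (akds_riem i j k l)) 4 2 3 2 4 x = 0"
    "frame_cov (\<lambda>i j k l. lift (akds_riem i j k l)) 4 2 3 3 4 x = Q r * (X c)^2 * psi_re_r r c / (W r c)^4"
    "frame_cov (\<lambda>i j k l. lift (akds_riem i j k l)) 4 2 4 2 4 x = 0"
    "frame_cov (\<lambda>i j k l. lift (akds_riem i j k l)) 4 2 4 3 4 x = 0"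
    "frame_cov (\<lambda>i j k l. lift (akds_riem i j k l)) 4 3 4 3 4 x = 0"
  unfolding frame_cov_def dir_riem[OF x rc] dir_psi_re[OF x rc] dir_mixed[OF x rc] conn_akds_conn[OF x] sum_4
    lift_def rc[symmetric] akds_riem_def psi_re_r_def psi_im_r_def psi_re_c_def psi_im_c_def
  using chartD(2-4)[OF x, folded rc] sigma_nonzero[OF chartD(1)[OF x, folded rc]]
  by (simp_all add: delta_def)
    (simp_all add: field_simps power2_eq_square power3_eq_cube power4_eq_xxxx
      eta_gamma)

definition contrib :: "4 \<Rightarrow> 4 \<Rightarrow> 4 \<Rightarrow> 4 \<Rightarrow> 4 \<Rightarrow> real^4 \<Rightarrow> real" where
  "contrib f i j k l x = (frame_cov (\<lambda>i j k l. lift (akds_riem i j k l)) f i j k l x)^2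
     / (lift (weight f) x * (lift (weight i) x * (lift (weight j) x * (lift (weight k) x
       * lift (weight l) x))))"

lemma contrib_symmetric:
  assumes x: "x \<in> chart"
  shows "contrib f j i k l x = contrib f i j k l x" "contrib f k l i j x = contrib f i j k l x"
    "contrib f i i k l x = 0"
proof -
  have sk: "frame_cov (\<lambda>i j k l. lift (akds_riem i j k l)) f j i k l x =
    - frame_cov (\<lambda>i j k l. lift (akds_riem i j k l)) f i j k l x" for i j k l
    by (rule frame_cov_skew12[OF elementary_riem x]) (unfold lift_def, rule akds_riem_skew)
  show "contrib f j i k l x = contrib f i j k l x"
    unfolding contrib_def sk[of j i] by (simp add: mult_ac)
  show "contrib f i i k l x = 0"
    using sk[of i i k l] by (simp add: contrib_def)
  have "frame_cov (\<lambda>i j k l. lift (akds_riem i j k l)) f k l i j x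
    = frame_cov (\<lambda>i j k l. lift (akds_riem i j k l)) f i j k l x"
    by (rule frame_cov_pair) (auto simp: lift_def akds_riem_pair)
  then show "contrib f k l i j x = contrib f i j k l x"
    unfolding contrib_def by (simp add: mult_ac)
qed

text \<open>The minus sign of the first weight decides the signs: in the components containing
  \<open>psi_im\<close> derivatives the index 1 occurs an odd number of times, in the others an even
  number. Hence real parts enter with plus and imaginary parts with minus.\<close>

lemma contrib_values:
  assumes x: "x \<in> chart" and rc: "r = x $ 2" "c = cos (x $ 3)"
  shows
    "contrib 1 1 2 1 2 x = 0"
    "contrib 1 1 2 1 3 x = 0"
    "contrib 1 1 2 1 4 x = - (((W r c)^2 * \<sigma> r c) * (X c * (psi_im_c r c)^2))"
    "contrib 1 1 2 2 3 x = ((W r c)^2 * \<sigma> r c) * (X c * (psi_re_c r c)^2)"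
    "contrib 1 1 2 2 4 x = 0"
    "contrib 1 1 2 3 4 x = 0"
    "contrib 1 1 3 1 3 x = 0"
    "contrib 1 1 3 1 4 x = 0"
    "contrib 1 1 3 2 3 x = 0"
    "contrib 1 1 3 2 4 x = 0"
    "contrib 1 1 3 3 4 x = 0"
    "contrib 1 1 4 1 4 x = 0"
    "contrib 1 1 4 2 3 x = 0"
    "contrib 1 1 4 2 4 x = 0"
    "contrib 1 1 4 3 4 x = ((W r c)^2 * \<sigma> r c) * (X c * (psi_re_c r c)^2)"
    "contrib 1 2 3 2 3 x = 0"
    "contrib 1 2 3 2 4 x = 0"
    "contrib 1 2 3 3 4 x = - (((W r c)^2 * \<sigma> r c) * (X c * (psi_im_c r c)^2))"
    "contrib 1 2 4 2 4 x = 0"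
    "contrib 1 2 4 3 4 x = 0"
    "contrib 1 3 4 3 4 x = 0"
    "contrib 2 1 2 1 2 x = 4 * ((W r c)^2 * \<sigma> r c) * (Q r * (psi_re_r r c)^2)"
    "contrib 2 1 2 1 3 x = ((W r c)^2 * \<sigma> r c) * (X c * (psi_re_c r c)^2)"
    "contrib 2 1 2 1 4 x = 0"
    "contrib 2 1 2 2 3 x = 0"
    "contrib 2 1 2 2 4 x = - (((W r c)^2 * \<sigma> r c) * (X c * (psi_im_c r c)^2))"
    "contrib 2 1 2 3 4 x = - (4 * ((W r c)^2 * \<sigma> r c) * (Q r * (psi_im_r r c)^2))"
    "contrib 2 1 3 1 3 x = ((W r c)^2 * \<sigma> r c) * (Q r * (psi_re_r r c)^2)"
    "contrib 2 1 3 1 4 x = 0"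
    "contrib 2 1 3 2 3 x = 0"
    "contrib 2 1 3 2 4 x = - (((W r c)^2 * \<sigma> r c) * (Q r * (psi_im_r r c)^2))"
    "contrib 2 1 3 3 4 x = - (((W r c)^2 * \<sigma> r c) * (X c * (psi_im_c r c)^2))"
    "contrib 2 1 4 1 4 x = ((W r c)^2 * \<sigma> r c) * (Q r * (psi_re_r r c)^2)"
    "contrib 2 1 4 2 3 x = - (((W r c)^2 * \<sigma> r c) * (Q r * (psi_im_r r c)^2))"
    "contrib 2 1 4 2 4 x = 0"
    "contrib 2 1 4 3 4 x = 0"
    "contrib 2 2 3 2 3 x = ((W r c)^2 * \<sigma> r c) * (Q r * (psi_re_r r c)^2)"
    "contrib 2 2 3 2 4 x = 0"
    "contrib 2 2 3 3 4 x = 0"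
    "contrib 2 2 4 2 4 x = ((W r c)^2 * \<sigma> r c) * (Q r * (psi_re_r r c)^2)"
    "contrib 2 2 4 3 4 x = ((W r c)^2 * \<sigma> r c) * (X c * (psi_re_c r c)^2)"
    "contrib 2 3 4 3 4 x = 4 * ((W r c)^2 * \<sigma> r c) * (Q r * (psi_re_r r c)^2)"
    "contrib 3 1 2 1 2 x = 4 * ((W r c)^2 * \<sigma> r c) * (X c * (psi_re_c r c)^2)"
    "contrib 3 1 2 1 3 x = ((W r c)^2 * \<sigma> r c) * (Q r * (psi_re_r r c)^2)"
    "contrib 3 1 2 1 4 x = 0"
    "contrib 3 1 2 2 3 x = 0"
    "contrib 3 1 2 2 4 x = - (((W r c)^2 * \<sigma> r c) * (Q r * (psi_im_r r c)^2))"
    "contrib 3 1 2 3 4 x = - (4 * ((W r c)^2 * \<sigma> r c) * (X c * (psi_im_c r c)^2))"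
    "contrib 3 1 3 1 3 x = ((W r c)^2 * \<sigma> r c) * (X c * (psi_re_c r c)^2)"
    "contrib 3 1 3 1 4 x = 0"
    "contrib 3 1 3 2 3 x = 0"
    "contrib 3 1 3 2 4 x = - (((W r c)^2 * \<sigma> r c) * (X c * (psi_im_c r c)^2))"
    "contrib 3 1 3 3 4 x = - (((W r c)^2 * \<sigma> r c) * (Q r * (psi_im_r r c)^2))"
    "contrib 3 1 4 1 4 x = ((W r c)^2 * \<sigma> r c) * (X c * (psi_re_c r c)^2)"
    "contrib 3 1 4 2 3 x = - (((W r c)^2 * \<sigma> r c) * (X c * (psi_im_c r c)^2))"
    "contrib 3 1 4 2 4 x = 0"
    "contrib 3 1 4 3 4 x = 0"
    "contrib 3 2 3 2 3 x = ((W r c)^2 * \<sigma> r c) * (X c * (psi_re_c r c)^2)"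
    "contrib 3 2 3 2 4 x = 0"
    "contrib 3 2 3 3 4 x = 0"
    "contrib 3 2 4 2 4 x = ((W r c)^2 * \<sigma> r c) * (X c * (psi_re_c r c)^2)"
    "contrib 3 2 4 3 4 x = ((W r c)^2 * \<sigma> r c) * (Q r * (psi_re_r r c)^2)"
    "contrib 3 3 4 3 4 x = 4 * ((W r c)^2 * \<sigma> r c) * (X c * (psi_re_c r c)^2)"
    "contrib 4 1 2 1 2 x = 0"
    "contrib 4 1 2 1 3 x = 0"
    "contrib 4 1 2 1 4 x = ((W r c)^2 * \<sigma> r c) * (Q r * (psi_re_r r c)^2)"
    "contrib 4 1 2 2 3 x = - (((W r c)^2 * \<sigma> r c) * (Q r * (psi_im_r r c)^2))"
    "contrib 4 1 2 2 4 x = 0"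
    "contrib 4 1 2 3 4 x = 0"
    "contrib 4 1 3 1 3 x = 0"
    "contrib 4 1 3 1 4 x = 0"
    "contrib 4 1 3 2 3 x = 0"
    "contrib 4 1 3 2 4 x = 0"
    "contrib 4 1 3 3 4 x = 0"
    "contrib 4 1 4 1 4 x = 0"
    "contrib 4 1 4 2 3 x = 0"
    "contrib 4 1 4 2 4 x = 0"
    "contrib 4 1 4 3 4 x = - (((W r c)^2 * \<sigma> r c) * (Q r * (psi_im_r r c)^2))"
    "contrib 4 2 3 2 3 x = 0"
    "contrib 4 2 3 2 4 x = 0"
    "contrib 4 2 3 3 4 x = ((W r c)^2 * \<sigma> r c) * (Q r * (psi_re_r r c)^2)"
    "contrib 4 2 4 2 4 x = 0"
    "contrib 4 2 4 3 4 x = 0"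
    "contrib 4 3 4 3 4 x = 0"
  unfolding contrib_def frame_cov_values[OF x rc] lift_def rc[symmetric] weight_simps
  using chartD(2-4)[OF x, folded rc] sigma_nonzero[OF chartD(1)[OF x, folded rc]]
  by (simp_all add: field_simps eval_nat_numeral)

text \<open>W^2 \<sigma> Q and W^2 \<sigma> X are the inverse metric components for r and c, so the
  right-hand side is 80 times the real part of the squared gradient of \<Psi>.\<close>

lemma karlhede_psi:
  assumes x: "x \<in> chart" and rc: "r = x $ 2" "c = cos (x $ 3)"
  shows "karlhede_invariant (akds_metric a m \<Lambda> \<alpha>) x = 80 * ((W r c)^2 * \<sigma> r c)
    * (Q r * ((psi_re_r r c)^2 - (psi_im_r r c)^2) + X c * ((psi_re_c r c)^2 - (psi_im_c r c)^2))"
proof -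
  have "karlhede_invariant (akds_metric a m \<Lambda> \<alpha>) x
    = (\<Sum>f\<in>UNIV. \<Sum>i\<in>UNIV. \<Sum>j\<in>UNIV. \<Sum>k\<in>UNIV. \<Sum>l\<in>UNIV. contrib f i j k l x)"
    unfolding contrib_def
    by (rule karlhede_invariant_frame[OF x elementary_riem riemann_components])
  also have "\<dots> = (\<Sum>f\<in>UNIV. 4 * (contrib f 1 2 1 2 x + contrib f 1 3 1 3 x + contrib f 1 4 1 4 x
        + contrib f 2 3 2 3 x + contrib f 2 4 2 4 x + contrib f 3 4 3 4 x)
      + 8 * (contrib f 1 2 1 3 x + contrib f 1 2 1 4 x + contrib f 1 2 2 3 x + contrib f 1 2 2 4 x
      + contrib f 1 2 3 4 x
        + contrib f 1 3 1 4 x + contrib f 1 3 2 3 x + contrib f 1 3 2 4 x + contrib f 1 3 3 4 x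
        + contrib f 1 4 2 3 x + contrib f 1 4 2 4 x + contrib f 1 4 3 4 x
        + contrib f 2 3 2 4 x + contrib f 2 3 3 4 x + contrib f 2 4 3 4 x))"
    by (intro sum.cong refl sum_riemann_symmetric contrib_symmetric[OF x])
  also have "\<dots> = 80 * ((W r c)^2 * \<sigma> r c)
    * (Q r * ((psi_re_r r c)^2 - (psi_im_r r c)^2) + X c * ((psi_re_c r c)^2 - (psi_im_c r c)^2))"
    \<comment> \<open>For each of Q and X the real squares count 4 * 12 + 8 * 4 and the imaginary
      ones 8 * 10, which is 80 in both cases.\<close>
    unfolding sum_4 contrib_values[OF x rc] by (simp add: algebra_simps)
  finally show ?thesis .
qed

section \<open>The coefficients\<close>

text \<open>Real part of (1 - i \<alpha> a) (1 + i \<alpha> a c^2) (r - i a c)^4, where the middle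
  factor is W + \<alpha> c (r + i a c). For the c-derivative the middle factor is \<alpha> r^2 + i
  a, arising from \<alpha> r (r + i a c) + i a W.\<close>

definition num_re_r :: "real \<Rightarrow> real \<Rightarrow> real" where
  "num_re_r r c = (1 + \<alpha>^2 * a^2 * c^2) * (r^4 - 6 * r^2 * a^2 * c^2 + a^4 * c^4)
      - (a * \<alpha> * c^2 - \<alpha> * a) * (4 * r * a^3 * c^3 - 4 * r^3 * a * c)"
definition num_im_r :: "real \<Rightarrow> real \<Rightarrow> real" where
  "num_im_r r c = (1 + \<alpha>^2 * a^2 * c^2) * (4 * r * a^3 * c^3 - 4 * r^3 * a * c)
      + (a * \<alpha> * c^2 - \<alpha> * a) * (r^4 - 6 * r^2 * a^2 * c^2 + a^4 * c^4)"
definition num_re_c :: "real \<Rightarrow> real \<Rightarrow> real" where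
  "num_re_c r c = (\<alpha> * r^2 + \<alpha> * a^2) * (r^4 - 6 * r^2 * a^2 * c^2 + a^4 * c^4)
      - (a - \<alpha>^2 * a * r^2) * (4 * r * a^3 * c^3 - 4 * r^3 * a * c)"
definition num_im_c :: "real \<Rightarrow> real \<Rightarrow> real" where
  "num_im_c r c = (\<alpha> * r^2 + \<alpha> * a^2) * (4 * r * a^3 * c^3 - 4 * r^3 * a * c)
      + (a - \<alpha>^2 * a * r^2) * (r^4 - 6 * r^2 * a^2 * c^2 + a^4 * c^4)"

lemma psi_deriv_values:
  assumes "S r c \<noteq> 0" "W r c \<noteq> 0"
  shows "psi_re_r r c = 3 * m * (W r c)^2 / (S r c)^4 * num_re_r r c"
    and "psi_im_r r c = 3 * m * (W r c)^2 / (S r c)^4 * num_im_r r c"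
    and "psi_re_c r c = 3 * m * (W r c)^2 / (S r c)^4 * num_re_c r c"
    and "psi_im_c r c = 3 * m * (W r c)^2 / (S r c)^4 * num_im_c r c"
proof -
  \<comment> \<open>R + i I = (1 - i \<alpha> a) (r - i a c)^3, so that \<Psi> = - m W^3 (R + i I) /
    S^3.\<close>
  define R I where "R = (r^3 - 3 * r * a^2 * c^2) + \<alpha> * a * (a^3 * c^3 - 3 * r^2 * a * c)"
    and "I = (a^3 * c^3 - 3 * r^2 * a * c) - \<alpha> * a * (r^3 - 3 * r * a^2 * c^2)"
  have u: "\<xi> r c + \<beta> r c = (r + \<alpha> * a^2 * c^3) / (S r c * W r c)"
    and v: "\<gamma> r c + a * \<eta> r c = (\<alpha> * r^3 + a^2 * c) / (S r c * W r c)"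
    unfolding \<xi>_def \<eta>_def \<beta>_def \<gamma>_def using assms
    by (simp_all add: field_simps) (simp_all add: S_def W_def algebra_simps eval_nat_numeral)
  have p: "psi_re r c = - m * (W r c)^3 * R / (S r c)^3" "psi_im r c = - m * (W r c)^3 * I / (S r c)^3"
    by (simp_all add: psi_re_def psi_im_def R_def I_def)
  have "psi_re_r r c = 3 * m * (W r c)^2 / (S r c)^4 * ((r + \<alpha> * a^2 * c^3) * R + a * c * W r c * I)"
    unfolding psi_re_r_def u p \<eta>_def using assms by (simp add: field_simps eval_nat_numeral)
  also have "(r + \<alpha> * a^2 * c^3) * R + a * c * W r c * I = num_re_r r c"
    unfolding R_def I_def W_def num_re_r_def num_im_r_def num_re_c_def num_im_c_def by (simp add:
      algebra_simps eval_nat_numeral)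
  finally show "psi_re_r r c = 3 * m * (W r c)^2 / (S r c)^4 * \<dots>" .
  have "psi_im_r r c = 3 * m * (W r c)^2 / (S r c)^4 * ((r + \<alpha> * a^2 * c^3) * I - a * c * W r c * R)"
    unfolding psi_im_r_def u p \<eta>_def using assms by (simp add: field_simps eval_nat_numeral)
  also have "(r + \<alpha> * a^2 * c^3) * I - a * c * W r c * R = num_im_r r c"
    unfolding R_def I_def W_def num_re_r_def num_im_r_def num_re_c_def num_im_c_def by (simp add:
      algebra_simps eval_nat_numeral)
  finally show "psi_im_r r c = 3 * m * (W r c)^2 / (S r c)^4 * \<dots>" .
  have "psi_re_c r c = 3 * m * (W r c)^2 / (S r c)^4 * ((\<alpha> * r^3 + a^2 * c) * R - a * r * W r c * I)"
    unfolding psi_re_c_def v p \<xi>_def using assms by (simp add: field_simps eval_nat_numeral)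
  also have "(\<alpha> * r^3 + a^2 * c) * R - a * r * W r c * I = num_re_c r c"
    unfolding R_def I_def W_def num_re_r_def num_im_r_def num_re_c_def num_im_c_def by (simp add:
      algebra_simps eval_nat_numeral)
  finally show "psi_re_c r c = 3 * m * (W r c)^2 / (S r c)^4 * \<dots>" .
  have "psi_im_c r c = 3 * m * (W r c)^2 / (S r c)^4 * ((\<alpha> * r^3 + a^2 * c) * I + a * r * W r c * R)"
    unfolding psi_im_c_def v p \<xi>_def using assms by (simp add: field_simps eval_nat_numeral)
  also have "(\<alpha> * r^3 + a^2 * c) * I + a * r * W r c * R = num_im_c r c"
    unfolding R_def I_def W_def num_re_r_def num_im_r_def num_re_c_def num_im_c_def by (simp add:
      algebra_simps eval_nat_numeral)
  finally show "psi_im_c r c = 3 * m * (W r c)^2 / (S r c)^4 * \<dots>" .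
qed

text \<open>
  The coefficients of the powers of \<open>c\<close> in
  \<open>Re ((1 - \<i> \<alpha> a)\<^sup>2 (1 + \<i> \<alpha> a c\<^sup>2)\<^sup>2 (r - \<i> a c)\<^sup>8)\<close> and
  \<open>Re ((1 - \<i> \<alpha> a)\<^sup>2 (\<alpha> r\<^sup>2 + \<i> a)\<^sup>2 (r - \<i> a c)\<^sup>8)\<close>.
\<close>

definition coeffs_Q :: "real \<Rightarrow> real list" where
  "coeffs_Q r = [
    r^8 - \<alpha>^2 * a^2 * r^8,
    - 16 * \<alpha> * a^2 * r^7,
    - 28 * a^2 * r^6 + 4 * \<alpha>^2 * a^2 * r^8 + 28 * \<alpha>^2 * a^4 * r^6,
    16 * \<alpha> * a^2 * r^7 + 112 * \<alpha> * a^4 * r^5 - 16 * \<alpha>^3 * a^4 * r^7,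
    70 * a^4 * r^4 - 112 * \<alpha>^2 * a^4 * r^6 - \<alpha>^2 * a^2 * r^8 - 70 * \<alpha>^2 * a^6 * r^4 + \<alpha>^4 * a^4 * r^8,
    - 112 * \<alpha> * a^4 * r^5 - 112 * \<alpha> * a^6 * r^3 + 16 * \<alpha>^3 * a^4 * r^7 + 112 * \<alpha>^3 * a^6 * r^5,
    - 28 * a^6 * r^2 + 280 * \<alpha>^2 * a^6 * r^4 + 28 * \<alpha>^2 * a^4 * r^6 + 28 * \<alpha>^2 * a^8 * r^2
      - 28 * \<alpha>^4 * a^6 * r^6,
    112 * \<alpha> * a^6 * r^3 + 16 * \<alpha> * a^8 * r - 112 * \<alpha>^3 * a^6 * r^5 - 112 * \<alpha>^3 * a^8 * r^3,
    a^8 - 112 * \<alpha>^2 * a^8 * r^2 - 70 * \<alpha>^2 * a^6 * r^4 - \<alpha>^2 * a^10 + 70 * \<alpha>^4 * a^8 * r^4,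
    - 16 * \<alpha> * a^8 * r + 112 * \<alpha>^3 * a^8 * r^3 + 16 * \<alpha>^3 * a^10 * r,
    4 * \<alpha>^2 * a^10 + 28 * \<alpha>^2 * a^8 * r^2 - 28 * \<alpha>^4 * a^10 * r^2,
    - 16 * \<alpha>^3 * a^10 * r,
    -1 * \<alpha>^2 * a^10 + \<alpha>^4 * a^12]"

definition coeffs_X :: "real \<Rightarrow> real list" where
  "coeffs_X r = [
    -1 * a^2 * r^8 + \<alpha>^2 * r^12 + 4 * \<alpha>^2 * a^2 * r^10 + \<alpha>^2 * a^4 * r^8 - \<alpha>^4 * a^2 * r^12,
    16 * \<alpha> * a^2 * r^9 + 16 * \<alpha> * a^4 * r^7 - 16 * \<alpha>^3 * a^2 * r^11 - 16 * \<alpha>^3 * a^4 * r^9,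
    28 * a^4 * r^6 - 28 * \<alpha>^2 * a^2 * r^10 - 112 * \<alpha>^2 * a^4 * r^8 - 28 * \<alpha>^2 * a^6 * r^6
      + 28 * \<alpha>^4 * a^4 * r^10,
    - 112 * \<alpha> * a^4 * r^7 - 112 * \<alpha> * a^6 * r^5 + 112 * \<alpha>^3 * a^4 * r^9 + 112 * \<alpha>^3 * a^6 * r^7,
    - 70 * a^6 * r^4 + 70 * \<alpha>^2 * a^4 * r^8 + 280 * \<alpha>^2 * a^6 * r^6 + 70 * \<alpha>^2 * a^8 * r^4
      - 70 * \<alpha>^4 * a^6 * r^8,
    112 * \<alpha> * a^6 * r^5 + 112 * \<alpha> * a^8 * r^3 - 112 * \<alpha>^3 * a^6 * r^7 - 112 * \<alpha>^3 * a^8 * r^5,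
    28 * a^8 * r^2 - 28 * \<alpha>^2 * a^6 * r^6 - 112 * \<alpha>^2 * a^8 * r^4 - 28 * \<alpha>^2 * a^10 * r^2
      + 28 * \<alpha>^4 * a^8 * r^6,
    - 16 * \<alpha> * a^8 * r^3 - 16 * \<alpha> * a^10 * r + 16 * \<alpha>^3 * a^8 * r^5 + 16 * \<alpha>^3 * a^10 * r^3,
    -1 * a^10 + \<alpha>^2 * a^8 * r^4 + 4 * \<alpha>^2 * a^10 * r^2 + \<alpha>^2 * a^12 - \<alpha>^4 * a^10 * r^4]"

text \<open>The left-hand sides are the real parts of squares of complex numbers, expanded in powers
  of c.\<close>

lemma sum_coeffs:
  "(num_re_r r c)^2 - (num_im_r r c)^2 = coeffs_Q r ! 0 + coeffs_Q r ! 1 * c + coeffs_Q r ! 2 * c^2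
    + coeffs_Q r ! 3 * c^3
     + coeffs_Q r ! 4 * c^4 + coeffs_Q r ! 5 * c^5 + coeffs_Q r ! 6 * c^6 + coeffs_Q r ! 7 * c^7
       + coeffs_Q r ! 8 * c^8
     + coeffs_Q r ! 9 * c^9 + coeffs_Q r ! 10 * c^10 + coeffs_Q r ! 11 * c^11 + coeffs_Q r ! 12 * c^12"
  "(num_re_c r c)^2 - (num_im_c r c)^2 = coeffs_X r ! 0 + coeffs_X r ! 1 * c + coeffs_X r ! 2 * c^2
    + coeffs_X r ! 3 * c^3
     + coeffs_X r ! 4 * c^4 + coeffs_X r ! 5 * c^5 + coeffs_X r ! 6 * c^6 + coeffs_X r ! 7 * c^7
       + coeffs_X r ! 8 * c^8"
  unfolding num_re_r_def num_im_r_def num_re_c_def num_im_c_def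
  by (simp add: coeffs_Q_def, simp add: algebra_simps eval_nat_numeral)
    (simp add: coeffs_X_def, simp add: algebra_simps eval_nat_numeral)

text \<open>Q is constant in c, while X is a quartic with coefficients 1, - 2 \<alpha> m, \<kappa> -
  1, 2 \<alpha> m, - \<kappa>; each line is the resulting convolution with \<open>coeffs_X\<close>.
  The overall minus matches the negative prefactor of the invariant.\<close>

lemma karlhede_coeffs_values:
  assumes \<kappa>: "\<kappa> = (\<alpha>^2 + \<Lambda> / 3) * a^2" and L: "\<Lambda> = 3 * L"
  shows
    "karlhede_coeffs a m \<Lambda> \<alpha> r ! 0 = - (Q r * coeffs_Q r ! 0 + (coeffs_X r ! 0))"
    "karlhede_coeffs a m \<Lambda> \<alpha> r ! 1 = - (Q r * coeffs_Q r ! 1 + (coeffs_X r ! 1 +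
      - (2 * \<alpha> * m) * coeffs_X r ! 0))"
    "karlhede_coeffs a m \<Lambda> \<alpha> r ! 2 = - (Q r * coeffs_Q r ! 2 + (coeffs_X r ! 2 +
      - (2 * \<alpha> * m) * coeffs_X r ! 1 + (\<kappa> - 1) * coeffs_X r ! 0))"
    "karlhede_coeffs a m \<Lambda> \<alpha> r ! 3 = - (Q r * coeffs_Q r ! 3 + (coeffs_X r ! 3 +
      - (2 * \<alpha> * m) * coeffs_X r ! 2 + (\<kappa> - 1) * coeffs_X r ! 1 + (2 * \<alpha> * m) * coeffs_X r ! 0))"
    "karlhede_coeffs a m \<Lambda> \<alpha> r ! 4 = - (Q r * coeffs_Q r ! 4 + (coeffs_X r ! 4 +
      - (2 * \<alpha> * m) * coeffs_X r ! 3 + (\<kappa> - 1) * coeffs_X r ! 2 + (2 * \<alpha> * m) * coeffs_X r ! 1 +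
      - \<kappa> * coeffs_X r ! 0))"
    "karlhede_coeffs a m \<Lambda> \<alpha> r ! 5 = - (Q r * coeffs_Q r ! 5 + (coeffs_X r ! 5 +
      - (2 * \<alpha> * m) * coeffs_X r ! 4 + (\<kappa> - 1) * coeffs_X r ! 3 + (2 * \<alpha> * m) * coeffs_X r ! 2 +
      - \<kappa> * coeffs_X r ! 1))"
    "karlhede_coeffs a m \<Lambda> \<alpha> r ! 6 = - (Q r * coeffs_Q r ! 6 + (coeffs_X r ! 6 +
      - (2 * \<alpha> * m) * coeffs_X r ! 5 + (\<kappa> - 1) * coeffs_X r ! 4 + (2 * \<alpha> * m) * coeffs_X r ! 3 +
      - \<kappa> * coeffs_X r ! 2))"
    "karlhede_coeffs a m \<Lambda> \<alpha> r ! 7 = - (Q r * coeffs_Q r ! 7 + (coeffs_X r ! 7 +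
      - (2 * \<alpha> * m) * coeffs_X r ! 6 + (\<kappa> - 1) * coeffs_X r ! 5 + (2 * \<alpha> * m) * coeffs_X r ! 4 +
      - \<kappa> * coeffs_X r ! 3))"
    "karlhede_coeffs a m \<Lambda> \<alpha> r ! 8 = - (Q r * coeffs_Q r ! 8 + (coeffs_X r ! 8 +
      - (2 * \<alpha> * m) * coeffs_X r ! 7 + (\<kappa> - 1) * coeffs_X r ! 6 + (2 * \<alpha> * m) * coeffs_X r ! 5 +
      - \<kappa> * coeffs_X r ! 4))"
    "karlhede_coeffs a m \<Lambda> \<alpha> r ! 9 = - (Q r * coeffs_Q r ! 9 + (- (2 * \<alpha> * m) * coeffs_X r ! 8 + (\<kappa>
      - 1) * coeffs_X r ! 7 + (2 * \<alpha> * m) * coeffs_X r ! 6 + - \<kappa> * coeffs_X r ! 5))"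
    "karlhede_coeffs a m \<Lambda> \<alpha> r ! 10 = - (Q r * coeffs_Q r ! 10 + ((\<kappa> - 1) * coeffs_X r ! 8
      + (2 * \<alpha> * m) * coeffs_X r ! 7 + - \<kappa> * coeffs_X r ! 6))"
    "karlhede_coeffs a m \<Lambda> \<alpha> r ! 11 = - (Q r * coeffs_Q r ! 11 + ((2 * \<alpha> * m) * coeffs_X r ! 8 +
      - \<kappa> * coeffs_X r ! 7))"
    "karlhede_coeffs a m \<Lambda> \<alpha> r ! 12 = - (Q r * coeffs_Q r ! 12 + (- \<kappa> * coeffs_X r ! 8))"
  unfolding \<kappa> Q_def unfolding L
  by (simp_all add: karlhede_coeffs_def coeffs_Q_def coeffs_X_def)
    (simp_all add: field_simps eval_nat_numeral)

lemma sum_karlhede_coeffs: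
  "(\<Sum>i=0..12. karlhede_coeffs a m \<Lambda> \<alpha> r ! i * c^i)
   = - (Q r * ((num_re_r r c)^2 - (num_im_r r c)^2) + X c * ((num_re_c r c)^2 - (num_im_c r c)^2))"
proof -
  have *: "(\<Sum>i=0..12. f i) = f 0 + f 1 + f 2 + f 3 + f 4 + f 5 + f 6 + f 7 + f 8 + f 9 + f 10 + f 11 + f 12"
    for f :: "nat \<Rightarrow> real"
    by (simp add: eval_nat_numeral)
  define \<kappa> where "\<kappa> = (\<alpha>^2 + \<Lambda> / 3) * a^2"
  have L: "\<Lambda> = 3 * (\<Lambda> / 3)" by simp
  have X: "X c = 1 - 2 * \<alpha> * m * c + (\<kappa> - 1) * c^2 + 2 * \<alpha> * m * c^3 - \<kappa> * c^4"
    unfolding X_def \<kappa>_def by (simp add: field_simps eval_nat_numeral)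
  show ?thesis
    unfolding * sum_coeffs karlhede_coeffs_values[OF \<kappa>_def L] X
    by (simp add: algebra_simps eval_nat_numeral)
qed

end

theorem theorem36:
  fixes a m \<Lambda> \<alpha> t r \<theta> \<phi> :: real
  assumes "akds_Omega \<alpha> r \<theta> > 0"
    and "akds_rho2 a r \<theta> \<noteq> 0"
    and "akds_Q a m \<Lambda> \<alpha> r \<noteq> 0"
    and "akds_P a m \<Lambda> \<alpha> \<theta> > 0"
    and "sin \<theta> \<noteq> 0"
  shows "karlhede_invariant (akds_metric a m \<Lambda> \<alpha>) (vector [t, r, \<theta>, \<phi>]) =
    (- 720 * m^2 * (\<alpha> * r * cos \<theta> - 1)^6) / (r^2 + a^2 * (cos \<theta>)^2)^9
      * (\<Sum>i=0..12. karlhede_coeffs a m \<Lambda> \<alpha> r ! i * (cos \<theta>)^i)"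
proof -
  interpret akds a m \<Lambda> \<alpha> .
  let ?c = "cos \<theta>"
  have X: "X ?c = akds_P a m \<Lambda> \<alpha> \<theta> * (sin \<theta>)^2"
    by (simp add: X_def akds_P_def sin_squared_eq)
  have nz: "S r ?c \<noteq> 0" "W r ?c \<noteq> 0" "Q r \<noteq> 0" "X ?c \<noteq> 0"
    using assms unfolding X by (auto simp: S_def W_def Q_def akds_rho2_def akds_Omega_def akds_Q_def)
  then have x: "vector [t, r, \<theta>, \<phi>] \<in> chart"
    by (simp add: chart_def regular_def)
  have "\<alpha> * r * ?c - 1 = - W r ?c" by (simp add: W_def)
  then have W: "(\<alpha> * r * ?c - 1)^6 = (W r ?c)^6" by simp
  \<comment> \<open>The derivatives of \<Psi> carry the common factor 3 m W^2 / S^4; its square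
    times 80 W^2 / S is 720 m^2 W^6 / S^9.\<close>
  show ?thesis
    unfolding karlhede_psi[OF x refl refl] sum_karlhede_coeffs W S_def[symmetric]
    using nz by (simp add: psi_deriv_values[OF nz(1,2)] \<sigma>_def power_mult_distrib power_divide) (simp add:
      field_simps eval_nat_numeral)
qed

end
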